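(* Let $d\ge2$, $1<\alpha<2$, $1<q<d+\alpha$ and $1<p<\infty$. There exist constants $c_{d,p,q,\alpha}$ and $c$, depending only on $d,p,q,\alpha$, such that for every measurable $b=b_{\mathfrak s}+b_{\mathfrak b}:\mathbb R^{d+1}\to\mathbb R^d$ with $b_{\mathfrak b}\in L^\infty(\mathbb R^{d+1})$ and $|b_{\mathfrak s}|^{\frac1{\alpha-1}}\in E_q$, for all $\lambda>0$ and for both choices of sign, $$\big\||b|^{\frac1p}(\lambda\pm\partial_t+(-\Delta)^{\frac\alpha2})^{(-1+\frac1\alpha)\frac1p}\big\|_{L^p(\mathbb R^{d+1})\to L^p(\mathbb R^{d+1})}\le c_{d,p,q,\alpha}\,\||b_{\mathfrak s}|^{\frac1{\alpha-1}}\|_{E_q}^{\frac{\alpha-1}p}+c\,\lambda^{(-1+\frac1\alpha)\frac1p}\,\|b_{\mathfrak b}\|_{L^\infty(\mathbb R^{d+1})}^{\frac1p}.$$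
   Context: Points of $\mathbb R^{d+1}$ are written $(t,x)$, $t\in\mathbb R$, $x\in\mathbb R^d$. For $q>1$, $v\in L^q_{\rm loc}(\mathbb R^{d+1})$ is in the Morrey class $E_q$ if $$\|v\|_{E_q}:=\sup_{\rho>0,(t,x)\in\mathbb R^{d+1}}\rho\Big(\frac1{|C_\rho(t,x)|}\int_{C_\rho(t,x)}|v(s,y)|^q\,ds\,dy\Big)^{1/q}<\infty,\quad C_\rho(t,x)=\{(s,y):t\le s\le t+\rho^\alpha,\ |y-x|\le\rho\}.$$ Let $q_2(t,\cdot)$, $t>0$, be the convolution kernel of $e^{-t(-\Delta)^{\alpha/2}}$ on $\mathbb R^d$; for $0<\gamma\le2$ set $q_\gamma(t,x)=\mathbf 1_{\{t>0\}}\Gamma(\gamma/2)^{-1}t^{\frac\gamma2-1}q_2(t,x)$. Then $$(\lambda+\partial_t+(-\Delta)^{\frac\alpha2})^{-\frac\gamma2}f(t,x)=\int_{\mathbb R^{d+1}}e^{-\lambda(t-s)}q_\gamma(t-s,x-y)f(s,y)\,dy\,ds,$$ $$(\lambda-\partial_t+(-\Delta)^{\frac\alpha2})^{-\frac\gamma2}f(t,x)=\int_{\mathbb R^{d+1}}e^{-\lambda(s-t)}q_\gamma(s-t,x-y)f(s,y)\,dy\,ds.$$ *)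

theory Defs
  imports "HOL-Analysis.Analysis" "HOL-Probability.Essential_Supremum"
begin

subsection \<open>Lebesgue spaces and operator norms\<close>

definition Lp_space :: "real \<Rightarrow> ('a::euclidean_space \<Rightarrow> real) set" where
  "Lp_space p = {f \<in> borel_measurable lebesgue. integrable lebesgue (\<lambda>z. \<bar>f z\<bar> powr p)}"

definition Lp_norm :: "real \<Rightarrow> ('a::euclidean_space \<Rightarrow> real) \<Rightarrow> ennreal" where
  "Lp_norm p f =
     (if f \<in> Lp_space p then ennreal ((LINT z|lebesgue. \<bar>f z\<bar> powr p) powr (1 / p)) else \<infinity>)"

definition Lp_opnorm ::
    "real \<Rightarrow> (('a::euclidean_space \<Rightarrow> real) \<Rightarrow> 'a \<Rightarrow> real) \<Rightarrow> ennreal" where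
  "Lp_opnorm p T = (SUP f \<in> {f \<in> Lp_space p. Lp_norm p f \<le> 1}. Lp_norm p (T f))"

definition Lp_loc :: "real \<Rightarrow> ('a::euclidean_space \<Rightarrow> real) set" where
  "Lp_loc q = {v \<in> borel_measurable lebesgue.
     \<forall>K. compact K \<longrightarrow> set_integrable lebesgue K (\<lambda>z. \<bar>v z\<bar> powr q)}"

definition Linf_norm :: "('a::euclidean_space \<Rightarrow> 'b::euclidean_space) \<Rightarrow> ennreal" where
  "Linf_norm f = esssup lebesgue (\<lambda>z. ennreal (norm (f z)))"

definition Linf_space :: "('a::euclidean_space \<Rightarrow> 'b::euclidean_space) set" where
  "Linf_space = {f \<in> borel_measurable lebesgue. Linf_norm f < \<infinity>}"

subsection \<open>Parabolic Morrey classes\<close>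

definition par_cylinder :: "real \<Rightarrow> real \<Rightarrow> real \<times> 'a::euclidean_space \<Rightarrow> (real \<times> 'a) set" where
  "par_cylinder \<alpha> \<rho> = (\<lambda>(t, x). {(s, y). t \<le> s \<and> s \<le> t + \<rho> powr \<alpha> \<and> norm (y - x) \<le> \<rho>})"

definition morrey_norm :: "real \<Rightarrow> real \<Rightarrow> (real \<times> 'a::euclidean_space \<Rightarrow> real) \<Rightarrow> ennreal" where
  "morrey_norm \<alpha> q v =
     (SUP \<rho> \<in> {0<..}. SUP z. ennreal (\<rho> *
        (1 / measure lebesgue (par_cylinder \<alpha> \<rho> z) *
          (LINT w:par_cylinder \<alpha> \<rho> z|lebesgue. \<bar>v w\<bar> powr q)) powr (1 / q)))"

definition morrey_class :: "real \<Rightarrow> real \<Rightarrow> (real \<times> 'a::euclidean_space \<Rightarrow> real) set" where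
  "morrey_class \<alpha> q = {v \<in> Lp_loc q. morrey_norm \<alpha> q v < \<infinity>}"

subsection \<open>Fractional powers of the parabolic resolvent\<close>

text \<open>The semigroup generated by minus the fractional Laplacian is the Fourier multiplier with
  symbol \<open>exp (- t * norm \<xi> powr \<alpha>)\<close>, so its convolution kernel is the inverse Fourier
  transform of this symbol.  The symbol is even, hence the transform is real valued and \<open>Re\<close>
  is only a type conversion.\<close>

definition inverse_fourier :: "('a::euclidean_space \<Rightarrow> complex) \<Rightarrow> 'a \<Rightarrow> complex" where
  "inverse_fourier m x =
     complex_of_real (1 / (2 * pi) ^ DIM('a)) * (LINT \<xi>|lebesgue. exp (\<i> * of_real (x \<bullet> \<xi>)) * m \<xi>)"

definition stable_kernel :: "real \<Rightarrow> real \<Rightarrow> 'a::euclidean_space \<Rightarrow> real" where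
  "stable_kernel \<alpha> t x = Re (inverse_fourier (\<lambda>\<xi>. of_real (exp (- t * norm \<xi> powr \<alpha>))) x)"

definition par_kernel :: "real \<Rightarrow> real \<Rightarrow> real \<Rightarrow> 'a::euclidean_space \<Rightarrow> real" where
  "par_kernel \<alpha> \<gamma> t x =
     (if t > 0 then 1 / Gamma (\<gamma> / 2) * t powr (\<gamma> / 2 - 1) * stable_kernel \<alpha> t x else 0)"

text \<open>For \<open>\<sigma> = 1\<close> and \<open>\<sigma> = - 1\<close> the following are the integrand and the value at \<open>z\<close> of
  \<open>(lam + \<sigma> \<partial>\<^sub>t + (- \<Delta>) powr (\<alpha> / 2)) powr (- \<gamma> / 2)\<close> applied to \<open>f\<close>.\<close>

definition resolvent_integrand ::
    "real \<Rightarrow> real \<Rightarrow> real \<Rightarrow> real \<Rightarrow> (real \<times> 'a::euclidean_space \<Rightarrow> real) \<Rightarrow> real \<times> 'a \<Rightarrow> real \<times> 'a \<Rightarrow> real"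
  where
  "resolvent_integrand \<alpha> \<sigma> lam \<gamma> f = (\<lambda>(t, x) (s, y).
     exp (- lam * (\<sigma> * (t - s))) * par_kernel \<alpha> \<gamma> (\<sigma> * (t - s)) (x - y) * f (s, y))"

definition frac_resolvent ::
    "real \<Rightarrow> real \<Rightarrow> real \<Rightarrow> real \<Rightarrow> (real \<times> 'a::euclidean_space \<Rightarrow> real) \<Rightarrow> real \<times> 'a \<Rightarrow> real"
  where
  "frac_resolvent \<alpha> \<sigma> lam \<gamma> f z = (LINT w|lebesgue. resolvent_integrand \<alpha> \<sigma> lam \<gamma> f z w)"

end

theory Submission
  imports Defs
begin

text \<open>The kernel of the fractional resolvent is bounded, up to a constant, by the parabolic Riesz
  kernel of order \<open>\<kappa> = (\<alpha> - 1) / p\<close>, so the part with \<open>b\<^sub>s\<close> is a weighted estimate of Fefferman--Phong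
  type. It is proved by Schur's test: if \<open>u\<close> is the potential of small order of
  \<open>norm b\<^sub>s powr (q / (\<alpha> - 1))\<close>, then \<open>u\<close> is an \<open>A\<^sub>1\<close> weight with a Morrey bound, and a suitable power of
  \<open>u\<close> is a Schur weight. The part with \<open>b\<^sub>b\<close> only needs the \<open>L\<^sup>1\<close> norm of the kernel. The decay of the stable
  kernel follows by applying \<open>d + 2\<close> finite differences to its Fourier multiplier.\<close>

subsection \<open>Integrals of powers and Schur's test\<close>

text \<open>With \<open>g = norm b\<^sub>s powr (q / (\<alpha> - 1))\<close>, the Morrey condition
  bounds averages of \<open>g\<close> over parabolic balls of radius \<open>\<rho>\<close> by a
  multiple of \<open>\<rho> powr (- q)\<close>, and the weight is \<open>g powr e\<close> with
  \<open>e = (\<alpha> - 1) / q\<close>. As \<open>e < 1\<close>, averages of the weight are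
  controlled by those of \<open>g\<close>, and the room left in the exponent admits a small power of
  \<open>u\<close> beside it. The Morrey bound blows up at small radii, where the pointwise bound by
  \<open>u\<close> replaces it; a potential, rather than a maximal function, keeps the argument
  within Fubini for averages. Integrating the smaller of the two bounds over all radii, as in
  Hedberg's inequality, yields a power of \<open>u\<close> again, and a count of homogeneities
  closes Schur's test. The Riesz kernel is even in time, so both signs are treated at once. The
  multiplier \<open>exp (- t * norm \<xi> powr \<alpha>)\<close> is not smooth at the origin, and
  the bound for its derivatives of order \<open>d + 2\<close> is not integrable there. Finite
  differences meet no singularity: near the origin they are bounded by size alone, and derivatives
  are used only away from it.\<close>

lemma weighted_amgm:
  fixes x y a b :: real
  assumes "0 \<le> a" "0 \<le> b" "a + b \<le> 1" "0 \<le> x" "0 \<le> y"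
  shows "x powr a * y powr b \<le> a * x + b * y + (1 - a - b)"
proof (cases "x = 0 \<or> y = 0")
  case True
  then show ?thesis using assms by auto
next
  case False
  \<comment> \<open>The missing weight goes to a third number 1, so that the weights sum to 1. Then
    \<open>ln r \<le> r - 1\<close> is applied to the three quotients by the mean \<open>s\<close>;
    the weighted sum of the right-hand sides cancels.\<close>
  define c where "c = 1 - a - b"
  define s where "s = a * x + b * y + c"
  have xy: "x > 0" "y > 0" and c: "c \<ge> 0" using False assms by (auto simp: c_def)
  have "s > 0"
  proof -
    have "a > 0 \<or> b > 0 \<or> c > 0" using assms by (auto simp: c_def)
    moreover have "a * x \<ge> 0" "b * y \<ge> 0" using assms by auto
    moreover have "a > 0 \<Longrightarrow> a * x > 0" "b > 0 \<Longrightarrow> b * y > 0" using xy by auto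
    ultimately show ?thesis unfolding s_def using c by fastforce
  qed
  have l: "ln (x / s) \<le> x / s - 1" "ln (y / s) \<le> y / s - 1" "ln (1 / s) \<le> 1 / s - 1"
    using xy \<open>s > 0\<close> by (auto intro!: ln_le_minus_one)
  have "a * ln (x / s) + b * ln (y / s) + c * ln (1 / s)
      \<le> a * (x / s - 1) + b * (y / s - 1) + c * (1 / s - 1)"
    using l assms c by (intro add_mono mult_left_mono) auto
  also have "\<dots> = (a * x + b * y + c) / s - (a + b + c)"
    by (simp add: field_simps add_divide_distrib)
  also have "\<dots> = 0" using \<open>s > 0\<close> unfolding s_def[symmetric] by (simp add: c_def)
  finally have "a * ln x + b * ln y \<le> (a + b + c) * ln s"
    using xy \<open>s > 0\<close> by (simp add: ln_div algebra_simps)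
  then have "a * ln x + b * ln y \<le> ln s" by (simp add: c_def)
  then have "exp (a * ln x + b * ln y) \<le> s"
    using \<open>s > 0\<close> by (metis exp_le_cancel_iff exp_ln)
  then show ?thesis using xy by (simp add: powr_def exp_add s_def c_def)
qed

lemma nn_integral_powr_from_0:
  fixes e R :: real
  assumes "e > 0" "R \<ge> 0"
  shows "(\<integral>\<^sup>+r\<in>{0..R}. ennreal (r powr (e - 1)) \<partial>lborel) = ennreal (R powr e / e)"
proof -
  have "((\<lambda>x. x powr (e - 1)) has_integral (R powr (e - 1 + 1) / (e - 1 + 1))) {0..R}"
    using assms by (intro has_integral_powr_from_0) auto
  then have "((\<lambda>x. if x \<in> {0..R} then x powr (e - 1) else 0) has_integral (R powr e / e)) UNIV"
    by (subst has_integral_restrict_UNIV) auto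
  from nn_integral_has_integral_lborel[OF _ _ this] have "(\<integral>\<^sup>+x. ennreal (if x \<in> {0..R} then x powr (e - 1) else 0) \<partial>lborel) = ennreal (R powr e / e)"
    by auto
  also have "?this \<longleftrightarrow> ?thesis"
    by (intro arg_cong2[where f="(=)"] nn_integral_cong) (auto simp: indicator_def)
  finally show ?thesis .
qed

lemma nn_integral_powr_to_inf:
  fixes s R :: real
  assumes "s > 0" "R > 0"
  shows "(\<integral>\<^sup>+r\<in>{R..}. ennreal (r powr (- s - 1)) \<partial>lborel) = ennreal (R powr (- s) / s)"
proof -
  have "((\<lambda>x. x powr (- s - 1)) has_integral (- (R powr (- s - 1 + 1)) / (- s - 1 + 1))) {R..}"
    using assms by (intro has_integral_powr_to_inf) auto
  then have "((\<lambda>x. if x \<in> {R..} then x powr (- s - 1) else 0) has_integral (R powr (- s) / s)) UNIV"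
    by (subst has_integral_restrict_UNIV) auto
  from nn_integral_has_integral_lborel[OF _ _ this] have "(\<integral>\<^sup>+x. ennreal (if x \<in> {R..} then x powr (- s - 1) else 0) \<partial>lborel) = ennreal (R powr (- s) / s)"
    by auto
  also have "?this \<longleftrightarrow> ?thesis"
    by (intro arg_cong2[where f="(=)"] nn_integral_cong) (auto simp: indicator_def)
  finally show ?thesis .
qed

text \<open>Hedberg's splitting: below the radius where the two bounds agree the constant
  \<open>u\<close> is used, beyond it the decaying bound, and both pieces give the same product of
  powers of \<open>u\<close> and \<open>B\<close>. The condition \<open>0 < e\<close> is convergence
  at 0, and \<open>e < m * f\<close> is convergence at infinity.\<close>

lemma nn_integral_powr_min:
  fixes e f m u B :: real
  assumes "0 < e" "e < m * f" "0 < m" "0 < u" "0 < B"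
  shows "(\<integral>\<^sup>+r\<in>{0<..}. ennreal (r powr (e - 1) * min u (B * r powr (- m)) powr f) \<partial>lborel)
    \<le> ennreal ((1 / e + 1 / (m * f - e)) * (u powr (f - e / m) * B powr (e / m)))"
proof -
  have f: "f > 0" using assms by (smt (verit) mult_nonneg_nonpos)
  \<comment> \<open>The two bounds agree here: \<open>u = B * R powr (- m)\<close>.\<close>
  define R where "R = (B / u) powr (1 / m)"
  have R: "R > 0" using assms by (simp add: R_def)
  have Re: "R powr e = B powr (e / m) * u powr (- (e / m))"
    using assms by (simp add: R_def powr_powr powr_divide powr_minus field_simps)
  have Rf: "R powr (- (m * f - e)) = B powr (e / m - f) * u powr (f - e / m)"
  proof -
    have "R powr (- (m * f - e)) = (B / u) powr (e / m - f)"
      using assms by (simp add: R_def powr_powr field_simps)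
    also have "\<dots> = B powr (e / m - f) * u powr (- (e / m - f))"
      using assms by (simp add: powr_divide powr_minus field_simps)
    also have "- (e / m - f) = f - e / m" by simp
    finally show ?thesis .
  qed
  have pw: "r powr (e - 1) * min u (B * r powr (- m)) powr f * indicator {0<..} r
     \<le> u powr f * (r powr (e - 1) * indicator {0..R} r)
       + B powr f * (r powr (- (m * f - e) - 1) * indicator {R..} r)" for r :: real
  proof (cases "r \<le> R")
    case True
    have "r powr (e - 1) * min u (B * r powr (- m)) powr f \<le> r powr (e - 1) * u powr f"
      using assms f by (intro mult_left_mono powr_mono2) auto
    then have "r powr (e - 1) * min u (B * r powr (- m)) powr f * indicator {0<..} r
      \<le> u powr f * (r powr (e - 1) * indicator {0..R} r)"
      using True by (auto simp: indicator_def mult.commute)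
    moreover have "B powr f * (r powr (- (m * f - e) - 1) * indicator {R..} r) \<ge> 0"
      by (simp add: indicator_def)
    ultimately show ?thesis by linarith
  next
    case False
    then have r: "r > R" "r > 0" using R by auto
    have "r powr (e - 1) * min u (B * r powr (- m)) powr f \<le> r powr (e - 1) * (B * r powr (- m)) powr f"
      using assms f by (intro mult_left_mono powr_mono2) auto
    also have "\<dots> = B powr f * r powr (- (m * f - e) - 1)"
    proof -
      have "(B * r powr (- m)) powr f = B powr f * r powr (- (m * f))"
        using assms r by (simp add: powr_mult powr_powr)
      moreover have "r powr (- (m * f - e) - 1) = r powr (e - 1) * r powr (- (m * f))"
        by (simp add: powr_add[symmetric] algebra_simps)
      ultimately show ?thesis by simp
    qed
    finally show ?thesis using r by (auto simp: indicator_def)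
  qed
  have "(\<integral>\<^sup>+r\<in>{0<..}. ennreal (r powr (e - 1) * min u (B * r powr (- m)) powr f) \<partial>lborel)
     = (\<integral>\<^sup>+r. ennreal (r powr (e - 1) * min u (B * r powr (- m)) powr f * indicator {0<..} r) \<partial>lborel)"
    by (intro nn_integral_cong) (auto simp: indicator_def)
  also have "\<dots> \<le> (\<integral>\<^sup>+r. ennreal (u powr f * (r powr (e - 1) * indicator {0..R} r)
       + B powr f * (r powr (- (m * f - e) - 1) * indicator {R..} r)) \<partial>lborel)"
    using pw by (intro nn_integral_mono ennreal_leI) auto
  also have "\<dots> = (\<integral>\<^sup>+r. ennreal (u powr f) * (ennreal (r powr (e - 1)) * indicator {0..R} r) +
     ennreal (B powr f) * (ennreal (r powr (- (m * f - e) - 1)) * indicator {R..} r) \<partial>lborel)"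
    by (intro nn_integral_cong) (auto simp: indicator_def ennreal_mult')
  also have "\<dots> = ennreal (u powr f) * ennreal (R powr e / e)
      + ennreal (B powr f) * ennreal (R powr (- (m * f - e)) / (m * f - e))"
    using nn_integral_powr_from_0[of e R] nn_integral_powr_to_inf[of "m * f - e" R] assms R
    by (subst nn_integral_add) (auto simp: nn_integral_cmult)
  also have "\<dots> = ennreal (u powr f * (R powr e / e) + B powr f * (R powr (- (m * f - e)) / (m * f - e)))"
    using assms by (subst ennreal_plus) (auto simp: ennreal_mult' simp del: times_divide_eq_right)
  also have "u powr f * (R powr e / e) + B powr f * (R powr (- (m * f - e)) / (m * f - e)) =
     (1 / e) * (B powr (e / m) * (u powr f * u powr (- (e / m))))
      + (1 / (m * f - e)) * ((B powr f * B powr (e / m - f)) * u powr (f - e / m))"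
    unfolding Re Rf by (simp add: field_simps)
  also have "\<dots> = (1 / e + 1 / (m * f - e)) * (u powr (f - e / m) * B powr (e / m))"
    using assms by (simp add: powr_add[symmetric] distrib_left distrib_right mult_ac)
  finally show ?thesis .
qed

lemma nn_integral_lborel_diff:
  fixes h :: "'a::euclidean_space \<Rightarrow> ennreal"
  assumes [measurable]: "h \<in> borel_measurable borel"
  shows "(\<integral>\<^sup>+w. h (z - w) \<partial>lborel) = (\<integral>\<^sup>+w. h w \<partial>lborel)"
    and "(\<integral>\<^sup>+w. h (w - z) \<partial>lborel) = (\<integral>\<^sup>+w. h w \<partial>lborel)"
proof -
  have "(lborel :: 'a measure) = density (distr lborel borel (\<lambda>x. z + (-1) *\<^sub>R x)) (\<lambda>_. ennreal (\<bar>-1\<bar>^DIM('a)))"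
    using lborel_affine[of "-1" z] by simp
  then have d: "(lborel :: 'a measure) = distr lborel borel (\<lambda>x. z - x)" by (simp add: density_1)
  show "(\<integral>\<^sup>+w. h (z - w) \<partial>lborel) = (\<integral>\<^sup>+w. h w \<partial>lborel)"
    by (subst (2) d, subst nn_integral_distr) auto
  have "(lborel :: 'a measure) = density (distr lborel borel (\<lambda>x. - z + 1 *\<^sub>R x)) (\<lambda>_. ennreal (\<bar>1\<bar>^DIM('a)))"
    using lborel_affine[of 1 "-z"] by simp
  then have e: "(lborel :: 'a measure) = distr lborel borel (\<lambda>x. x - z)" by (simp add: density_1)
  show "(\<integral>\<^sup>+w. h (w - z) \<partial>lborel) = (\<integral>\<^sup>+w. h w \<partial>lborel)"
    by (subst (2) e, subst nn_integral_distr) auto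
qed

text \<open>With \<open>\<theta> = F / s\<close>, Young's inequality
  \<open>x \<le> \<theta> powr (1 - p) * x powr p / p + (1 - 1 / p) * \<theta>\<close> for \<open>x = f / \<sigma>\<close> gives Hoelder's
  inequality without powers of extended reals.\<close>

lemma Holder_pointwise:
  fixes f \<sigma> :: "'a \<Rightarrow> real" and k :: "'a \<Rightarrow> ennreal"
  assumes p: "1 < p"
    and [measurable]: "k \<in> borel_measurable M" "f \<in> borel_measurable M" "\<sigma> \<in> borel_measurable M"
    and pos: "AE w in M. 0 < \<sigma> w"
    and s: "0 < s" "(\<integral>\<^sup>+w. k w * ennreal (\<sigma> w) \<partial>M) \<le> ennreal s"
    and F: "0 \<le> F" "ennreal F \<le> (\<integral>\<^sup>+w. k w * ennreal \<bar>f w\<bar> \<partial>M)"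
  shows "ennreal (F powr p) \<le> ennreal (s powr (p - 1)) *
    (\<integral>\<^sup>+w. k w * ennreal (\<bar>f w\<bar> powr p * \<sigma> w powr (1 - p)) \<partial>M)" (is "_ \<le> _ * ?G")
proof (cases "F = 0 \<or> ?G = \<infinity>")
  case True
  then show ?thesis using s p by (auto simp: ennreal_mult_top)
next
  case False
  then have F0: "F > 0" using F by auto
  obtain G where G: "?G = ennreal G" "G \<ge> 0" using False by (cases ?G) auto
  define \<theta> where "\<theta> = F / s"
  have \<theta>: "\<theta> > 0" using F0 s by (simp add: \<theta>_def)
  have young: "\<bar>f w\<bar> \<le> (\<theta> powr (1 - p) / p) * (\<bar>f w\<bar> powr p * \<sigma> w powr (1 - p)) + ((1 - 1 / p) * \<theta>) * \<sigma> w"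
    if "\<sigma> w > 0" for w
  proof -
    define x where "x = \<bar>f w\<bar> / (\<sigma> w * \<theta>)"
    have x: "x \<ge> 0" using that \<theta> by (simp add: x_def)
    have "x \<le> (1 / p) * x powr p + (1 - 1 / p)"
      using weighted_amgm[of "1 / p" 0 "x powr p" 1] p x by (simp add: powr_powr)
    then have "\<sigma> w * \<theta> * x \<le> \<sigma> w * \<theta> * ((1 / p) * x powr p + (1 - 1 / p))"
      using that \<theta> by (intro mult_left_mono) auto
    also have "\<sigma> w * \<theta> * x = \<bar>f w\<bar>" using that \<theta> by (simp add: x_def)
    also have "x powr p = \<bar>f w\<bar> powr p / (\<sigma> w powr p * \<theta> powr p)"
      using that \<theta> by (simp add: x_def powr_divide powr_mult)
    finally show ?thesis using that \<theta> p by (simp add: powr_diff field_simps)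
  qed
  have "ennreal F \<le> (\<integral>\<^sup>+w. k w * ennreal \<bar>f w\<bar> \<partial>M)" by (rule F)
  also have "\<dots> \<le> (\<integral>\<^sup>+w. ennreal (\<theta> powr (1 - p) / p) * (k w * ennreal (\<bar>f w\<bar> powr p * \<sigma> w powr (1 - p)))
        + ennreal ((1 - 1 / p) * \<theta>) * (k w * ennreal (\<sigma> w)) \<partial>M)"
  proof (rule nn_integral_mono_AE, use pos in eventually_elim)
    fix w assume w: "0 < \<sigma> w"
    have "ennreal \<bar>f w\<bar> \<le> ennreal ((\<theta> powr (1 - p) / p) * (\<bar>f w\<bar> powr p * \<sigma> w powr (1 - p)) + ((1 - 1 / p) * \<theta>) * \<sigma> w)"
      using young[OF w] by (rule ennreal_leI)
    also have "\<dots> = ennreal (\<theta> powr (1 - p) / p) * ennreal (\<bar>f w\<bar> powr p * \<sigma> w powr (1 - p))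
        + ennreal ((1 - 1 / p) * \<theta>) * ennreal (\<sigma> w)"
      using p \<theta> w by (subst ennreal_plus) (auto intro!: mult_nonneg_nonneg simp flip: ennreal_mult'')
    finally have "k w * ennreal \<bar>f w\<bar> \<le> k w * \<dots>" by (rule mult_left_mono) simp
    then show "k w * ennreal \<bar>f w\<bar> \<le> ennreal (\<theta> powr (1 - p) / p) * (k w * ennreal (\<bar>f w\<bar> powr p * \<sigma> w powr (1 - p)))
        + ennreal ((1 - 1 / p) * \<theta>) * (k w * ennreal (\<sigma> w))"
      by (simp add: distrib_left mult_ac)
  qed
  also have "\<dots> = ennreal (\<theta> powr (1 - p) / p) * ?G + ennreal ((1 - 1 / p) * \<theta>) * (\<integral>\<^sup>+w. k w * ennreal (\<sigma> w) \<partial>M)"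
    by (subst nn_integral_add) (simp_all add: nn_integral_cmult)
  also have "\<dots> \<le> ennreal (\<theta> powr (1 - p) / p) * ennreal G + ennreal ((1 - 1 / p) * \<theta>) * ennreal s"
    unfolding G by (intro add_mono mult_left_mono s) auto
  also have "\<dots> = ennreal ((\<theta> powr (1 - p) / p) * G + ((1 - 1 / p) * \<theta>) * s)"
    using p \<theta> s G by (subst ennreal_plus) (auto intro!: mult_nonneg_nonneg simp flip: ennreal_mult'')
  finally have "F \<le> (\<theta> powr (1 - p) / p) * G + ((1 - 1 / p) * \<theta>) * s"
    using p \<theta> s G by (subst (asm) ennreal_le_iff) (auto intro!: add_nonneg_nonneg mult_nonneg_nonneg)
  \<comment> \<open>The choice of \<open>\<theta>\<close> makes the second term a fraction of
    \<open>F\<close>, which is absorbed on the left. This subtraction is the reason for taking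
    \<open>F\<close> as a finite real below the integral.\<close>
  also have "((1 - 1 / p) * \<theta>) * s = F - F / p" using s by (simp add: \<theta>_def field_simps)
  finally have "F / p \<le> (\<theta> powr (1 - p) / p) * G" by simp
  then have "F \<le> \<theta> powr (1 - p) * G" using p by (simp add: field_simps)
  then have "\<theta> powr (p - 1) * F \<le> \<theta> powr (p - 1) * (\<theta> powr (1 - p) * G)"
    by (intro mult_left_mono) auto
  also have "\<dots> = G" using \<theta> by (simp add: mult.assoc[symmetric] powr_add[symmetric])
  finally have "F powr p / s powr (p - 1) \<le> G"
    using F0 s by (simp add: \<theta>_def powr_divide powr_diff field_simps)
  then have "F powr p \<le> s powr (p - 1) * G" using s by (simp add: field_simps)
  then show ?thesis unfolding G using G(2) by (metis ennreal_leI ennreal_mult'' )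
qed

abbreviation Lp_mass :: "real \<Rightarrow> ('a::euclidean_space \<Rightarrow> real) \<Rightarrow> ennreal" where
  "Lp_mass p f \<equiv> (\<integral>\<^sup>+w. ennreal (\<bar>f w\<bar> powr p) \<partial>lborel)"

text \<open>Hoelder against \<open>\<sigma>\<close> in the inner variable costs
  \<open>s z powr (p - 1)\<close>. After Fubini the adjoint condition returns
  \<open>\<sigma> w powr (p - 1)\<close>, which cancels the factor
  \<open>\<sigma> w powr (1 - p)\<close> left by Hoelder. Keeping \<open>s\<close> separate from
  \<open>\<sigma>\<close> allows the operator to map one power of \<open>u\<close> to
  another.\<close>

lemma Schur_test:
  fixes K :: "'a::euclidean_space \<Rightarrow> 'a \<Rightarrow> ennreal" and f \<sigma> V s F :: "'a \<Rightarrow> real"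
  assumes p: "1 < p"
    and [measurable]: "case_prod K \<in> borel_measurable (lborel \<Otimes>\<^sub>M lborel)" "f \<in> borel_measurable lborel"
      "\<sigma> \<in> borel_measurable lborel" "V \<in> borel_measurable lborel" "s \<in> borel_measurable lborel"
    and V: "\<And>z. 0 \<le> V z"
    and pos: "AE w in lborel. 0 < \<sigma> w"
    and s: "AE z in lborel. 0 < s z \<and> (\<integral>\<^sup>+w. K z w * ennreal (\<sigma> w) \<partial>lborel) \<le> ennreal (s z)"
    and adj: "AE w in lborel. (\<integral>\<^sup>+z. K z w * ennreal (V z * s z powr (p - 1)) \<partial>lborel) \<le> ennreal (C * \<sigma> w powr (p - 1))"
    and C: "0 \<le> C"
    and F: "AE z in lborel. ennreal \<bar>F z\<bar> \<le> (\<integral>\<^sup>+w. K z w * ennreal \<bar>f w\<bar> \<partial>lborel)"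
  shows "(\<integral>\<^sup>+z. ennreal (V z * \<bar>F z\<bar> powr p) \<partial>lborel) \<le> ennreal C * Lp_mass p f"
proof -
  have Km[measurable]: "(\<lambda>w. K z w) \<in> borel_measurable lborel" "(\<lambda>z. K z w) \<in> borel_measurable lborel" for z w
    using measurable_Pair2[OF assms(2), of z] measurable_Pair1[OF assms(2), of w] by simp_all
  have "(\<integral>\<^sup>+z. ennreal (V z * \<bar>F z\<bar> powr p) \<partial>lborel)
    \<le> (\<integral>\<^sup>+z. (\<integral>\<^sup>+w. ennreal (V z * s z powr (p - 1)) * (K z w * ennreal (\<bar>f w\<bar> powr p * \<sigma> w powr (1 - p))) \<partial>lborel) \<partial>lborel)"
  proof (rule nn_integral_mono_AE, use s F in eventually_elim)
    fix z assume z: "0 < s z \<and> (\<integral>\<^sup>+w. K z w * ennreal (\<sigma> w) \<partial>lborel) \<le> ennreal (s z)"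
      and Fz: "ennreal \<bar>F z\<bar> \<le> (\<integral>\<^sup>+w. K z w * ennreal \<bar>f w\<bar> \<partial>lborel)"
    have "ennreal (\<bar>F z\<bar> powr p) \<le> ennreal (s z powr (p - 1)) *
       (\<integral>\<^sup>+w. K z w * ennreal (\<bar>f w\<bar> powr p * \<sigma> w powr (1 - p)) \<partial>lborel)"
      using z Fz pos p by (intro Holder_pointwise) auto
    then have "ennreal (V z) * ennreal (\<bar>F z\<bar> powr p) \<le> ennreal (V z) * (ennreal (s z powr (p - 1)) *
       (\<integral>\<^sup>+w. K z w * ennreal (\<bar>f w\<bar> powr p * \<sigma> w powr (1 - p)) \<partial>lborel))"
      by (rule mult_left_mono) simp
    then show "ennreal (V z * \<bar>F z\<bar> powr p) \<le>
       (\<integral>\<^sup>+w. ennreal (V z * s z powr (p - 1)) * (K z w * ennreal (\<bar>f w\<bar> powr p * \<sigma> w powr (1 - p))) \<partial>lborel)"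
      using V by (subst nn_integral_cmult) (simp_all add: ennreal_mult mult.assoc)
  qed
  also have "\<dots> = (\<integral>\<^sup>+w. (\<integral>\<^sup>+z. ennreal (V z * s z powr (p - 1)) * (K z w * ennreal (\<bar>f w\<bar> powr p * \<sigma> w powr (1 - p))) \<partial>lborel) \<partial>lborel)"
    by (rule lborel_pair.Fubini') measurable
  also have "\<dots> \<le> (\<integral>\<^sup>+w. ennreal C * ennreal (\<bar>f w\<bar> powr p) \<partial>lborel)"
  proof (rule nn_integral_mono_AE, use adj pos in eventually_elim)
    fix w assume w: "(\<integral>\<^sup>+z. K z w * ennreal (V z * s z powr (p - 1)) \<partial>lborel) \<le> ennreal (C * \<sigma> w powr (p - 1))"
      and \<sigma>: "0 < \<sigma> w"
    have "(\<integral>\<^sup>+z. ennreal (V z * s z powr (p - 1)) * (K z w * ennreal (\<bar>f w\<bar> powr p * \<sigma> w powr (1 - p))) \<partial>lborel)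
      = (\<integral>\<^sup>+z. ennreal (\<bar>f w\<bar> powr p * \<sigma> w powr (1 - p)) * (K z w * ennreal (V z * s z powr (p - 1))) \<partial>lborel)"
      by (intro nn_integral_cong) (simp add: mult_ac)
    also have "\<dots> = ennreal (\<bar>f w\<bar> powr p * \<sigma> w powr (1 - p)) * (\<integral>\<^sup>+z. K z w * ennreal (V z * s z powr (p - 1)) \<partial>lborel)"
      by (rule nn_integral_cmult) measurable
    also have "\<dots> \<le> ennreal (\<bar>f w\<bar> powr p * \<sigma> w powr (1 - p)) * ennreal (C * \<sigma> w powr (p - 1))"
      by (intro mult_left_mono w) simp
    also have "\<dots> = ennreal (\<bar>f w\<bar> powr p * \<sigma> w powr (1 - p) * (C * \<sigma> w powr (p - 1)))"
      by (rule ennreal_mult'[symmetric]) (use C in auto)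
    also have "\<bar>f w\<bar> powr p * \<sigma> w powr (1 - p) * (C * \<sigma> w powr (p - 1))
       = C * (\<bar>f w\<bar> powr p * (\<sigma> w powr (1 - p) * \<sigma> w powr (p - 1)))" by (simp add: mult_ac)
    also have "\<dots> = C * \<bar>f w\<bar> powr p" using \<sigma> by (simp add: powr_add[symmetric])
    also have "ennreal \<dots> = ennreal C * ennreal (\<bar>f w\<bar> powr p)" by (rule ennreal_mult') (use C in auto)
    finally show "(\<integral>\<^sup>+z. ennreal (V z * s z powr (p - 1)) * (K z w * ennreal (\<bar>f w\<bar> powr p * \<sigma> w powr (1 - p))) \<partial>lborel)
      \<le> ennreal C * ennreal (\<bar>f w\<bar> powr p)" .
  qed
  also have "\<dots> = ennreal C * Lp_mass p f"
    by (rule nn_integral_cmult) measurable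
  finally show ?thesis .
qed

subsection \<open>Potentials for homogeneous norms\<close>

text \<open>Symmetry, subadditivity and the exact volume growth of balls suffice for the potential
  theory; no dilations are required. The locale serves the Euclidean norm with \<open>D = d\<close>
  for Fourier integrals, and the parabolic norm with \<open>D = d + \<alpha>\<close> for the
  resolvent.\<close>

locale homogeneous_norm =
  fixes N :: "'a::euclidean_space \<Rightarrow> real" and c D :: real
  assumes N_measurable[measurable]: "N \<in> borel_measurable borel"
    and N_minus: "N (- z) = N z"
    and N_triangle: "N (z + w) \<le> N z + N w"
    and c_pos: "0 < c" and D_pos: "0 < D"
    and emeasure_N_le: "0 < \<rho> \<Longrightarrow> emeasure lborel {z. N z \<le> \<rho>} = ennreal (c * \<rho> powr D)"
begin

definition ball_kernel :: "real \<Rightarrow> 'a \<Rightarrow> ennreal" where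
  "ball_kernel \<rho> z = ennreal (if N z \<le> \<rho> then 1 / (c * \<rho> powr D) else 0)"

definition avg :: "real \<Rightarrow> ('a \<Rightarrow> ennreal) \<Rightarrow> 'a \<Rightarrow> ennreal" where
  "avg \<rho> f z = (\<integral>\<^sup>+w. ball_kernel \<rho> (z - w) * f w \<partial>lborel)"

text \<open>Up to the factor \<open>1 / (c * (D - \<kappa>))\<close> this is \<open>N z powr (\<kappa> - D)\<close>; the integral form turns
  estimates of potentials into estimates of averages over balls.\<close>

definition riesz_kernel :: "real \<Rightarrow> 'a \<Rightarrow> ennreal" where
  "riesz_kernel \<kappa> z = (\<integral>\<^sup>+\<rho>\<in>{0<..}. ennreal (\<rho> powr (\<kappa> - 1)) * ball_kernel \<rho> z \<partial>lborel)"

definition potential :: "real \<Rightarrow> ('a \<Rightarrow> ennreal) \<Rightarrow> 'a \<Rightarrow> ennreal" where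
  "potential \<kappa> f z = (\<integral>\<^sup>+w. riesz_kernel \<kappa> (z - w) * f w \<partial>lborel)"

lemma N_diff_commute: "N (z - w) = N (w - z)"
  using N_minus[of "z - w"] by simp

lemma ball_kernel_measurable[measurable]:
  assumes [measurable]: "r \<in> borel_measurable M" "h \<in> borel_measurable M"
  shows "(\<lambda>x. ball_kernel (r x) (h x)) \<in> borel_measurable M"
  unfolding ball_kernel_def by measurable

lemma avg_measurable[measurable]:
  assumes [measurable]: "f \<in> borel_measurable borel" "r \<in> borel_measurable M" "h \<in> borel_measurable M"
  shows "(\<lambda>x. avg (r x) f (h x)) \<in> borel_measurable M"
proof -
  have "(\<lambda>(\<rho>, z). avg \<rho> f z) \<in> borel_measurable (borel \<Otimes>\<^sub>M borel)"
    unfolding avg_def case_prod_beta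
    by (rule lborel.borel_measurable_nn_integral) measurable
  from measurable_compose[OF _ this, of "\<lambda>x. (r x, h x)" M] show ?thesis by simp
qed

lemma riesz_kernel_measurable[measurable]: "riesz_kernel \<kappa> \<in> borel_measurable borel"
  unfolding riesz_kernel_def by measurable

lemma potential_measurable[measurable]:
  assumes [measurable]: "f \<in> borel_measurable borel"
  shows "potential \<kappa> f \<in> borel_measurable borel"
  unfolding potential_def by measurable

lemma riesz_kernel_diff_commute: "riesz_kernel \<kappa> (z - w) = riesz_kernel \<kappa> (w - z)"
  by (simp add: riesz_kernel_def ball_kernel_def N_diff_commute[of z w])

lemma nn_integral_ball_kernel:
  assumes "0 < \<rho>"
  shows "(\<integral>\<^sup>+z. ball_kernel \<rho> z \<partial>lborel) = 1"
proof -
  have "(\<integral>\<^sup>+z. ball_kernel \<rho> z \<partial>lborel)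
      = (\<integral>\<^sup>+z. ennreal (1 / (c * \<rho> powr D)) * indicator {z. N z \<le> \<rho>} z \<partial>lborel)"
    by (intro nn_integral_cong) (auto simp: ball_kernel_def)
  also have "\<dots> = ennreal (1 / (c * \<rho> powr D)) * ennreal (c * \<rho> powr D)"
    using assms by (subst nn_integral_cmult_indicator) (auto simp: emeasure_N_le)
  also have "\<dots> = 1"
    using assms c_pos by (subst ennreal_mult'[symmetric]) auto
  finally show ?thesis .
qed

lemma avg_mono_AE:
  assumes "AE w in lborel. f w \<le> h w"
  shows "avg \<rho> f z \<le> avg \<rho> h z"
  unfolding avg_def using assms by (intro nn_integral_mono_AE) (auto elim!: eventually_mono intro: mult_left_mono)

lemma avg_const: "0 < \<rho> \<Longrightarrow> avg \<rho> (\<lambda>_. a) z = a"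
  unfolding avg_def
  by (subst nn_integral_multc) (simp_all add: nn_integral_lborel_diff nn_integral_ball_kernel)

section \<open>Potentials as integrals of averages over all radii\<close>

lemma potential_eq_nn_integral_avg:
  assumes [measurable]: "f \<in> borel_measurable borel"
  shows "potential \<kappa> f z = (\<integral>\<^sup>+\<rho>\<in>{0<..}. ennreal (\<rho> powr (\<kappa> - 1)) * avg \<rho> f z \<partial>lborel)"
proof -
  have "potential \<kappa> f z = (\<integral>\<^sup>+w. (\<integral>\<^sup>+\<rho>. ennreal (\<rho> powr (\<kappa> - 1)) * ball_kernel \<rho> (z - w) * indicator {0<..} \<rho> * f w \<partial>lborel) \<partial>lborel)"
    unfolding potential_def riesz_kernel_def
    by (intro nn_integral_cong nn_integral_multc[symmetric]) measurable
  also have "\<dots> = (\<integral>\<^sup>+\<rho>. (\<integral>\<^sup>+w. ennreal (\<rho> powr (\<kappa> - 1)) * ball_kernel \<rho> (z - w) * indicator {0<..} \<rho> * f w \<partial>lborel) \<partial>lborel)"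
    by (rule lborel_pair.Fubini') measurable
  also have "\<dots> = (\<integral>\<^sup>+\<rho>. ennreal (\<rho> powr (\<kappa> - 1)) * indicator {0<..} \<rho> * avg \<rho> f z \<partial>lborel)"
    unfolding avg_def by (intro nn_integral_cong, subst nn_integral_cmult[symmetric])
      (auto simp: mult_ac intro!: nn_integral_cong)
  finally show ?thesis by (simp add: mult_ac)
qed

lemma avg_potential_eq:
  assumes [measurable]: "f \<in> borel_measurable borel"
  shows "avg \<rho> (potential \<tau> f) z = (\<integral>\<^sup>+r\<in>{0<..}. ennreal (r powr (\<tau> - 1)) * avg \<rho> (avg r f) z \<partial>lborel)"
proof -
  have "avg \<rho> (potential \<tau> f) z = (\<integral>\<^sup>+w. (\<integral>\<^sup>+r. ball_kernel \<rho> (z - w) * (ennreal (r powr (\<tau> - 1)) * avg r f w * indicator {0<..} r) \<partial>lborel) \<partial>lborel)"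
    unfolding avg_def[of \<rho>] potential_eq_nn_integral_avg[OF assms]
    by (intro nn_integral_cong nn_integral_cmult[symmetric]) measurable
  also have "\<dots> = (\<integral>\<^sup>+r. (\<integral>\<^sup>+w. ball_kernel \<rho> (z - w) * (ennreal (r powr (\<tau> - 1)) * avg r f w * indicator {0<..} r) \<partial>lborel) \<partial>lborel)"
    by (rule lborel_pair.Fubini') measurable
  also have "\<dots> = (\<integral>\<^sup>+r. (\<integral>\<^sup>+w. ennreal (r powr (\<tau> - 1)) * indicator {0<..} r * (ball_kernel \<rho> (z - w) * avg r f w) \<partial>lborel) \<partial>lborel)"
    by (intro nn_integral_cong) (simp add: mult_ac)
  also have "\<dots> = (\<integral>\<^sup>+r. ennreal (r powr (\<tau> - 1)) * indicator {0<..} r * avg \<rho> (avg r f) z \<partial>lborel)"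
    unfolding avg_def[of \<rho>] by (intro nn_integral_cong nn_integral_cmult) measurable
  finally show ?thesis by (simp add: mult_ac)
qed

text \<open>By the triangle inequality the convolution lives on the ball of radius
  \<open>\<rho> + r \<le> 2 * max \<rho> r\<close>. There the kernel of the larger radius is bounded
  by its supremum and the other one integrates to 1; \<open>2 powr D\<close> pays for doubling the
  radius.\<close>

lemma ball_kernel_convolution_le:
  assumes "0 < \<rho>" "0 < r"
  shows "(\<integral>\<^sup>+y. ball_kernel \<rho> (z - y) * ball_kernel r (y - w) \<partial>lborel)
    \<le> ennreal (2 powr D) * ball_kernel (2 * max \<rho> r) (z - w)"
proof (cases "N (z - w) \<le> 2 * max \<rho> r")
  case False
  have *: "ball_kernel \<rho> (z - y) * ball_kernel r (y - w) = 0" for y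
    using N_triangle[of "z - y" "y - w"] False by (auto simp: ball_kernel_def)
  show ?thesis unfolding * by simp
next
  case True
  have "ennreal (2 powr D) * ball_kernel (2 * max \<rho> r) (z - w) = ennreal (2 powr D * (1 / (c * (2 * max \<rho> r) powr D)))"
    using True by (subst ennreal_mult') (simp_all add: ball_kernel_def)
  also have "2 powr D * (1 / (c * (2 * max \<rho> r) powr D)) = 1 / (c * (max \<rho> r) powr D)"
    using assms c_pos by (simp add: powr_mult)
  finally have rhs: "ennreal (2 powr D) * ball_kernel (2 * max \<rho> r) (z - w) = ennreal (1 / (c * (max \<rho> r) powr D))" .
  show ?thesis
  proof (cases "\<rho> \<le> r")
    case True
    have "(\<integral>\<^sup>+y. ball_kernel \<rho> (z - y) * ball_kernel r (y - w) \<partial>lborel)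
      \<le> (\<integral>\<^sup>+y. ball_kernel \<rho> (z - y) * ennreal (1 / (c * (max \<rho> r) powr D)) \<partial>lborel)"
      using True c_pos assms by (intro nn_integral_mono mult_left_mono) (auto simp: ball_kernel_def max_def)
    also have "\<dots> = ennreal (1 / (c * (max \<rho> r) powr D))"
      using assms by (subst nn_integral_multc) (simp_all add: nn_integral_lborel_diff nn_integral_ball_kernel)
    finally show ?thesis unfolding rhs .
  next
    case False
    have "(\<integral>\<^sup>+y. ball_kernel \<rho> (z - y) * ball_kernel r (y - w) \<partial>lborel)
      \<le> (\<integral>\<^sup>+y. ennreal (1 / (c * (max \<rho> r) powr D)) * ball_kernel r (y - w) \<partial>lborel)"
      using False c_pos assms by (intro nn_integral_mono mult_right_mono) (auto simp: ball_kernel_def max_def)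
    also have "\<dots> = ennreal (1 / (c * (max \<rho> r) powr D))"
      using assms by (subst nn_integral_cmult) (simp_all add: nn_integral_lborel_diff nn_integral_ball_kernel)
    finally show ?thesis unfolding rhs .
  qed
qed

lemma avg_avg_le:
  assumes [measurable]: "f \<in> borel_measurable borel" and "0 < \<rho>" "0 < r"
  shows "avg \<rho> (avg r f) z \<le> ennreal (2 powr D) * avg (2 * max \<rho> r) f z"
proof -
  have "avg \<rho> (avg r f) z = (\<integral>\<^sup>+y. (\<integral>\<^sup>+w. ball_kernel \<rho> (z - y) * (ball_kernel r (y - w) * f w) \<partial>lborel) \<partial>lborel)"
    unfolding avg_def by (intro nn_integral_cong nn_integral_cmult[symmetric]) measurable
  also have "\<dots> = (\<integral>\<^sup>+w. (\<integral>\<^sup>+y. ball_kernel \<rho> (z - y) * (ball_kernel r (y - w) * f w) \<partial>lborel) \<partial>lborel)"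
    by (rule lborel_pair.Fubini') measurable
  also have "\<dots> = (\<integral>\<^sup>+w. (\<integral>\<^sup>+y. ball_kernel \<rho> (z - y) * ball_kernel r (y - w) \<partial>lborel) * f w \<partial>lborel)"
    by (intro nn_integral_cong, subst nn_integral_multc[symmetric]) (auto simp: mult.assoc)
  also have "\<dots> \<le> (\<integral>\<^sup>+w. ennreal (2 powr D) * (ball_kernel (2 * max \<rho> r) (z - w) * f w) \<partial>lborel)"
    using ball_kernel_convolution_le[OF assms(2,3)]
    by (intro nn_integral_mono) (auto simp flip: mult.assoc intro!: mult_right_mono)
  also have "\<dots> = ennreal (2 powr D) * avg (2 * max \<rho> r) f z"
    unfolding avg_def by (rule nn_integral_cmult) measurable
  finally show ?thesis .
qed

lemma avg_le_avg:
  assumes [measurable]: "f \<in> borel_measurable borel" and "0 < \<rho>" "\<rho> \<le> r" "r \<le> 2 * \<rho>"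
  shows "avg \<rho> f z \<le> ennreal (2 powr D) * avg r f z"
proof -
  have "ball_kernel \<rho> x \<le> ennreal (2 powr D) * ball_kernel r x" for x
  proof (cases "N x \<le> \<rho>")
    case True
    have "r powr D \<le> (2 * \<rho>) powr D" using assms D_pos by (intro powr_mono2) auto
    then have "1 / (c * \<rho> powr D) \<le> 2 powr D * (1 / (c * r powr D))"
      using assms c_pos by (simp add: powr_mult field_simps)
    then show ?thesis
      using True assms by (auto simp: ball_kernel_def simp flip: ennreal_mult' intro: ennreal_leI)
  qed (auto simp: ball_kernel_def)
  then have "avg \<rho> f z \<le> (\<integral>\<^sup>+w. ennreal (2 powr D) * (ball_kernel r (z - w) * f w) \<partial>lborel)"
    unfolding avg_def by (intro nn_integral_mono) (auto simp flip: mult.assoc intro!: mult_right_mono)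
  also have "\<dots> = ennreal (2 powr D) * avg r f z"
    unfolding avg_def by (rule nn_integral_cmult) measurable
  finally show ?thesis .
qed

text \<open>The radii between \<open>\<rho>\<close> and \<open>2 * \<rho>\<close> alone already
  contribute this much to the potential, because averages at comparable radii are comparable up to
  \<open>2 powr D\<close>.\<close>

lemma avg_le_potential:
  assumes [measurable]: "f \<in> borel_measurable borel" and "0 < \<rho>" "0 < \<tau>"
  shows "ennreal (\<rho> powr \<tau>) * avg \<rho> f z \<le> ennreal (2 powr (D + 1)) * potential \<tau> f z"
proof -
  have "ennreal (\<rho> powr \<tau>) * avg \<rho> f z = ennreal (\<rho> powr \<tau> / \<rho>) * avg \<rho> f z * ennreal \<rho>"
    using assms by (subst (2) mult.commute, subst mult.assoc[symmetric], subst ennreal_mult'[symmetric]) auto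
  also have "\<dots> = (\<integral>\<^sup>+r. ennreal (\<rho> powr \<tau> / \<rho>) * avg \<rho> f z * indicator {\<rho>..2 * \<rho>} r \<partial>lborel)"
    using assms by (subst nn_integral_cmult_indicator) auto
  also have "\<dots> \<le> (\<integral>\<^sup>+r. ennreal (2 powr (D + 1)) * (ennreal (r powr (\<tau> - 1)) * avg r f z * indicator {0<..} r) \<partial>lborel)"
  proof (rule nn_integral_mono)
    fix r
    show "ennreal (\<rho> powr \<tau> / \<rho>) * avg \<rho> f z * indicator {\<rho>..2 * \<rho>} r
       \<le> ennreal (2 powr (D + 1)) * (ennreal (r powr (\<tau> - 1)) * avg r f z * indicator {0<..} r)"
    proof (cases "r \<in> {\<rho>..2 * \<rho>}")
      case True
      then have r: "\<rho> \<le> r" "r \<le> 2 * \<rho>" "0 < r" using assms by auto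
      have "\<rho> powr \<tau> / \<rho> \<le> r powr \<tau> * (2 / r)"
        unfolding divide_inverse using assms r by (intro mult_mono powr_mono2) (auto simp: field_simps)
      also have "\<dots> = 2 * r powr (\<tau> - 1)" using r by (simp add: powr_diff)
      finally have "ennreal (\<rho> powr \<tau> / \<rho>) * avg \<rho> f z \<le> ennreal (2 * r powr (\<tau> - 1)) * (ennreal (2 powr D) * avg r f z)"
        using assms r by (intro mult_mono avg_le_avg ennreal_leI) auto
      also have "\<dots> = ennreal (2 powr (D + 1)) * (ennreal (r powr (\<tau> - 1)) * avg r f z)"
        by (simp add: powr_add ennreal_mult' mult_ac)
      finally show ?thesis using True r by simp
    qed auto
  qed
  also have "\<dots> = ennreal (2 powr (D + 1)) * potential \<tau> f z"
    unfolding potential_eq_nn_integral_avg[OF assms(1)] by (rule nn_integral_cmult) measurable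
  finally show ?thesis .
qed

text \<open>This is the A_1 property of potentials. An inner radius \<open>r > \<rho>\<close> is
  only doubled by the outer average, and a change of variables restores the potential. All inner
  radii \<open>r \<le> \<rho>\<close> collapse to the single radius \<open>2 * \<rho>\<close>, with
  total weight \<open>\<rho> powr \<tau> / \<tau>\<close>, which \<open>avg_le_potential\<close>
  controls.\<close>

lemma avg_potential_le_potential:
  assumes [measurable]: "f \<in> borel_measurable borel" and "0 < \<rho>" "0 < \<tau>"
  shows "avg \<rho> (potential \<tau> f) z \<le> ennreal (2 powr D * (2 powr (D + 1) / \<tau> + 1)) * potential \<tau> f z"
proof -
  let ?J = "\<lambda>r. ennreal (r powr (\<tau> - 1))"
  have dil: "(\<integral>\<^sup>+r. ?J r * avg (2 * r) f z * indicator {0<..} r \<partial>lborel) \<le> potential \<tau> f z"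
  proof -
    have "(\<integral>\<^sup>+r. ?J r * avg (2 * r) f z * indicator {0<..} r \<partial>lborel)
      \<le> (\<integral>\<^sup>+r. 2 * (?J (2 * r) * avg (2 * r) f z * indicator {0<..} (2 * r)) \<partial>lborel)"
    proof (intro nn_integral_mono)
      fix r :: real
      show "?J r * avg (2 * r) f z * indicator {0<..} r \<le> 2 * (?J (2 * r) * avg (2 * r) f z * indicator {0<..} (2 * r))"
      proof (cases "r > 0")
        case True
        have "r powr (\<tau> - 1) \<le> 2 powr \<tau> * r powr (\<tau> - 1)"
          using assms mult_right_mono[of 1 "2 powr \<tau>" "r powr (\<tau> - 1)"] by (simp add: ge_one_powr_ge_zero)
        also have "\<dots> = 2 * (2 * r) powr (\<tau> - 1)"
          using True by (simp add: powr_mult powr_diff)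
        finally have "?J r * avg (2 * r) f z \<le> ennreal (2 * (2 * r) powr (\<tau> - 1)) * avg (2 * r) f z"
          by (intro mult_right_mono ennreal_leI) auto
        also have "\<dots> = 2 * (?J (2 * r) * avg (2 * r) f z)"
          by (subst ennreal_mult') (auto simp: mult_ac)
        finally show ?thesis using True by simp
      qed auto
    qed
    also have "\<dots> = 2 * (\<integral>\<^sup>+r. ?J (2 * r) * avg (2 * r) f z * indicator {0<..} (2 * r) \<partial>lborel)"
      by (rule nn_integral_cmult) measurable
    also have "\<dots> = (\<integral>\<^sup>+r. ?J r * avg r f z * indicator {0<..} r \<partial>lborel)"
      by (subst (2) nn_integral_real_affine[where t=0 and c=2]) auto
    finally show ?thesis by (simp add: potential_eq_nn_integral_avg)
  qed
  have near: "(\<integral>\<^sup>+r. ?J r * indicator {0..\<rho>} r * avg (2 * \<rho>) f z \<partial>lborel) \<le> ennreal (2 powr (D + 1) / \<tau>) * potential \<tau> f z"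
  proof -
    have "(\<integral>\<^sup>+r. ?J r * indicator {0..\<rho>} r * avg (2 * \<rho>) f z \<partial>lborel) = ennreal (\<rho> powr \<tau> / \<tau>) * avg (2 * \<rho>) f z"
      using assms by (subst nn_integral_multc) (auto simp: nn_integral_powr_from_0)
    also have "\<dots> \<le> ennreal ((1 / \<tau>) * (2 * \<rho>) powr \<tau>) * avg (2 * \<rho>) f z"
      using assms by (intro mult_right_mono ennreal_leI) (auto intro!: powr_mono2 divide_right_mono)
    also have "\<dots> = ennreal (1 / \<tau>) * (ennreal ((2 * \<rho>) powr \<tau>) * avg (2 * \<rho>) f z)"
      using assms by (subst ennreal_mult') (auto simp: mult.assoc)
    also have "\<dots> \<le> ennreal (1 / \<tau>) * (ennreal (2 powr (D + 1)) * potential \<tau> f z)"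
      using assms by (intro mult_left_mono avg_le_potential) auto
    also have "\<dots> = ennreal (2 powr (D + 1) / \<tau>) * potential \<tau> f z"
      using assms by (subst mult.assoc[symmetric], subst ennreal_mult'[symmetric]) auto
    finally show ?thesis .
  qed
  have "avg \<rho> (potential \<tau> f) z \<le> (\<integral>\<^sup>+r. ennreal (2 powr D) * (?J r * indicator {0..\<rho>} r * avg (2 * \<rho>) f z
        + ?J r * avg (2 * r) f z * indicator {0<..} r) \<partial>lborel)"
    unfolding avg_potential_eq[OF assms(1)]
  proof (rule nn_integral_mono)
    fix r :: real
    show "?J r * avg \<rho> (avg r f) z * indicator {0<..} r \<le> ennreal (2 powr D) * (?J r * indicator {0..\<rho>} r * avg (2 * \<rho>) f z
        + ?J r * avg (2 * r) f z * indicator {0<..} r)"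
    proof (cases "r > 0")
      case True
      have "?J r * avg \<rho> (avg r f) z \<le> ?J r * (ennreal (2 powr D) * avg (2 * max \<rho> r) f z)"
        using True assms by (intro mult_left_mono avg_avg_le) auto
      also have "\<dots> \<le> ?J r * (ennreal (2 powr D) * (indicator {0..\<rho>} r * avg (2 * \<rho>) f z + avg (2 * r) f z))"
        using True by (intro mult_left_mono) (auto simp: max_def)
      finally show ?thesis using True by (simp add: algebra_simps)
    qed auto
  qed
  also have "\<dots> = ennreal (2 powr D) * ((\<integral>\<^sup>+r. ?J r * indicator {0..\<rho>} r * avg (2 * \<rho>) f z \<partial>lborel)
     + (\<integral>\<^sup>+r. ?J r * avg (2 * r) f z * indicator {0<..} r \<partial>lborel))"
    by (subst nn_integral_cmult, measurable, subst nn_integral_add) auto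
  also have "\<dots> \<le> ennreal (2 powr D) * (ennreal (2 powr (D + 1) / \<tau>) * potential \<tau> f z + potential \<tau> f z)"
    by (intro mult_left_mono add_mono near dil) auto
  also have "\<dots> = ennreal (2 powr D * (2 powr (D + 1) / \<tau> + 1)) * potential \<tau> f z"
  proof -
    have "ennreal (2 powr D * (2 powr (D + 1) / \<tau> + 1)) = ennreal (2 powr D) * (ennreal (2 powr (D + 1) / \<tau>) + 1)"
      using assms by (subst ennreal_mult') (auto simp: ennreal_plus)
    then show ?thesis by (simp add: algebra_simps)
  qed
  finally show ?thesis .
qed

text \<open>Averaging at scale \<open>\<rho>\<close> replaces an inner radius \<open>r\<close> by a
  multiple of \<open>max \<rho> r\<close>. The Morrey bound therefore acts as the smaller of its
  values at \<open>\<rho>\<close> and at \<open>r\<close>, and integrating over \<open>r\<close>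
  lowers the Morrey exponent from \<open>q\<close> to \<open>q - \<tau>\<close>.\<close>

lemma avg_potential_le_morrey:
  assumes [measurable]: "f \<in> borel_measurable borel" and "0 < \<rho>" "0 < \<tau>" "\<tau> < q" "0 < A"
    and morrey: "\<And>r. 0 < r \<Longrightarrow> avg r f z \<le> ennreal (A * r powr (- q))"
  shows "avg \<rho> (potential \<tau> f) z \<le> ennreal (2 powr D * (1 / \<tau> + 1 / (q - \<tau>)) * (A * \<rho> powr (\<tau> - q)))"
proof -
  \<comment> \<open>The outer \<open>powr 1\<close> only gives the integrand the shape of
    \<open>nn_integral_powr_min\<close> with \<open>f = 1\<close>.\<close>
  let ?m = "\<lambda>r. min (A * \<rho> powr (- q)) (A * r powr (- q)) powr 1"
  have "avg \<rho> (potential \<tau> f) z \<le> (\<integral>\<^sup>+r. ennreal (2 powr D) * (ennreal (r powr (\<tau> - 1) * ?m r) * indicator {0<..} r) \<partial>lborel)"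
    unfolding avg_potential_eq[OF assms(1)]
  proof (rule nn_integral_mono)
    fix r :: real
    show "ennreal (r powr (\<tau> - 1)) * avg \<rho> (avg r f) z * indicator {0<..} r
      \<le> ennreal (2 powr D) * (ennreal (r powr (\<tau> - 1) * ?m r) * indicator {0<..} r)"
    proof (cases "r > 0")
      case True
      have "ennreal (r powr (\<tau> - 1)) * avg \<rho> (avg r f) z \<le> ennreal (r powr (\<tau> - 1)) * (ennreal (2 powr D) * ennreal (A * (2 * max \<rho> r) powr (- q)))"
        using True assms by (intro mult_left_mono order.trans[OF avg_avg_le] morrey) auto
      also have "\<dots> \<le> ennreal (r powr (\<tau> - 1)) * (ennreal (2 powr D) * ennreal (?m r))"
        using True assms by (intro mult_left_mono ennreal_leI) (auto simp: intro!: powr_mono2')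
      finally show ?thesis using True by (simp add: ennreal_mult' mult_ac)
    qed auto
  qed
  also have "\<dots> = ennreal (2 powr D) * (\<integral>\<^sup>+r\<in>{0<..}. ennreal (r powr (\<tau> - 1) * ?m r) \<partial>lborel)"
    by (rule nn_integral_cmult) measurable
  also have "\<dots> \<le> ennreal (2 powr D) * ennreal ((1 / \<tau> + 1 / (q * 1 - \<tau>)) * ((A * \<rho> powr (- q)) powr (1 - \<tau> / q) * A powr (\<tau> / q)))"
    using assms by (intro mult_left_mono nn_integral_powr_min) auto
  also have "(A * \<rho> powr (- q)) powr (1 - \<tau> / q) * A powr (\<tau> / q) = A * \<rho> powr (\<tau> - q)"
  proof -
    have "(A * \<rho> powr (- q)) powr (1 - \<tau> / q) = A powr (1 - \<tau> / q) * \<rho> powr (\<tau> - q)"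
      using assms by (simp add: powr_mult powr_powr algebra_simps)
    then show ?thesis using assms by (simp add: powr_add[symmetric] mult_ac)
  qed
  finally show ?thesis by (simp add: ennreal_mult'[symmetric] mult.assoc)
qed

text \<open>The averages over the balls of integer radius about 0 are finite, and these countably
  many balls exhaust the space.\<close>

lemma AE_potential_finite:
  assumes [measurable]: "f \<in> borel_measurable borel" and "0 < \<tau>" "\<tau> < q" "0 < A"
    and morrey: "\<And>r z. 0 < r \<Longrightarrow> avg r f z \<le> ennreal (A * r powr (- q))"
  shows "AE z in lborel. potential \<tau> f z < \<infinity>"
proof -
  \<comment> \<open>\<open>Suc n\<close> keeps the radius positive for \<open>n = 0\<close>.\<close>
  have "AE w in lborel. \<forall>n::nat. ball_kernel (real (Suc n)) (0 - w) * potential \<tau> f w \<noteq> \<infinity>"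
  proof (subst AE_all_countable, intro allI nn_integral_PInf_AE)
    fix n :: nat
    show "(\<integral>\<^sup>+w. ball_kernel (real (Suc n)) (0 - w) * potential \<tau> f w \<partial>lborel) \<noteq> \<infinity>"
      using avg_potential_le_morrey[OF assms(1) _ assms(2-4) morrey, of "real (Suc n)" 0]
      by (auto simp: avg_def top_unique)
  qed measurable
  then show ?thesis
  proof eventually_elim
    fix w assume w: "\<forall>n::nat. ball_kernel (real (Suc n)) (0 - w) * potential \<tau> f w \<noteq> \<infinity>"
    obtain n :: nat where n: "N (0 - w) \<le> real n" using real_arch_simple by blast
    then have "ball_kernel (real (Suc n)) (0 - w) \<noteq> 0"
      using c_pos by (auto simp: ball_kernel_def)
    then show "potential \<tau> f w < \<infinity>"
      using w[rule_format, of n] by (auto simp: ennreal_mult_eq_top_iff less_top)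
  qed
qed

text \<open>Disposes of the degenerate case of the weighted estimate: if the potential vanishes at a
  single point, then so do all averages about it, and the weight is trivial. Otherwise the potential
  is positive everywhere and may be raised to negative powers in Schur's test.\<close>

lemma AE_zero_of_potential_zero:
  assumes [measurable]: "f \<in> borel_measurable borel" and "0 < \<tau>" and zero: "potential \<tau> f z = 0"
  shows "AE w in lborel. f w = 0"
proof -
  have "AE w in lborel. \<forall>n::nat. ball_kernel (real (Suc n)) (z - w) * f w = 0"
  proof (subst AE_all_countable, intro allI)
    fix n :: nat
    have "avg (real (Suc n)) f z = 0"
      using avg_le_potential[OF assms(1), of "real (Suc n)" \<tau> z] zero assms by auto
    then show "AE w in lborel. ball_kernel (real (Suc n)) (z - w) * f w = 0"
      unfolding avg_def by (subst (asm) nn_integral_0_iff_AE) auto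
  qed
  then show ?thesis
  proof eventually_elim
    fix w assume w: "\<forall>n::nat. ball_kernel (real (Suc n)) (z - w) * f w = 0"
    obtain n :: nat where n: "N (z - w) \<le> real n" using real_arch_simple by blast
    then have "ball_kernel (real (Suc n)) (z - w) \<noteq> 0"
      using c_pos by (auto simp: ball_kernel_def)
    then show "f w = 0" using w[rule_format, of n] by auto
  qed
qed

text \<open>A Hoelder inequality without real powers of extended reals: \<open>weighted_amgm\<close>
  is applied pointwise to \<open>g / X\<close> and \<open>u / Y\<close>, and the resulting linear
  expression is averaged. The remaining weight \<open>1 - a - b\<close> sits on a constant, which
  averages preserve.\<close>

lemma avg_geometric_mean_le:
  fixes g u :: "'a \<Rightarrow> real"
  assumes [measurable]: "g \<in> borel_measurable borel" "u \<in> borel_measurable borel"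
    and nonneg: "\<And>w. 0 \<le> g w" "\<And>w. 0 \<le> u w"
    and "0 \<le> a" "0 \<le> b" "a + b \<le> 1" "0 < \<rho>" "0 < X" "0 < Y"
    and "avg \<rho> g z \<le> ennreal X" "avg \<rho> u z \<le> ennreal Y"
  shows "avg \<rho> (\<lambda>w. ennreal (g w powr a * u w powr b)) z \<le> ennreal (X powr a * Y powr b)"
proof -
  let ?P = "X powr a * Y powr b"
  have pw: "ennreal (g w powr a * u w powr b)
      \<le> ennreal (?P * a / X) * ennreal (g w) + ennreal (?P * b / Y) * ennreal (u w) + ennreal (?P * (1 - a - b))" for w
  proof -
    have "(g w / X) powr a * (u w / Y) powr b \<le> a * (g w / X) + b * (u w / Y) + (1 - a - b)"
      using assms by (intro weighted_amgm) auto
    then have "?P * ((g w / X) powr a * (u w / Y) powr b) \<le> ?P * (a * (g w / X) + b * (u w / Y) + (1 - a - b))"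
      by (intro mult_left_mono) auto
    also have "?P * ((g w / X) powr a * (u w / Y) powr b) = g w powr a * u w powr b"
      using assms by (simp add: powr_divide)
    finally have "g w powr a * u w powr b \<le> ?P * a / X * g w + ?P * b / Y * u w + ?P * (1 - a - b)"
      by (simp add: algebra_simps)
    then have "ennreal (g w powr a * u w powr b) \<le> ennreal (?P * a / X * g w + ?P * b / Y * u w + ?P * (1 - a - b))"
      by (rule ennreal_leI)
    also have "\<dots> = ennreal (?P * a / X * g w) + ennreal (?P * b / Y * u w) + ennreal (?P * (1 - a - b))"
      using assms by (subst ennreal_plus, force, force, subst ennreal_plus) auto
    also have "\<dots> = ennreal (?P * a / X) * ennreal (g w) + ennreal (?P * b / Y) * ennreal (u w) + ennreal (?P * (1 - a - b))"
      using nonneg by (subst ennreal_mult'', force, subst ennreal_mult'') auto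
    finally show ?thesis .
  qed
  have "avg \<rho> (\<lambda>w. ennreal (g w powr a * u w powr b)) z \<le>
     avg \<rho> (\<lambda>w. ennreal (?P * a / X) * ennreal (g w) + ennreal (?P * b / Y) * ennreal (u w) + ennreal (?P * (1 - a - b))) z"
    by (intro avg_mono_AE AE_I2 pw)
  also have "\<dots> = (\<integral>\<^sup>+w. ennreal (?P * a / X) * (ball_kernel \<rho> (z - w) * ennreal (g w))
      + ennreal (?P * b / Y) * (ball_kernel \<rho> (z - w) * ennreal (u w)) + ball_kernel \<rho> (z - w) * ennreal (?P * (1 - a - b)) \<partial>lborel)"
    unfolding avg_def by (intro nn_integral_cong) (simp add: algebra_simps)
  also have "\<dots> = ennreal (?P * a / X) * avg \<rho> g z + ennreal (?P * b / Y) * avg \<rho> u z + ennreal (?P * (1 - a - b))"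
    using avg_const[OF \<open>0 < \<rho>\<close>, of "ennreal (?P * (1 - a - b))" z]
    by (simp add: nn_integral_add nn_integral_cmult avg_def)
  also have "\<dots> \<le> ennreal (?P * a / X) * ennreal X + ennreal (?P * b / Y) * ennreal Y + ennreal (?P * (1 - a - b))"
    using assms by (intro add_mono mult_left_mono) auto
  also have "\<dots> = ennreal (?P * a / X * X) + ennreal (?P * b / Y * Y) + ennreal (?P * (1 - a - b))"
    using assms by (subst ennreal_mult'', force, subst ennreal_mult'') auto
  also have "\<dots> = ennreal (?P * a / X * X + ?P * b / Y * Y + ?P * (1 - a - b))"
    using assms by (subst ennreal_plus, force, force, subst ennreal_plus) auto
  also have "?P * a / X * X + ?P * b / Y * Y + ?P * (1 - a - b) = ?P"
    using assms by (simp add: algebra_simps)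
  finally show ?thesis .
qed

text \<open>Schur's test with the weight \<open>\<sigma> = u powr a\<close>, where \<open>u\<close> is the potential of \<open>g\<close> of small order
  \<open>\<tau>\<close>. With \<open>m = q - \<tau>\<close>, averages of \<open>u\<close> over balls of radius \<open>\<rho>\<close> are bounded both by \<open>u\<close> (as for
  \<open>A\<^sub>1\<close> weights) and by \<open>A * \<rho> powr (- m)\<close> (Morrey bound), so that potentials of powers of \<open>u\<close> are
  again powers of \<open>u\<close>.\<close>

lemma Fefferman_Phong_aux:
  fixes g f F :: "'a \<Rightarrow> real"
  assumes p: "1 < p" and \<kappa>: "0 < \<kappa>" "\<kappa> * p < q"
    and \<tau>: "0 < \<tau>" "\<tau> * p < q" "\<kappa> < q - \<tau>"
    and \<delta>: "0 < \<delta>" "\<kappa> / (q - \<tau>) + \<delta> \<le> 1" "\<kappa> * p / q + \<delta> * (p - 1) \<le> 1"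
    and A0: "0 \<le> A"
    and C0: "C0 = max (2 powr (D + 1)) (max (2 powr D * (2 powr (D + 1) / \<tau> + 1)) (2 powr D * (1 / \<tau> + 1 / (q - \<tau>))))"
    and C1: "C1 = C0 powr (\<kappa> / (q - \<tau>) + \<delta>) * (1 / \<kappa> + 1 / ((q - \<tau>) * \<delta>))"
    and C2: "C2 = C1 powr (p - 1) * (C0 powr (\<kappa> * p / q + \<delta> * (p - 1)) *
        (1 / (\<kappa> - \<tau> * (\<kappa> * p / q)) + 1 / (((q - \<tau>) * (\<kappa> / (q - \<tau>) + \<delta>)) * (p - 1))))"
    and [measurable]: "g \<in> borel_measurable borel" "f \<in> borel_measurable borel"
    and g: "\<And>z. 0 \<le> g z"
    and morrey: "\<And>r z. 0 < r \<Longrightarrow> avg r (\<lambda>w. ennreal (g w)) z \<le> ennreal (A * r powr (- q))"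
    and F: "AE z in lborel. ennreal \<bar>F z\<bar> \<le> potential \<kappa> (\<lambda>w. ennreal \<bar>f w\<bar>) z"
  shows "(\<integral>\<^sup>+z. ennreal (g z powr (\<kappa> * p / q) * \<bar>F z\<bar> powr p) \<partial>lborel)
    \<le> ennreal (C2 * A powr (\<kappa> * p / q)) * Lp_mass p f" (is "?I \<le> _")
proof -
  define U where "U = potential \<tau> (\<lambda>w. ennreal (g w))"
  define u where "u z = enn2real (U z)" for z
  define m where "m = q - \<tau>"
  \<comment> \<open>\<open>g powr e\<close> is the weight on the left-hand side. In the exponent
    \<open>a\<close> of the Schur weight, \<open>\<kappa> / m\<close> is what a potential of order
    \<open>\<kappa>\<close> uses up; the remainder \<open>\<delta>\<close> makes the integral over
    the radii converge at infinity.\<close>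
  define e where "e = \<kappa> * p / q"
  define a where "a = \<kappa> / m + \<delta>"
  define M where "M z \<rho> = min (u z) (A * \<rho> powr (- m))" for z \<rho>
  have [measurable]: "U \<in> borel_measurable borel" "u \<in> borel_measurable borel"
    unfolding U_def u_def by measurable
  have u0: "u z \<ge> 0" for z by (simp add: u_def)
  have m: "m > 0" "\<kappa> < m" using \<tau> \<kappa> by (auto simp: m_def)
  have "0 < \<kappa> * p" using \<kappa> p by simp
  then have q: "q > 0" using \<kappa> by linarith
  have e: "0 < e" "e < 1" using q \<kappa> p by (auto simp: e_def)
  have a: "0 < a" "a \<le> 1" "m * a > \<kappa>"
    using \<delta> \<kappa> m by (auto simp: a_def m_def[symmetric] algebra_simps add_pos_pos)
  have eb: "e + \<delta> * (p - 1) \<le> 1" using \<delta> by (simp add: e_def)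
  have \<kappa>\<tau>e: "\<kappa> - \<tau> * e > 0"
  proof -
    have "\<tau> * e = \<kappa> * (\<tau> * p / q)" by (simp add: e_def)
    also have "\<dots> < \<kappa> * 1" using \<tau> \<kappa> q by (intro mult_strict_left_mono) auto
    finally show ?thesis by simp
  qed
  \<comment> \<open>The balance behind the Schur test. When \<open>M\<close> equals
    \<open>A * \<rho> powr (- m)\<close>, the factor \<open>\<rho> powr (- \<tau>)\<close> is worth
    \<open>\<tau> / m\<close> powers of \<open>M\<close>, so \<open>g powr e\<close> is worth
    \<open>e + \<tau> * e / m\<close> powers. Of the total \<open>\<kappa> * p / m\<close>, one
    share \<open>\<kappa> / m\<close> pays for the adjoint potential, and \<open>p - 1\<close>
    shares fill the gap between \<open>s powr (p - 1)\<close> and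
    \<open>(u powr a) powr (p - 1)\<close>.\<close>
  have em: "e + \<tau> * e / m = \<kappa> * p / m"
  proof -
    have "e * (m + \<tau>) = \<kappa> * p" using q by (simp add: e_def m_def)
    then show ?thesis using m by (simp add: field_simps)
  qed
  have C0p: "C0 \<ge> 2 powr (D + 1)" "C0 \<ge> 2 powr D * (2 powr (D + 1) / \<tau> + 1)" "C0 \<ge> 2 powr D * (1 / \<tau> + 1 / (q - \<tau>))"
    unfolding C0 by auto
  have "(1::real) = 2 powr 0" by simp
  also have "\<dots> \<le> 2 powr (D + 1)" using D_pos by (intro powr_mono) auto
  finally have C01: "C0 \<ge> 1" using C0p by linarith
  have C1pos: "C1 > 0"
    using C01 \<delta> \<kappa> m unfolding C1 m_def[symmetric] by (auto intro!: mult_pos_pos add_pos_pos)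
  have C2pos: "C2 > 0"
  proof -
    have "1 / (\<kappa> - \<tau> * e) + 1 / ((m * a) * (p - 1)) > 0"
      using \<kappa>\<tau>e m a p by (intro add_pos_pos) auto
    then show ?thesis
      using C01 C1pos unfolding C2 m_def[symmetric] a_def[symmetric] e_def[symmetric] by (auto intro!: mult_pos_pos)
  qed
  show ?thesis
  proof (cases "\<exists>z. U z = 0")
    case True
    then obtain z where "U z = 0" by auto
    then have "AE w in lborel. ennreal (g w) = 0"
      using \<tau> by (intro AE_zero_of_potential_zero[where \<tau>=\<tau> and z=z]) (auto simp: U_def)
    then have "AE z in lborel. ennreal (g z powr (\<kappa> * p / q) * \<bar>F z\<bar> powr p) = 0"
    proof eventually_elim
      fix z assume "ennreal (g z) = 0"
      then have "g z = 0" using g[of z] by (simp add: ennreal_eq_0_iff)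
      then show "ennreal (g z powr (\<kappa> * p / q) * \<bar>F z\<bar> powr p) = 0" by simp
    qed
    then have "?I = (\<integral>\<^sup>+z. 0 \<partial>(lborel :: 'a measure))"
      by (rule nn_integral_cong_AE)
    then show ?thesis by simp
  next
    case False
    have A: "0 < A"
    proof (rule ccontr)
      assume "\<not> 0 < A"
      then have "avg r (\<lambda>w. ennreal (g w)) 0 = 0" if "0 < r" for r
        using morrey[OF that, of 0] A0 by simp
      then have "(\<integral>\<^sup>+r\<in>{0<..}. ennreal (r powr (\<tau> - 1)) * avg r (\<lambda>w. ennreal (g w)) 0 \<partial>lborel) = (\<integral>\<^sup>+r. 0 \<partial>(lborel :: real measure))"
        by (intro nn_integral_cong) (auto simp: indicator_def)
      then have "U 0 = 0" unfolding U_def by (simp add: potential_eq_nn_integral_avg)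
      then show False using False by simp
    qed
    have Ufin: "AE z in lborel. U z < \<infinity>"
      unfolding U_def using \<tau> A \<kappa> by (intro AE_potential_finite[OF _ _ _ _ morrey]) auto
    have Uu: "AE z in lborel. U z = ennreal (u z)"
      using Ufin by eventually_elim (simp add: u_def)
    have good: "AE z in lborel. 0 < u z \<and> U z = ennreal (u z)"
      using Uu Ufin
      by eventually_elim (use False in \<open>auto simp: u_def enn2real_positive_iff zero_less_iff_neq_zero less_top\<close>)
    have avg_u: "avg \<rho> (\<lambda>w. ennreal (u w)) z \<le> ennreal (C0 * M z \<rho>)"
      if "0 < \<rho>" "0 < u z \<and> U z = ennreal (u z)" for \<rho> z
    proof -
      have *: "avg \<rho> (\<lambda>w. ennreal (u w)) z \<le> avg \<rho> U z"
        by (rule avg_mono_AE) (use Uu in \<open>auto elim: eventually_mono\<close>)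
      have "avg \<rho> U z \<le> ennreal (2 powr D * (2 powr (D + 1) / \<tau> + 1)) * U z"
        unfolding U_def using that \<tau> by (intro avg_potential_le_potential) auto
      also have "\<dots> \<le> ennreal C0 * U z" using C0p by (intro mult_right_mono ennreal_leI) auto
      also have "\<dots> = ennreal (C0 * u z)" using that C01 by (simp add: ennreal_mult')
      finally have 1: "avg \<rho> U z \<le> ennreal (C0 * u z)" .
      have "avg \<rho> U z \<le> ennreal (2 powr D * (1 / \<tau> + 1 / (q - \<tau>)) * (A * \<rho> powr (\<tau> - q)))"
        unfolding U_def using that \<tau> A morrey \<kappa> by (intro avg_potential_le_morrey) auto
      also have "\<dots> \<le> ennreal (C0 * (A * \<rho> powr (- m)))"
        using mult_right_mono[OF C0p(3), of "A * \<rho> powr (\<tau> - q)"] A by (intro ennreal_leI) (simp add: m_def)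
      finally have "avg \<rho> U z \<le> ennreal (C0 * (A * \<rho> powr (- m)))" .
      then show ?thesis using * 1 by (auto simp: M_def min_def intro: order_trans)
    qed
    \<comment> \<open>The same double bound for \<open>g\<close> itself, at the price of
      \<open>\<rho> powr (- \<tau>)\<close>: one half is \<open>avg_le_potential\<close>, the other
      the Morrey hypothesis with \<open>q = \<tau> + m\<close>.\<close>
    have avg_g: "avg \<rho> (\<lambda>w. ennreal (g w)) z \<le> ennreal (C0 * \<rho> powr (- \<tau>) * M z \<rho>)"
      if "0 < \<rho>" "0 < u z \<and> U z = ennreal (u z)" for \<rho> z
    proof -
      have "ennreal (\<rho> powr \<tau>) * avg \<rho> (\<lambda>w. ennreal (g w)) z \<le> ennreal (2 powr (D + 1)) * U z"
        unfolding U_def using that \<tau> by (intro avg_le_potential) auto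
      also have "\<dots> \<le> ennreal C0 * U z" using C0p by (intro mult_right_mono ennreal_leI) auto
      also have "\<dots> = ennreal (C0 * u z)" using that C01 by (simp add: ennreal_mult')
      finally have "ennreal (\<rho> powr (- \<tau>)) * (ennreal (\<rho> powr \<tau>) * avg \<rho> (\<lambda>w. ennreal (g w)) z) \<le> ennreal (\<rho> powr (- \<tau>)) * ennreal (C0 * u z)"
        by (intro mult_left_mono) auto
      moreover have "ennreal (\<rho> powr (- \<tau>)) * (ennreal (\<rho> powr \<tau>) * avg \<rho> (\<lambda>w. ennreal (g w)) z) = avg \<rho> (\<lambda>w. ennreal (g w)) z"
        using that by (simp add: mult.assoc[symmetric] ennreal_mult'[symmetric] powr_add[symmetric])
      ultimately have 1: "avg \<rho> (\<lambda>w. ennreal (g w)) z \<le> ennreal (C0 * \<rho> powr (- \<tau>) * u z)"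
        by (simp add: ennreal_mult'[symmetric] mult.commute[of C0] mult.assoc)
      have "avg \<rho> (\<lambda>w. ennreal (g w)) z \<le> ennreal (A * \<rho> powr (- q))" using that by (intro morrey)
      also have "A * \<rho> powr (- q) = 1 * \<rho> powr (- \<tau>) * (A * \<rho> powr (- m))"
        by (simp add: m_def powr_add[symmetric])
      also have "ennreal \<dots> \<le> ennreal (C0 * \<rho> powr (- \<tau>) * (A * \<rho> powr (- m)))"
        using C01 A by (intro ennreal_leI mult_right_mono) auto
      finally show ?thesis using 1 by (auto simp: M_def min_def)
    qed
    have M0: "0 < M z \<rho>" if "0 < \<rho>" "0 < u z" for z \<rho> using that A by (auto simp: M_def)
    \<comment> \<open>The first Schur bound to be proved: the potential trades
      \<open>\<kappa> / m\<close> of the \<open>a\<close> powers of \<open>u\<close> for powers of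
      \<open>A\<close>, leaving \<open>\<delta>\<close>.\<close>
    define s where "s z = C1 * A powr (\<kappa> / m) * u z powr \<delta>" for z
    have pot_u: "potential \<kappa> (\<lambda>w. ennreal (u w powr a)) z \<le> ennreal (s z)"
      if z: "0 < u z \<and> U z = ennreal (u z)" for z
    proof -
      have "potential \<kappa> (\<lambda>w. ennreal (u w powr a)) z
        = (\<integral>\<^sup>+\<rho>\<in>{0<..}. ennreal (\<rho> powr (\<kappa> - 1)) * avg \<rho> (\<lambda>w. ennreal (u w powr a)) z \<partial>lborel)"
        by (rule potential_eq_nn_integral_avg) measurable
      also have "\<dots> \<le> (\<integral>\<^sup>+\<rho>. ennreal (C0 powr a) * (ennreal (\<rho> powr (\<kappa> - 1) * M z \<rho> powr a) * indicator {0<..} \<rho>) \<partial>lborel)"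
      proof (rule nn_integral_mono)
        fix \<rho> :: real
        show "ennreal (\<rho> powr (\<kappa> - 1)) * avg \<rho> (\<lambda>w. ennreal (u w powr a)) z * indicator {0<..} \<rho>
          \<le> ennreal (C0 powr a) * (ennreal (\<rho> powr (\<kappa> - 1) * M z \<rho> powr a) * indicator {0<..} \<rho>)"
        proof (cases "\<rho> > 0")
          case True
          \<comment> \<open>Jensen's inequality for the exponent \<open>a \<le> 1\<close>, obtained
            from the geometric mean estimate with the constant 1 as an idle first factor.\<close>
          have "avg \<rho> (\<lambda>w. ennreal (1 powr 0 * u w powr a)) z \<le> ennreal (1 powr 0 * (C0 * M z \<rho>) powr a)"
            using True z M0[of \<rho> z] avg_u[of \<rho> z] a C01 u0 avg_const[OF True, of 1 z]
            by (intro avg_geometric_mean_le) auto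
          then have "avg \<rho> (\<lambda>w. ennreal (u w powr a)) z \<le> ennreal (C0 powr a * M z \<rho> powr a)"
            using C01 M0[of \<rho> z] True z by (simp add: powr_mult)
          then have "ennreal (\<rho> powr (\<kappa> - 1)) * avg \<rho> (\<lambda>w. ennreal (u w powr a)) z
            \<le> ennreal (\<rho> powr (\<kappa> - 1)) * ennreal (C0 powr a * M z \<rho> powr a)"
            by (rule mult_left_mono) simp
          then show ?thesis using True by (simp add: ennreal_mult' mult_ac)
        qed auto
      qed
      also have "\<dots> = ennreal (C0 powr a) * (\<integral>\<^sup>+\<rho>\<in>{0<..}. ennreal (\<rho> powr (\<kappa> - 1) * M z \<rho> powr a) \<partial>lborel)"
        unfolding M_def by (rule nn_integral_cmult) measurable
      also have "\<dots> \<le> ennreal (C0 powr a) * ennreal ((1 / \<kappa> + 1 / (m * a - \<kappa>)) * (u z powr (a - \<kappa> / m) * A powr (\<kappa> / m)))"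
        unfolding M_def using \<kappa> a m z A by (intro mult_left_mono nn_integral_powr_min) auto
      also have "\<dots> = ennreal (C0 powr a * ((1 / \<kappa> + 1 / (m * a - \<kappa>)) * (u z powr (a - \<kappa> / m) * A powr (\<kappa> / m))))"
        by (simp add: ennreal_mult')
      also have "C0 powr a * ((1 / \<kappa> + 1 / (m * a - \<kappa>)) * (u z powr (a - \<kappa> / m) * A powr (\<kappa> / m))) = s z"
      proof -
        have "m * a - \<kappa> = m * \<delta>" "a - \<kappa> / m = \<delta>" using m by (auto simp: a_def field_simps)
        then show ?thesis unfolding s_def C1 m_def[symmetric] a_def[symmetric] by simp
      qed
      finally show ?thesis .
    qed
    have pot_gu: "potential \<kappa> (\<lambda>z. ennreal (g z powr e * s z powr (p - 1))) w \<le> ennreal (C2 * A powr e * (u w powr a) powr (p - 1))"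
      if w: "0 < u w \<and> U w = ennreal (u w)" for w
    proof -
      define b where "b = \<delta> * (p - 1)"
      define B where "B = C1 powr (p - 1) * A powr (\<kappa> * (p - 1) / m)"
      \<comment> \<open>The factor \<open>\<rho> powr (- (\<tau> * e))\<close> coming from the
        averages of \<open>g\<close> lowers the order of the potential from \<open>\<kappa>\<close>
        to \<open>\<epsilon>\<close>. It stays positive because
        \<open>\<tau> * p < q\<close>.\<close>
      define \<epsilon> where "\<epsilon> = \<kappa> - \<tau> * e"
      have b: "b > 0" using \<delta> p by (simp add: b_def)
      have B: "B \<ge> 0" by (simp add: B_def)
      have id: "e + b - \<epsilon> / m = a * (p - 1)"
      proof -
        have "e - \<epsilon> / m = (e + \<tau> * e / m) - \<kappa> / m" by (simp add: \<epsilon>_def diff_divide_distrib)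
        also have "\<dots> = \<kappa> / m * (p - 1)" unfolding em by (simp add: algebra_simps diff_divide_distrib)
        finally show ?thesis by (simp add: a_def b_def algebra_simps)
      qed
      have id2: "m * (e + b) - \<epsilon> = m * a * (p - 1)"
      proof -
        have "m * (e + b) - \<epsilon> = m * (e + b - \<epsilon> / m)" using m by (simp add: field_simps)
        then show ?thesis unfolding id by simp
      qed
      have sp: "g z powr e * s z powr (p - 1) = B * (g z powr e * u z powr b)" for z
        using C1pos A u0[of z] by (simp add: s_def B_def powr_mult powr_powr b_def mult_ac)
      have pB: "potential \<kappa> (\<lambda>z. ennreal (g z powr e * s z powr (p - 1))) w
        = ennreal B * potential \<kappa> (\<lambda>z. ennreal (g z powr e * u z powr b)) w"
        unfolding sp potential_def using B
        by (subst nn_integral_cmult[symmetric]) (auto simp: ennreal_mult' mult_ac)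
      have "potential \<kappa> (\<lambda>z. ennreal (g z powr e * u z powr b)) w
        = (\<integral>\<^sup>+\<rho>\<in>{0<..}. ennreal (\<rho> powr (\<kappa> - 1)) * avg \<rho> (\<lambda>z. ennreal (g z powr e * u z powr b)) w \<partial>lborel)"
        by (rule potential_eq_nn_integral_avg) measurable
      also have "\<dots> \<le> (\<integral>\<^sup>+\<rho>. ennreal (C0 powr (e + b)) * (ennreal (\<rho> powr (\<epsilon> - 1) * M w \<rho> powr (e + b)) * indicator {0<..} \<rho>) \<partial>lborel)"
      proof (rule nn_integral_mono)
        fix \<rho> :: real
        show "ennreal (\<rho> powr (\<kappa> - 1)) * avg \<rho> (\<lambda>z. ennreal (g z powr e * u z powr b)) w * indicator {0<..} \<rho>
          \<le> ennreal (C0 powr (e + b)) * (ennreal (\<rho> powr (\<epsilon> - 1) * M w \<rho> powr (e + b)) * indicator {0<..} \<rho>)"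
        proof (cases "\<rho> > 0")
          case True
          have "avg \<rho> (\<lambda>z. ennreal (g z powr e * u z powr b)) w
            \<le> ennreal ((C0 * \<rho> powr (- \<tau>) * M w \<rho>) powr e * (C0 * M w \<rho>) powr b)"
            using True w M0[of \<rho> w] avg_u[of \<rho> w] avg_g[of \<rho> w] e b eb C01 u0 g
            by (intro avg_geometric_mean_le) (auto simp: b_def)
          also have "(C0 * \<rho> powr (- \<tau>) * M w \<rho>) powr e * (C0 * M w \<rho>) powr b
            = C0 powr (e + b) * \<rho> powr (- (\<tau> * e)) * M w \<rho> powr (e + b)"
            using C01 M0[of \<rho> w] True w by (simp add: powr_mult powr_powr powr_add)
          finally have "ennreal (\<rho> powr (\<kappa> - 1)) * avg \<rho> (\<lambda>z. ennreal (g z powr e * u z powr b)) w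
            \<le> ennreal (\<rho> powr (\<kappa> - 1)) * ennreal (C0 powr (e + b) * \<rho> powr (- (\<tau> * e)) * M w \<rho> powr (e + b))"
            by (intro mult_left_mono) auto
          also have "\<dots> = ennreal (C0 powr (e + b)) * ennreal (\<rho> powr (\<kappa> - 1) * \<rho> powr (- (\<tau> * e)) * M w \<rho> powr (e + b))"
            by (simp add: ennreal_mult' mult_ac)
          also have "\<rho> powr (\<kappa> - 1) * \<rho> powr (- (\<tau> * e)) = \<rho> powr (\<epsilon> - 1)"
            by (simp add: powr_add[symmetric] \<epsilon>_def algebra_simps)
          finally show ?thesis using True by simp
        qed auto
      qed
      also have "\<dots> = ennreal (C0 powr (e + b)) * (\<integral>\<^sup>+\<rho>\<in>{0<..}. ennreal (\<rho> powr (\<epsilon> - 1) * M w \<rho> powr (e + b)) \<partial>lborel)"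
        unfolding M_def by (rule nn_integral_cmult) measurable
      also have "\<dots> \<le> ennreal (C0 powr (e + b)) * ennreal ((1 / \<epsilon> + 1 / (m * (e + b) - \<epsilon>)) * (u w powr (e + b - \<epsilon> / m) * A powr (\<epsilon> / m)))"
      proof -
        have "0 < m * a * (p - 1)" using m a p by simp
        then have "\<epsilon> < m * (e + b)" using id2 by linarith
        then show ?thesis
          unfolding M_def using \<kappa>\<tau>e m w A by (intro mult_left_mono nn_integral_powr_min) (auto simp: \<epsilon>_def)
      qed
      finally have "potential \<kappa> (\<lambda>z. ennreal (g z powr e * s z powr (p - 1))) w \<le> ennreal B * (ennreal (C0 powr (e + b)) *
          ennreal ((1 / \<epsilon> + 1 / (m * (e + b) - \<epsilon>)) * (u w powr (e + b - \<epsilon> / m) * A powr (\<epsilon> / m))))"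
        unfolding pB by (rule mult_left_mono) simp
      also have "\<dots> = ennreal (B * (C0 powr (e + b) * ((1 / \<epsilon> + 1 / (m * (e + b) - \<epsilon>)) * (u w powr (e + b - \<epsilon> / m) * A powr (\<epsilon> / m)))))"
        using B by (simp add: ennreal_mult')
      also have "B * (C0 powr (e + b) * ((1 / \<epsilon> + 1 / (m * (e + b) - \<epsilon>)) * (u w powr (e + b - \<epsilon> / m) * A powr (\<epsilon> / m))))
         = C2 * (A powr (\<kappa> * (p - 1) / m) * A powr (\<epsilon> / m)) * u w powr (a * (p - 1))"
        unfolding id id2 C2 B_def m_def[symmetric] a_def[symmetric] e_def[symmetric] b_def[symmetric] \<epsilon>_def[symmetric]
        by (simp add: mult_ac)
      also have "A powr (\<kappa> * (p - 1) / m) * A powr (\<epsilon> / m) = A powr e"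
      proof -
        have "\<kappa> * (p - 1) / m + \<epsilon> / m = \<kappa> * p / m - \<tau> * e / m"
          by (simp add: \<epsilon>_def algebra_simps diff_divide_distrib add_divide_distrib)
        also have "\<dots> = e" using em by simp
        finally show ?thesis by (simp add: powr_add[symmetric])
      qed
      also have "u w powr (a * (p - 1)) = (u w powr a) powr (p - 1)" by (simp add: powr_powr)
      finally show ?thesis .
    qed
    have "(\<integral>\<^sup>+z. ennreal (g z powr e * \<bar>F z\<bar> powr p) \<partial>lborel) \<le> ennreal (C2 * A powr e) * Lp_mass p f"
    proof (rule Schur_test[where K="\<lambda>z w. riesz_kernel \<kappa> (z - w)" and \<sigma>="\<lambda>w. u w powr a" and s=s])
      show "AE w in lborel. 0 < u w powr a" using good by eventually_elim auto
      show "AE z in lborel. 0 < s z \<and> (\<integral>\<^sup>+w. riesz_kernel \<kappa> (z - w) * ennreal (u w powr a) \<partial>lborel) \<le> ennreal (s z)"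
        using good
      proof eventually_elim
        fix z assume z: "0 < u z \<and> U z = ennreal (u z)"
        then have "s z > 0" using C1pos A by (simp add: s_def)
        then show "0 < s z \<and> (\<integral>\<^sup>+w. riesz_kernel \<kappa> (z - w) * ennreal (u w powr a) \<partial>lborel) \<le> ennreal (s z)"
          using pot_u[OF z] by (simp add: potential_def)
      qed
      show "AE w in lborel. (\<integral>\<^sup>+z. riesz_kernel \<kappa> (z - w) * ennreal (g z powr e * s z powr (p - 1)) \<partial>lborel)
        \<le> ennreal (C2 * A powr e * (u w powr a) powr (p - 1))"
        using good
      proof eventually_elim
        fix w assume w: "0 < u w \<and> U w = ennreal (u w)"
        show "(\<integral>\<^sup>+z. riesz_kernel \<kappa> (z - w) * ennreal (g z powr e * s z powr (p - 1)) \<partial>lborel)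
        \<le> ennreal (C2 * A powr e * (u w powr a) powr (p - 1))"
          using pot_gu[OF w] riesz_kernel_diff_commute[of \<kappa> _ w] unfolding potential_def by simp
      qed
      show "0 \<le> C2 * A powr e" using C2pos by simp
      show "AE z in lborel. ennreal \<bar>F z\<bar> \<le> (\<integral>\<^sup>+w. riesz_kernel \<kappa> (z - w) * ennreal \<bar>f w\<bar> \<partial>lborel)"
        using F by (simp add: potential_def)
      show "(\<lambda>(z, w). riesz_kernel \<kappa> (z - w)) \<in> borel_measurable (lborel \<Otimes>\<^sub>M lborel)"
        unfolding case_prod_beta by measurable
    qed (use p in \<open>auto simp: s_def[abs_def]\<close>)
    then show ?thesis by (simp add: e_def)
  qed
qed

theorem Fefferman_Phong:
  fixes p \<kappa> q :: real
  assumes p: "1 < p" and \<kappa>: "0 < \<kappa>" "\<kappa> * p < q"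
  shows "\<exists>C>0. \<forall>(g :: 'a \<Rightarrow> real) (f :: 'a \<Rightarrow> real) F A. 0 \<le> A \<longrightarrow>
    g \<in> borel_measurable borel \<longrightarrow> f \<in> borel_measurable borel \<longrightarrow> (\<forall>z. 0 \<le> g z) \<longrightarrow>
    (\<forall>r>0. \<forall>z. avg r (\<lambda>w. ennreal (g w)) z \<le> ennreal (A * r powr (- q))) \<longrightarrow>
    (AE z in lborel. ennreal \<bar>F z\<bar> \<le> potential \<kappa> (\<lambda>w. ennreal \<bar>f w\<bar>) z) \<longrightarrow>
    (\<integral>\<^sup>+z. ennreal (g z powr (\<kappa> * p / q) * \<bar>F z\<bar> powr p) \<partial>lborel)
      \<le> ennreal (C * A powr (\<kappa> * p / q)) * Lp_mass p f"
proof -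
  have kq: "\<kappa> < q" using mult_strict_left_mono[of 1 p \<kappa>] p \<kappa> by linarith
  then have q: "q > 0" using \<kappa> by simp
  \<comment> \<open>Half of each of the two upper bounds that \<open>\<tau>\<close> must stay
    strictly below, \<open>q / p\<close> and \<open>q - \<kappa>\<close>.\<close>
  define \<tau> where "\<tau> = min (q / (2 * p)) ((q - \<kappa>) / 2)"
  have \<tau>: "0 < \<tau>" "\<tau> * p < q" "\<kappa> < q - \<tau>"
  proof -
    show "0 < \<tau>" using q kq p by (auto simp: \<tau>_def)
    have "\<tau> * p \<le> q / (2 * p) * p" using p by (intro mult_right_mono) (auto simp: \<tau>_def)
    also have "\<dots> < q" using q p by simp
    finally show "\<tau> * p < q" .
    have "\<tau> \<le> (q - \<kappa>) / 2" unfolding \<tau>_def by (rule min.cobounded2)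
    then have "2 * \<tau> \<le> q - \<kappa>" by simp
    then show "\<kappa> < q - \<tau>" using kq by linarith
  qed
  \<comment> \<open>The largest value that the two non-strict constraints on \<open>\<delta>\<close>
    permit; it is positive because \<open>\<kappa> < q - \<tau>\<close> and
    \<open>\<kappa> * p < q\<close>.\<close>
  define \<delta> where "\<delta> = min (1 - \<kappa> / (q - \<tau>)) ((1 - \<kappa> * p / q) / (p - 1))"
  have \<delta>: "0 < \<delta>" "\<kappa> / (q - \<tau>) + \<delta> \<le> 1" "\<kappa> * p / q + \<delta> * (p - 1) \<le> 1"
  proof -
    show "0 < \<delta>" using \<tau> \<kappa> p q by (auto simp: \<delta>_def)
    show "\<kappa> / (q - \<tau>) + \<delta> \<le> 1" by (simp add: \<delta>_def)
    have "\<delta> * (p - 1) \<le> (1 - \<kappa> * p / q) / (p - 1) * (p - 1)"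
      using p by (intro mult_right_mono) (auto simp: \<delta>_def)
    then show "\<kappa> * p / q + \<delta> * (p - 1) \<le> 1" using p by simp
  qed
  define C0 where "C0 = max (2 powr (D + 1)) (max (2 powr D * (2 powr (D + 1) / \<tau> + 1)) (2 powr D * (1 / \<tau> + 1 / (q - \<tau>))))"
  define C1 where "C1 = C0 powr (\<kappa> / (q - \<tau>) + \<delta>) * (1 / \<kappa> + 1 / ((q - \<tau>) * \<delta>))"
  define C2 where "C2 = C1 powr (p - 1) * (C0 powr (\<kappa> * p / q + \<delta> * (p - 1)) *
        (1 / (\<kappa> - \<tau> * (\<kappa> * p / q)) + 1 / (((q - \<tau>) * (\<kappa> / (q - \<tau>) + \<delta>)) * (p - 1))))"
  show ?thesis
  proof (intro exI[of _ "max 1 C2"] conjI allI impI)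
    fix g f :: "'a \<Rightarrow> real" and F A
    assume "0 \<le> A" "g \<in> borel_measurable borel" "f \<in> borel_measurable borel" "\<forall>z. 0 \<le> g z"
      "\<forall>r>0. \<forall>z. avg r (\<lambda>w. ennreal (g w)) z \<le> ennreal (A * r powr (- q))"
      "AE z in lborel. ennreal \<bar>F z\<bar> \<le> potential \<kappa> (\<lambda>w. ennreal \<bar>f w\<bar>) z"
    then have "(\<integral>\<^sup>+z. ennreal (g z powr (\<kappa> * p / q) * \<bar>F z\<bar> powr p) \<partial>lborel)
      \<le> ennreal (C2 * A powr (\<kappa> * p / q)) * Lp_mass p f"
      by (intro Fefferman_Phong_aux[OF p \<kappa> \<tau> \<delta> _ C0_def C1_def C2_def]) auto
    also have "\<dots> \<le> ennreal (max 1 C2 * A powr (\<kappa> * p / q)) * Lp_mass p f"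
      by (intro mult_right_mono ennreal_leI) auto
    finally show "(\<integral>\<^sup>+z. ennreal (g z powr (\<kappa> * p / q) * \<bar>F z\<bar> powr p) \<partial>lborel)
      \<le> ennreal (max 1 C2 * A powr (\<kappa> * p / q)) * Lp_mass p f" .
  qed simp
qed

section \<open>Explicit Riesz kernel and integrals inside and outside a ball\<close>

lemma riesz_kernel_eq:
  assumes "0 < N z" "\<kappa> < D"
  shows "riesz_kernel \<kappa> z = ennreal (N z powr (\<kappa> - D) / (c * (D - \<kappa>)))"
proof -
  \<comment> \<open>Only the radii \<open>\<rho> \<ge> N z\<close> contribute. At
    \<open>N z = 0\<close> the integral diverges while \<open>0 powr x\<close> is 0, so the formula
    is confined to points with \<open>0 < N z\<close>.\<close>
  have "riesz_kernel \<kappa> z = (\<integral>\<^sup>+\<rho>. ennreal (1 / c) * (ennreal (\<rho> powr (- (D - \<kappa>) - 1)) * indicator {N z..} \<rho>) \<partial>lborel)"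
    unfolding riesz_kernel_def
  proof (rule nn_integral_cong)
    fix \<rho> :: real
    show "ennreal (\<rho> powr (\<kappa> - 1)) * ball_kernel \<rho> z * indicator {0<..} \<rho>
      = ennreal (1 / c) * (ennreal (\<rho> powr (- (D - \<kappa>) - 1)) * indicator {N z..} \<rho>)"
    proof (cases "N z \<le> \<rho>")
      case True
      then have "\<rho> > 0" using assms by linarith
      have "\<rho> powr (\<kappa> - 1) * (1 / (c * \<rho> powr D)) = 1 / c * \<rho> powr (- (D - \<kappa>) - 1)"
        using \<open>\<rho> > 0\<close> by (simp add: powr_diff powr_add powr_minus field_simps)
      then have "ennreal (\<rho> powr (\<kappa> - 1)) * ennreal (1 / (c * \<rho> powr D)) = ennreal (1 / c) * ennreal (\<rho> powr (- (D - \<kappa>) - 1))"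
        using c_pos by (subst (1 2) ennreal_mult'[symmetric]) auto
      then show ?thesis using True \<open>\<rho> > 0\<close> by (simp add: ball_kernel_def)
    qed (auto simp: ball_kernel_def)
  qed
  also have "\<dots> = ennreal (1 / c) * ennreal (N z powr (- (D - \<kappa>)) / (D - \<kappa>))"
    using assms nn_integral_powr_to_inf[of "D - \<kappa>" "N z"] by (subst nn_integral_cmult) auto
  also have "\<dots> = ennreal (N z powr (\<kappa> - D) / (c * (D - \<kappa>)))"
    using c_pos by (subst ennreal_mult'[symmetric]) (auto simp: mult_ac)
  finally show ?thesis .
qed

text \<open>The set where \<open>N\<close> is not positive lies in balls of arbitrarily small
  volume; the radius \<open>(\<epsilon> / c) powr (1 / D)\<close> has volume exactly
  \<open>\<epsilon>\<close>.\<close>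

lemma AE_N_pos: "AE z in lborel. 0 < N z"
proof -
  have "emeasure lborel {z. N z \<le> 0} \<le> ennreal (c * \<rho> powr D)" if "\<rho> > 0" for \<rho>
    using that by (subst emeasure_N_le[symmetric]) (auto intro!: emeasure_mono)
  note le = this
  have "emeasure lborel {z. N z \<le> 0} \<le> 0"
  proof (rule ennreal_le_epsilon)
    fix \<epsilon> :: real assume "\<epsilon> > 0"
    then show "emeasure lborel {z. N z \<le> 0} \<le> 0 + ennreal \<epsilon>"
      using le[of "(\<epsilon> / c) powr (1 / D)"] c_pos D_pos by (simp add: powr_powr)
  qed
  then show ?thesis
    by (intro AE_I[where N="{z. N z \<le> 0}"]) auto
qed

text \<open>Layer cake: \<open>N z powr (- s)\<close> is the integral of
  \<open>s * \<rho> powr (- s - 1)\<close> over \<open>\<rho> \<ge> N z\<close>, and Fubini reduces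
  the claim to volumes of balls. Counting full balls instead of shells puts \<open>s\<close> in
  place of \<open>D\<close> in the numerator of the constant.\<close>

lemma nn_integral_outside_ball:
  assumes "D < s" "0 < R"
  shows "(\<integral>\<^sup>+z. ennreal (if R < N z then N z powr (- s) else 0) \<partial>lborel) \<le> ennreal (s * c / (s - D) * R powr (D - s))"
proof -
  have s: "s > 0" using assms D_pos by simp
  have "(\<integral>\<^sup>+z. ennreal (if R < N z then N z powr (- s) else 0) \<partial>lborel)
    \<le> (\<integral>\<^sup>+z. (\<integral>\<^sup>+\<rho>. ennreal (s * \<rho> powr (- s - 1)) * indicator {R..} \<rho> * (if N z \<le> \<rho> then 1 else 0) \<partial>lborel) \<partial>lborel)"
  proof (rule nn_integral_mono)
    fix z :: 'a
    show "ennreal (if R < N z then N z powr (- s) else 0)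
      \<le> (\<integral>\<^sup>+\<rho>. ennreal (s * \<rho> powr (- s - 1)) * indicator {R..} \<rho> * (if N z \<le> \<rho> then 1 else 0) \<partial>lborel)"
    proof (cases "R < N z")
      case True
      have "ennreal (N z powr (- s)) = ennreal s * ennreal (N z powr (- s) / s)"
        using s by (subst ennreal_mult'[symmetric]) auto
      also have "\<dots> = (\<integral>\<^sup>+\<rho>. ennreal s * (ennreal (\<rho> powr (- s - 1)) * indicator {N z..} \<rho>) \<partial>lborel)"
        using s True assms by (subst nn_integral_cmult) (auto simp: nn_integral_powr_to_inf)
      also have "\<dots> \<le> (\<integral>\<^sup>+\<rho>. ennreal (s * \<rho> powr (- s - 1)) * indicator {R..} \<rho> * (if N z \<le> \<rho> then 1 else 0) \<partial>lborel)"
        using True s by (intro nn_integral_mono) (auto simp: indicator_def ennreal_mult' mult_ac)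
      finally show ?thesis using True by simp
    qed auto
  qed
  also have "\<dots> = (\<integral>\<^sup>+\<rho>. (\<integral>\<^sup>+z. ennreal (s * \<rho> powr (- s - 1)) * indicator {R..} \<rho> * (if N z \<le> \<rho> then 1 else 0) \<partial>lborel) \<partial>lborel)"
    by (rule lborel_pair.Fubini') measurable
  also have "\<dots> = (\<integral>\<^sup>+\<rho>. ennreal (s * c) * (ennreal (\<rho> powr (- (s - D) - 1)) * indicator {R..} \<rho>) \<partial>lborel)"
  proof (rule nn_integral_cong)
    fix \<rho> :: real
    show "(\<integral>\<^sup>+z. ennreal (s * \<rho> powr (- s - 1)) * indicator {R..} \<rho> * (if N z \<le> \<rho> then 1 else 0) \<partial>lborel)
      = ennreal (s * c) * (ennreal (\<rho> powr (- (s - D) - 1)) * indicator {R..} \<rho>)"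
    proof (cases "R \<le> \<rho>")
      case True
      have "(\<integral>\<^sup>+z. ennreal (s * \<rho> powr (- s - 1)) * indicator {R..} \<rho> * (if N z \<le> \<rho> then 1 else 0) \<partial>lborel)
        = (\<integral>\<^sup>+z. ennreal (s * \<rho> powr (- s - 1)) * indicator {z. N z \<le> \<rho>} z \<partial>lborel)"
        using True by (intro nn_integral_cong) auto
      also have "\<dots> = ennreal (s * \<rho> powr (- s - 1)) * ennreal (c * \<rho> powr D)"
        using True assms by (subst nn_integral_cmult_indicator) (auto simp: emeasure_N_le)
      also have "\<dots> = ennreal (s * \<rho> powr (- s - 1) * (c * \<rho> powr D))"
        using s by (subst ennreal_mult') auto
      also have "s * \<rho> powr (- s - 1) * (c * \<rho> powr D) = s * c * (\<rho> powr (- s - 1) * \<rho> powr D)"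
        by simp
      also have "\<rho> powr (- s - 1) * \<rho> powr D = \<rho> powr (- (s - D) - 1)"
        by (simp add: powr_add[symmetric] algebra_simps)
      also have "ennreal (s * c * \<rho> powr (- (s - D) - 1)) = ennreal (s * c) * ennreal (\<rho> powr (- (s - D) - 1))"
        using s c_pos by (subst ennreal_mult') auto
      finally show ?thesis using True by simp
    qed auto
  qed
  also have "\<dots> = ennreal (s * c) * ennreal (R powr (- (s - D)) / (s - D))"
    using assms nn_integral_powr_to_inf[of "s - D" R] by (subst nn_integral_cmult) auto
  also have "\<dots> = ennreal (s * c / (s - D) * R powr (D - s))"
    using s c_pos by (subst ennreal_mult'[symmetric]) auto
  finally show ?thesis .
qed

text \<open>The common shape of three later estimates: for the multiplier, for its finite
  differences and for the stable kernel. In each, \<open>R\<close> is the natural scale, at which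
  both terms have the same size.\<close>

lemma nn_integral_two_scales_le:
  assumes s: "D < s" "0 < R" and ab: "0 \<le> a" "0 \<le> b"
    and near: "\<And>z. N z \<le> R \<Longrightarrow> f z \<le> a"
    and far: "\<And>z. R < N z \<Longrightarrow> f z \<le> b * N z powr (- s)"
  shows "(\<integral>\<^sup>+z. ennreal (f z) \<partial>lborel) \<le> ennreal (c * (a * R powr D + b * (s / (s - D)) * R powr (D - s)))"
proof -
  have "(\<integral>\<^sup>+z. ennreal (f z) \<partial>lborel) \<le> (\<integral>\<^sup>+z. ennreal a * indicator {z. N z \<le> R} z +
      ennreal b * ennreal (if R < N z then N z powr (- s) else 0) \<partial>lborel)"
  proof (rule nn_integral_mono)
    fix z
    show "ennreal (f z) \<le> ennreal a * indicator {z. N z \<le> R} z + ennreal b * ennreal (if R < N z then N z powr (- s) else 0)"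
      using near[of z] far[of z] ab by (cases "N z \<le> R") (auto simp: ennreal_leI simp flip: ennreal_mult')
  qed
  also have "\<dots> = ennreal a * emeasure lborel {z. N z \<le> R} +
      ennreal b * (\<integral>\<^sup>+z. ennreal (if R < N z then N z powr (- s) else 0) \<partial>lborel)"
    by (subst nn_integral_add) (auto simp: nn_integral_cmult)
  also have "\<dots> \<le> ennreal a * ennreal (c * R powr D) + ennreal b * ennreal (s * c / (s - D) * R powr (D - s))"
    using s by (intro add_mono mult_left_mono nn_integral_outside_ball) (auto simp: emeasure_N_le)
  also have "\<dots> = ennreal (a * (c * R powr D) + b * (s * c / (s - D) * R powr (D - s)))"
  proof -
    have "0 \<le> s * c / (s - D) * R powr (D - s)" "0 \<le> c * R powr D"
      using s c_pos D_pos by (auto intro!: mult_nonneg_nonneg divide_nonneg_nonneg)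
    then show ?thesis using ab by (simp only: ennreal_plus ennreal_mult'' mult_nonneg_nonneg)
  qed
  also have "a * (c * R powr D) + b * (s * c / (s - D) * R powr (D - s)) = c * (a * R powr D + b * (s / (s - D)) * R powr (D - s))"
    by (simp add: algebra_simps)
  finally show ?thesis .
qed

end

subsection \<open>Derivatives of the stable multiplier\<close>

text \<open>Functions of \<open>t\<close>, \<open>l = \<xi> \<bullet> h\<close>, \<open>w = \<xi> \<bullet> \<xi>\<close> and \<open>c = h \<bullet> h\<close> containing the \<open>n\<close>-th derivatives of
  \<open>exp (- t * norm \<xi> powr \<alpha>)\<close> in direction \<open>h\<close>. The exponent of \<open>w\<close> makes a monomial homogeneous of
  degree \<open>k * \<alpha> - n\<close> in \<open>\<xi>\<close>.\<close>

inductive stable_symbol :: "real \<Rightarrow> nat \<Rightarrow> (real \<Rightarrow> real \<Rightarrow> real \<Rightarrow> real \<Rightarrow> real) \<Rightarrow> bool" for \<alpha> where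
  monom: "1 \<le> k \<Longrightarrow> j + 2 * i = n \<Longrightarrow> \<beta> = (real k * \<alpha> - real n - real j) / 2 \<Longrightarrow>
    stable_symbol \<alpha> n (\<lambda>t l w c. a * t ^ k * l ^ j * c ^ i * w powr \<beta> * exp (- (t * w powr (\<alpha> / 2))))"
| add: "stable_symbol \<alpha> n F \<Longrightarrow> stable_symbol \<alpha> n G \<Longrightarrow> stable_symbol \<alpha> n (\<lambda>t l w c. F t l w c + G t l w c)"

text \<open>The conditions on \<open>l\<close> and \<open>w\<close> are those that hold along the
  line \<open>\<xi> + s *\<^sub>R h\<close>, where \<open>l\<close> has slope \<open>c\<close> and
  \<open>w\<close> has slope \<open>2 * l\<close>. Directional derivatives thus become one-variable
  calculus, and \<open>0 < w s\<close> keeps the line off the origin.\<close>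

abbreviation line_derivative ::
    "(real \<Rightarrow> real \<Rightarrow> real \<Rightarrow> real \<Rightarrow> real) \<Rightarrow> (real \<Rightarrow> real \<Rightarrow> real \<Rightarrow> real \<Rightarrow> real) \<Rightarrow> bool" where
  "line_derivative F F' \<equiv> \<forall>t c l w s. (l has_real_derivative c) (at s) \<longrightarrow>
    (w has_real_derivative 2 * l s) (at s) \<longrightarrow> 0 < w s \<longrightarrow>
    ((\<lambda>s. F t (l s) (w s) c) has_real_derivative F' t (l s) (w s) c) (at s)"

text \<open>The product rule yields one monomial for each of the factors \<open>l ^ j\<close>,
  \<open>w powr \<beta>\<close> and the exponential. The last one gains a factor \<open>t\<close>
  together with \<open>\<alpha> / 2\<close> in the exponent of \<open>w\<close>, in agreement with
  the index rule.\<close>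

lemma stable_symbol_derivative:
  assumes "stable_symbol \<alpha> n F"
  shows "\<exists>F'. stable_symbol \<alpha> (Suc n) F' \<and> line_derivative F F'"
  using assms
proof induction
  case (monom k j i n \<beta> a)
  let ?m = "\<lambda>a k j i \<beta> t l w c. a * t ^ k * l ^ j * c ^ i * w powr \<beta> * exp (- (t * w powr (\<alpha> / 2))) :: real"
  \<comment> \<open>For \<open>j = 0\<close> this term vanishes, but truncated subtraction in
    \<open>j - 1\<close> would violate \<open>j + 2 * i = n\<close> for the new order. A monomial
    with admissible indices and coefficient 0 represents it instead.\<close>
  define F1 where "F1 = (if j = 0 then ?m 0 k (Suc j) i (\<beta> - 1) else ?m (a * real j) k (j - 1) (Suc i) \<beta>)"
  define F2 where "F2 = ?m (a * (2 * \<beta>)) k (Suc j) i (\<beta> - 1)"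
  define F3 where "F3 = ?m (- (a * \<alpha>)) (Suc k) (Suc j) i (\<beta> - 1 + \<alpha> / 2)"
  have 2: "stable_symbol \<alpha> (Suc n) F2" unfolding F2_def
    using monom by (intro stable_symbol.monom) (auto simp: field_simps)
  have 3: "stable_symbol \<alpha> (Suc n) F3" unfolding F3_def
    using monom by (intro stable_symbol.monom) (auto simp: field_simps)
  have 1: "stable_symbol \<alpha> (Suc n) F1"
  proof (cases "j = 0")
    case True
    have "stable_symbol \<alpha> (Suc n) (?m 0 k (Suc j) i (\<beta> - 1))"
      using monom by (intro stable_symbol.monom) (auto simp: field_simps)
    then show ?thesis using True unfolding F1_def by (simp only: if_True simp_thms)
  next
    case False
    have "stable_symbol \<alpha> (Suc n) (?m (a * real j) k (j - 1) (Suc i) \<beta>)"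
      using monom False by (intro stable_symbol.monom) (auto simp: field_simps of_nat_diff)
    then show ?thesis using False unfolding F1_def by (simp only: if_False simp_thms)
  qed
  have "stable_symbol \<alpha> (Suc n) (\<lambda>t l w c. (F1 t l w c + F2 t l w c) + F3 t l w c)"
    by (intro stable_symbol.add 1 2 3)
  moreover have "((\<lambda>s. ?m a k j i \<beta> t (l s) (w s) c) has_real_derivative
     (F1 t (l s) (w s) c + F2 t (l s) (w s) c) + F3 t (l s) (w s) c) (at s)"
    if l: "(l has_real_derivative c) (at s)" and w: "(w has_real_derivative 2 * l s) (at s)" and w0: "0 < w s"
    for t c l w s
  proof -
    have dw: "((\<lambda>s. w s powr b) has_real_derivative b * (2 * l s) * w s powr (b - 1)) (at s)" for b
      using w w0 by (auto intro!: derivative_eq_intros simp: powr_diff)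
    have de: "((\<lambda>s. exp (- (t * w s powr (\<alpha> / 2)))) has_real_derivative
       exp (- (t * w s powr (\<alpha> / 2))) * (- (t * (\<alpha> / 2 * (2 * l s) * w s powr (\<alpha> / 2 - 1))))) (at s)"
      by (intro DERIV_fun_exp DERIV_minus DERIV_cmult dw)
    have dl: "((\<lambda>s. l s ^ j) has_real_derivative real j * l s ^ (j - 1) * c) (at s)"
      using DERIV_power[OF l, of j] by (simp add: mult_ac)
    have "((\<lambda>s. (a * t ^ k * c ^ i) * (l s ^ j * (w s powr \<beta> * exp (- (t * w s powr (\<alpha> / 2)))))) has_real_derivative
      (a * t ^ k * c ^ i) * ((real j * l s ^ (j - 1) * c) * (w s powr \<beta> * exp (- (t * w s powr (\<alpha> / 2))))
        + ((\<beta> * (2 * l s) * w s powr (\<beta> - 1)) * exp (- (t * w s powr (\<alpha> / 2)))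
        + (exp (- (t * w s powr (\<alpha> / 2))) * (- (t * (\<alpha> / 2 * (2 * l s) * w s powr (\<alpha> / 2 - 1))))) * w s powr \<beta>) * l s ^ j)) (at s)"
      by (intro DERIV_cmult DERIV_mult dl dw de)
    moreover have "(a * t ^ k * c ^ i) * (l s ^ j * (w s powr \<beta> * exp (- (t * w s powr (\<alpha> / 2))))) = ?m a k j i \<beta> t (l s) (w s) c" for s
      by (simp add: mult_ac)
    moreover have "(a * t ^ k * c ^ i) * ((real j * l s ^ (j - 1) * c) * (w s powr \<beta> * exp (- (t * w s powr (\<alpha> / 2))))
        + ((\<beta> * (2 * l s) * w s powr (\<beta> - 1)) * exp (- (t * w s powr (\<alpha> / 2)))
        + (exp (- (t * w s powr (\<alpha> / 2))) * (- (t * (\<alpha> / 2 * (2 * l s) * w s powr (\<alpha> / 2 - 1))))) * w s powr \<beta>) * l s ^ j)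
      = (F1 t (l s) (w s) c + F2 t (l s) (w s) c) + F3 t (l s) (w s) c"
    proof -
      have "w s powr (\<beta> - 1 + \<alpha> / 2) = w s powr (\<alpha> / 2 - 1) * w s powr \<beta>"
        by (simp add: powr_add[symmetric] algebra_simps)
      then show ?thesis by (simp add: F1_def F2_def F3_def algebra_simps)
    qed
    ultimately show ?thesis by simp
  qed
  ultimately show ?case by blast
next
  case (add n F G)
  then obtain F' G' where "stable_symbol \<alpha> (Suc n) F'" "stable_symbol \<alpha> (Suc n) G'"
    and "line_derivative F F'" "line_derivative G G'"
    by blast
  then show ?case
    by (intro exI[of _ "\<lambda>t l w c. F' t l w c + G' t l w c"] conjI stable_symbol.add allI impI DERIV_add) auto
qed

lemma power_le_exp:
  fixes y :: real
  assumes "0 \<le> y"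
  shows "y ^ n \<le> real n ^ n * exp y"
proof (cases "n = 0")
  case False
  have "(y / n) ^ n \<le> (1 + y / n) ^ n" using assms by (intro power_mono) auto
  also have "\<dots> \<le> exp y" using assms False by (intro exp_ge_one_plus_x_over_n_power_n) auto
  finally show ?thesis using False by (simp add: power_divide field_simps)
qed (use assms in auto)

text \<open>Each monomial has at least one factor \<open>t\<close>. That one is kept; the other
  \<open>k - 1\<close> factors combine with powers of \<open>w\<close> into powers of
  \<open>y = t * w powr (\<alpha> / 2)\<close>, which the exponential absorbs. The surviving factor
  is the linear dependence on \<open>t\<close> in the decay of the stable kernel.\<close>

lemma stable_symbol_bound:
  assumes "stable_symbol \<alpha> n F"
  shows "\<exists>K\<ge>0. \<forall>t l w c. 0 < t \<longrightarrow> 0 < w \<longrightarrow> 0 < c \<longrightarrow> l\<^sup>2 \<le> c * w \<longrightarrow>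
    \<bar>F t l w c\<bar> \<le> K * t * c powr (real n / 2) * w powr ((\<alpha> - real n) / 2)"
  using assms
proof induction
  case (monom k j i n \<beta> a)
  \<comment> \<open>For \<open>k = 1\<close> the constant reads \<open>0 ^ 0 = 1\<close>, as
    required for \<open>exp (- y) \<le> 1\<close>.\<close>
  define K where "K = \<bar>a\<bar> * real (k - 1) ^ (k - 1)"
  show ?case
  proof (intro exI[of _ K] conjI allI impI)
    fix t l w c :: real
    assume t: "0 < t" and w: "0 < w" and c: "0 < c" and l: "l\<^sup>2 \<le> c * w"
    define y where "y = t * w powr (\<alpha> / 2)"
    have y: "y > 0" using t w by (simp add: y_def)
    have "\<bar>l\<bar> \<le> sqrt (c * w)" using l by (metis real_sqrt_abs real_sqrt_le_iff)
    then have "\<bar>l\<bar> ^ j \<le> sqrt (c * w) ^ j" by (intro power_mono) auto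
    also have "\<dots> = ((c * w) powr (1 / 2)) powr (real j)"
      using c w by (subst powr_realpow) (auto simp: powr_half_sqrt)
    also have "\<dots> = c powr (real j / 2) * w powr (real j / 2)"
      using c w by (simp add: powr_powr powr_mult)
    finally have lj: "\<bar>l\<bar> ^ j \<le> c powr (real j / 2) * w powr (real j / 2)" .
    have ci: "c powr (real j / 2) * c ^ i = c powr (real n / 2)"
    proof -
      have "c powr (real j / 2) * c ^ i = c powr (real j / 2 + real i)" using c by (simp add: powr_add powr_realpow)
      also have "real j / 2 + real i = real n / 2" using monom by (auto simp: field_simps)
      finally show ?thesis .
    qed
    have tk: "t ^ k * (w powr (real j / 2) * w powr \<beta>) = t * w powr ((\<alpha> - real n) / 2) * y ^ (k - 1)"
    proof -
      have 1: "t ^ k = t * t ^ (k - 1)" using monom(1) by (cases k) auto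
      have "(w powr (\<alpha> / 2)) ^ (k - 1) = (w powr (\<alpha> / 2)) powr (real (k - 1))"
        using w by (subst powr_realpow) auto
      also have "\<dots> = w powr (\<alpha> / 2 * real (k - 1))" by (simp add: powr_powr)
      finally have 2: "y ^ (k - 1) = t ^ (k - 1) * w powr (\<alpha> / 2 * real (k - 1))"
        by (simp add: y_def power_mult_distrib)
      have 3: "real j / 2 + \<beta> = (\<alpha> - real n) / 2 + \<alpha> / 2 * real (k - 1)"
        using monom(1) unfolding monom(3) by (simp add: of_nat_diff field_simps)
      have "w powr (real j / 2) * w powr \<beta> = w powr ((\<alpha> - real n) / 2) * w powr (\<alpha> / 2 * real (k - 1))"
        unfolding powr_add[symmetric] 3 ..
      then show ?thesis unfolding 1 2 by (simp add: mult_ac)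
    qed
    have "\<bar>a * t ^ k * l ^ j * c ^ i * w powr \<beta> * exp (- (t * w powr (\<alpha> / 2)))\<bar>
      = \<bar>a\<bar> * t ^ k * c ^ i * w powr \<beta> * exp (- y) * \<bar>l\<bar> ^ j"
      using t c by (simp add: abs_mult power_abs y_def mult_ac)
    also have "\<dots> \<le> \<bar>a\<bar> * t ^ k * c ^ i * w powr \<beta> * exp (- y) * (c powr (real j / 2) * w powr (real j / 2))"
      using t c w by (intro mult_left_mono lj) auto
    also have "\<dots> = \<bar>a\<bar> * (c powr (real j / 2) * c ^ i) * (t ^ k * (w powr (real j / 2) * w powr \<beta>)) * exp (- y)"
      by (simp add: mult_ac)
    also have "\<dots> = \<bar>a\<bar> * c powr (real n / 2) * t * w powr ((\<alpha> - real n) / 2) * (y ^ (k - 1) * exp (- y))"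
      unfolding ci tk by (simp add: mult_ac)
    also have "\<dots> \<le> \<bar>a\<bar> * c powr (real n / 2) * t * w powr ((\<alpha> - real n) / 2) * real (k - 1) ^ (k - 1)"
      using power_le_exp[of y "k - 1"] y t by (intro mult_left_mono) (auto simp: exp_minus field_simps)
    also have "\<dots> = K * t * c powr (real n / 2) * w powr ((\<alpha> - real n) / 2)"
      by (simp add: K_def mult_ac)
    finally show "\<bar>a * t ^ k * l ^ j * c ^ i * w powr \<beta> * exp (- (t * w powr (\<alpha> / 2)))\<bar>
      \<le> K * t * c powr (real n / 2) * w powr ((\<alpha> - real n) / 2)" .
  qed (simp add: K_def)
next
  case (add n F G)
  then obtain K1 K2 where K: "K1 \<ge> 0" "K2 \<ge> 0"
    and F: "\<And>t l w c. 0 < t \<Longrightarrow> 0 < w \<Longrightarrow> 0 < c \<Longrightarrow> l\<^sup>2 \<le> c * w \<Longrightarrow>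
      \<bar>F t l w c\<bar> \<le> K1 * t * c powr (real n / 2) * w powr ((\<alpha> - real n) / 2)"
    and G: "\<And>t l w c. 0 < t \<Longrightarrow> 0 < w \<Longrightarrow> 0 < c \<Longrightarrow> l\<^sup>2 \<le> c * w \<Longrightarrow>
      \<bar>G t l w c\<bar> \<le> K2 * t * c powr (real n / 2) * w powr ((\<alpha> - real n) / 2)"
    by blast
  show ?case
  proof (intro exI[of _ "K1 + K2"] conjI allI impI)
    fix t l w c :: real
    assume "0 < t" "0 < w" "0 < c" "l\<^sup>2 \<le> c * w"
    from add_mono[OF F[OF this] G[OF this]]
    show "\<bar>F t l w c + G t l w c\<bar> \<le> (K1 + K2) * t * c powr (real n / 2) * w powr ((\<alpha> - real n) / 2)"
      by (simp add: algebra_simps)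
  qed (use K in auto)
qed

section \<open>Iterated finite differences\<close>

definition fdiff :: "'a::ab_group_add \<Rightarrow> ('a \<Rightarrow> real) \<Rightarrow> 'a \<Rightarrow> real" where
  "fdiff h f x = f (x + h) - f x"

lemma fdiff_funpow_line:
  fixes h :: "'a::real_vector"
  shows "(fdiff 1 ^^ n) (\<lambda>s. f (x + s *\<^sub>R h)) s = (fdiff h ^^ n) f (x + s *\<^sub>R h)"
  by (induction n arbitrary: s) (auto simp: fdiff_def algebra_simps)

text \<open>The mean value theorem, once per difference. The induction runs over the whole sequence
  of derivatives, because differencing the function also differences all of its derivatives; the
  interval has the length \<open>n\<close> covered by the unit steps.\<close>

lemma fdiff_funpow_le_derivative:
  fixes f :: "nat \<Rightarrow> real \<Rightarrow> real"
  assumes "\<And>k s. k < n \<Longrightarrow> s \<in> {a..a + real n} \<Longrightarrow> (f k has_real_derivative f (Suc k) s) (at s)"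
    and "\<And>s. s \<in> {a..a + real n} \<Longrightarrow> \<bar>f n s\<bar> \<le> B"
  shows "\<bar>(fdiff 1 ^^ n) (f 0) a\<bar> \<le> B"
  using assms
proof (induction n arbitrary: f)
  case (Suc n)
  have "\<bar>(fdiff 1 ^^ n) (fdiff 1 (f 0)) a\<bar> \<le> B"
  proof (rule Suc.IH[where f="\<lambda>k. fdiff 1 (f k)"])
    fix k s assume k: "k < n" and s: "s \<in> {a..a + real n}"
    have 1: "(f k has_real_derivative f (Suc k) s) (at s)" "(f k has_real_derivative f (Suc k) (s + 1)) (at (s + 1))"
      using Suc.prems(1)[of k s] Suc.prems(1)[of k "s + 1"] k s by auto
    from 1(2) have "((\<lambda>s. f k (s + 1)) has_real_derivative f (Suc k) (s + 1)) (at s)"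
      by (simp add: DERIV_shift)
    from DERIV_diff[OF this 1(1)]
    show "(fdiff 1 (f k) has_real_derivative fdiff 1 (f (Suc k)) s) (at s)"
      by (simp add: fdiff_def[abs_def])
  next
    fix s assume s: "s \<in> {a..a + real n}"
    have "\<exists>z>s. z < s + 1 \<and> f n (s + 1) - f n s = (s + 1 - s) * f (Suc n) z"
      using s by (intro MVT2 Suc.prems(1)) auto
    then show "\<bar>fdiff 1 (f n) s\<bar> \<le> B"
      using Suc.prems(2) s by (auto simp: fdiff_def)
  qed
  then show ?case by (simp add: funpow_swap1)
qed auto

lemma fdiff_funpow_le_sup:
  fixes h :: "'a::real_vector"
  assumes "\<And>k. k \<le> n \<Longrightarrow> \<bar>f (x + real k *\<^sub>R h)\<bar> \<le> B"
  shows "\<bar>(fdiff h ^^ n) f x\<bar> \<le> 2 ^ n * B"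
  using assms
proof (induction n arbitrary: x)
  case (Suc n)
  have "\<bar>(fdiff h ^^ n) f (x + h)\<bar> \<le> 2 ^ n * B"
  proof (rule Suc.IH)
    fix k assume "k \<le> n"
    then show "\<bar>f (x + h + real k *\<^sub>R h)\<bar> \<le> B"
      using Suc.prems[of "Suc k"] by (simp add: scaleR_left_distrib add.assoc)
  qed
  moreover have "\<bar>(fdiff h ^^ n) f x\<bar> \<le> 2 ^ n * B" using Suc by simp
  ultimately show ?case by (simp add: fdiff_def[of h "(fdiff h ^^ n) f"])
qed (use assms[of 0] in simp)

text \<open>Permits replacing the multiplier by the multiplier minus 1, which is small near the
  origin.\<close>

lemma fdiff_funpow_add_const:
  "0 < n \<Longrightarrow> (fdiff h ^^ n) (\<lambda>x. f x + a) = (fdiff h ^^ n) f"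
proof (cases n)
  case (Suc k)
  have "fdiff h (\<lambda>x. f x + a) = fdiff h f" by (auto simp: fdiff_def)
  then show ?thesis by (simp add: Suc funpow_swap1)
qed simp

lemma fdiff_funpow_measurable[measurable]:
  fixes h :: "'a::euclidean_space"
  assumes [measurable]: "f \<in> borel_measurable borel"
  shows "(fdiff h ^^ n) f \<in> borel_measurable borel"
  by (induction n) (auto simp: fdiff_def[abs_def])

interpretation euclidean_norm: homogeneous_norm "norm :: 'a::euclidean_space \<Rightarrow> real"
  "unit_ball_vol (real DIM('a))" "real DIM('a)"
proof
  fix \<rho> :: real assume "0 < \<rho>"
  moreover have "{z :: 'a. norm z \<le> \<rho>} = cball 0 \<rho>" by auto
  ultimately show "emeasure lborel {z :: 'a. norm z \<le> \<rho>} = ennreal (unit_ball_vol (real DIM('a)) * \<rho> powr real DIM('a))"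
    by (simp add: emeasure_cball powr_realpow)
qed (auto simp: norm_triangle_ineq)

abbreviation stable_multiplier :: "real \<Rightarrow> real \<Rightarrow> 'a::euclidean_space \<Rightarrow> real" where
  "stable_multiplier \<alpha> t \<xi> \<equiv> exp (- t * norm \<xi> powr \<alpha>)"

text \<open>The condition \<open>2 * real n * norm h < norm \<xi>\<close> keeps all \<open>n\<close>
  steps at distance at least \<open>norm \<xi> / 2\<close> from the singularity at the origin. As
  \<open>\<alpha> - real n\<close> is not positive, this halving produces the factor
  \<open>2 powr (real n - \<alpha>)\<close>.\<close>

lemma stable_multiplier_directional_derivatives:
  assumes n: "1 \<le> n" and \<alpha>: "0 < \<alpha>"
  shows "\<exists>K\<ge>0. \<forall>t>0. \<forall>\<xi> h :: 'a::euclidean_space. h \<noteq> 0 \<longrightarrow> 2 * real n * norm h < norm \<xi> \<longrightarrow> real n \<ge> \<alpha> \<longrightarrow>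
    \<bar>(fdiff h ^^ n) (stable_multiplier \<alpha> t) \<xi>\<bar> \<le> K * t * norm h ^ n * norm \<xi> powr (\<alpha> - real n)"
proof -
  \<comment> \<open>The multiplier itself has no factor \<open>t\<close> and is not a symbol, so the
    chain starts at its first derivative. Hence the index shift: \<open>G k\<close> below belongs to
    the derivative of order \<open>Suc k\<close>.\<close>
  define F1 where "F1 = (\<lambda>t l w c :: real. - \<alpha> * t ^ 1 * l ^ 1 * c ^ 0 * w powr (\<alpha> / 2 - 1) * exp (- (t * w powr (\<alpha> / 2))))"
  have F1: "stable_symbol \<alpha> 1 F1"
    unfolding F1_def by (rule stable_symbol.monom) (auto simp: field_simps)
  \<comment> \<open>The symbols are chosen before \<open>t\<close>, \<open>\<xi>\<close> and
    \<open>h\<close>, which makes the bound \<open>K\<close> uniform in them.\<close>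
  have "\<exists>G. \<forall>k. (stable_symbol \<alpha> (Suc k) (G k) \<and> (k = 0 \<longrightarrow> G k = F1)) \<and> line_derivative (G k) (G (Suc k))"
  proof (rule dependent_nat_choice)
    show "\<exists>F. stable_symbol \<alpha> (Suc 0) F \<and> (0 = 0 \<longrightarrow> F = F1)" using F1 by auto
    show "\<exists>F'. (stable_symbol \<alpha> (Suc (Suc k)) F' \<and> (Suc k = 0 \<longrightarrow> F' = F1)) \<and> line_derivative F F'"
      if "stable_symbol \<alpha> (Suc k) F \<and> (k = 0 \<longrightarrow> F = F1)" for F k
      using stable_symbol_derivative[of \<alpha> "Suc k" F] that by auto
  qed
  then obtain G where GP: "\<forall>k. (stable_symbol \<alpha> (Suc k) (G k) \<and> (k = 0 \<longrightarrow> G k = F1)) \<and> line_derivative (G k) (G (Suc k))" ..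
  have G0: "G 0 = F1" and G: "stable_symbol \<alpha> (Suc k) (G k)" for k
    using GP by simp_all
  have dG: "((\<lambda>s. G k t (l s) (w s) c) has_real_derivative G (Suc k) t (l s) (w s) c) (at s)"
    if "(l has_real_derivative c) (at s)" "(w has_real_derivative 2 * l s) (at s)" "0 < w s" for k t c l w s
    using GP that by simp
  from stable_symbol_bound[OF G, of "n - 1"] n obtain K where K: "K \<ge> 0" and
    bd: "\<And>t l w c. 0 < t \<Longrightarrow> 0 < w \<Longrightarrow> 0 < c \<Longrightarrow> l\<^sup>2 \<le> c * w \<Longrightarrow>
    \<bar>G (n - 1) t l w c\<bar> \<le> K * t * c powr (real n / 2) * w powr ((\<alpha> - real n) / 2)"
    by auto
  show ?thesis
  proof (intro exI[of _ "K * 2 powr (real n - \<alpha>)"] conjI allI impI)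
    fix t :: real and \<xi> h :: 'a
    assume t: "0 < t" and h: "h \<noteq> 0" and far: "2 * real n * norm h < norm \<xi>" and n\<alpha>: "real n \<ge> \<alpha>"
    define l where "l s = (\<xi> + s *\<^sub>R h) \<bullet> h" for s
    define w where "w s = (\<xi> + s *\<^sub>R h) \<bullet> (\<xi> + s *\<^sub>R h)" for s
    define c where "c = h \<bullet> h"
    define f where "f k = (if k = 0 then (\<lambda>s. stable_multiplier \<alpha> t (\<xi> + s *\<^sub>R h)) else (\<lambda>s. G (k - 1) t (l s) (w s) c))" for k
    have c: "c > 0" using h by (simp add: c_def)
    have half: "norm \<xi> / 2 \<le> norm (\<xi> + s *\<^sub>R h)" if "s \<in> {0..0 + real n}" for s
    proof -
      have "norm (s *\<^sub>R h) \<le> real n * norm h" using that by (auto intro: mult_right_mono)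
      moreover have "norm \<xi> \<le> norm (\<xi> + s *\<^sub>R h) + norm (s *\<^sub>R h)"
        using norm_triangle_ineq4[of "\<xi> + s *\<^sub>R h" "s *\<^sub>R h"] by simp
      ultimately show ?thesis using far by linarith
    qed
    have \<xi>: "norm \<xi> > 0" using far by (smt (verit) mult_nonneg_nonneg norm_ge_zero of_nat_0_le_iff)
    have w0: "0 < w s" if "s \<in> {0..0 + real n}" for s
      using half[OF that] \<xi> by (auto simp: w_def)
    have dl: "(l has_real_derivative c) (at s)" for s
      unfolding l_def[abs_def] c_def by (auto intro!: derivative_eq_intros simp: inner_add_left)
    have weq: "w s = \<xi> \<bullet> \<xi> + 2 * s * (\<xi> \<bullet> h) + s ^ 2 * (h \<bullet> h)" for s
      by (simp add: w_def inner_add_left inner_add_right inner_commute power2_eq_square algebra_simps)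
    have dw: "(w has_real_derivative 2 * l s) (at s)" for s
      unfolding weq[abs_def] l_def by (auto intro!: derivative_eq_intros simp: inner_add_left algebra_simps)
    have "\<bar>(fdiff 1 ^^ n) (f 0) 0\<bar> \<le> K * t * c powr (real n / 2) * ((norm \<xi> / 2)\<^sup>2) powr ((\<alpha> - real n) / 2)"
    proof (rule fdiff_funpow_le_derivative)
      fix k s assume k: "k < n" and s: "s \<in> {0..0 + real n}"
      show "(f k has_real_derivative f (Suc k) s) (at s)"
      proof (cases k)
        case 0
        have "(\<lambda>s. stable_multiplier \<alpha> t (\<xi> + s *\<^sub>R h)) = (\<lambda>s. exp (- (t * w s powr (\<alpha> / 2))))"
        proof
          fix s
          have "norm (\<xi> + s *\<^sub>R h) powr \<alpha> = (norm (\<xi> + s *\<^sub>R h) powr 2) powr (\<alpha> / 2)" unfolding powr_powr by simp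
          also have "norm (\<xi> + s *\<^sub>R h) powr 2 = w s" by (simp add: w_def power2_norm_eq_inner)
          finally show "stable_multiplier \<alpha> t (\<xi> + s *\<^sub>R h) = exp (- (t * w s powr (\<alpha> / 2)))" by simp
        qed
        moreover have "((\<lambda>s. exp (- (t * w s powr (\<alpha> / 2)))) has_real_derivative
          exp (- (t * w s powr (\<alpha> / 2))) * (- (t * (\<alpha> / 2 * (2 * l s) * w s powr (\<alpha> / 2 - 1))))) (at s)"
          using dw[of s] w0[OF s] by (intro DERIV_fun_exp) (auto intro!: derivative_eq_intros simp: powr_diff)
        ultimately show ?thesis by (simp add: f_def 0 G0 F1_def mult_ac)
      next
        case (Suc j)
        then show ?thesis using dG[OF dl dw w0[OF s], of j t] by (simp add: f_def)
      qed
    next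
      fix s assume s: "s \<in> {0..0 + real n}"
      have "\<bar>f n s\<bar> \<le> K * t * c powr (real n / 2) * w s powr ((\<alpha> - real n) / 2)"
      proof -
        have "(l s)\<^sup>2 \<le> c * w s"
          using Cauchy_Schwarz_ineq[of "\<xi> + s *\<^sub>R h" h] by (simp add: l_def c_def w_def mult_ac)
        then show ?thesis using bd[OF t w0[OF s] c] n by (simp add: f_def)
      qed
      also have "w s powr ((\<alpha> - real n) / 2) \<le> ((norm \<xi> / 2)\<^sup>2) powr ((\<alpha> - real n) / 2)"
      proof (rule powr_mono2')
        show "(norm \<xi> / 2)\<^sup>2 \<le> w s"
          unfolding w_def power2_norm_eq_inner[symmetric] using half[OF s] by (intro power_mono) auto
      qed (use n\<alpha> \<xi> in auto)
      finally show "\<bar>f n s\<bar> \<le> K * t * c powr (real n / 2) * ((norm \<xi> / 2)\<^sup>2) powr ((\<alpha> - real n) / 2)"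
        using K t by (simp add: mult_left_mono)
    qed
    also have "(fdiff 1 ^^ n) (f 0) 0 = (fdiff h ^^ n) (stable_multiplier \<alpha> t) \<xi>"
      using fdiff_funpow_line[of n "stable_multiplier \<alpha> t" \<xi> h 0] by (simp add: f_def)
    also have "c powr (real n / 2) = norm h ^ n"
    proof -
      have "c = norm h powr 2" by (simp add: c_def power2_norm_eq_inner)
      then have "c powr (real n / 2) = norm h powr (2 * (real n / 2))" by (simp only: powr_powr)
      then show ?thesis using h by (simp add: powr_realpow)
    qed
    also have "((norm \<xi> / 2)\<^sup>2) powr ((\<alpha> - real n) / 2) = 2 powr (real n - \<alpha>) * norm \<xi> powr (\<alpha> - real n)"
    proof -
      have "((norm \<xi> / 2)\<^sup>2) = (norm \<xi> / 2) powr 2" by simp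
      then have "((norm \<xi> / 2)\<^sup>2) powr ((\<alpha> - real n) / 2) = (norm \<xi> / 2) powr (\<alpha> - real n)"
        by (simp only: powr_powr) (simp add: diff_divide_distrib)
      also have "\<dots> = norm \<xi> powr (\<alpha> - real n) * 2 powr (- (\<alpha> - real n))"
        using powr_minus_divide[of 2 "\<alpha> - real n"] by (simp add: powr_divide)
      finally show ?thesis by (simp add: mult_ac)
    qed
    finally show "\<bar>(fdiff h ^^ n) (stable_multiplier \<alpha> t) \<xi>\<bar> \<le> K * 2 powr (real n - \<alpha>) * t * norm h ^ n * norm \<xi> powr (\<alpha> - real n)"
      by (simp add: mult_ac)
  qed (use K in auto)
qed

subsection \<open>Bounds for the stable kernel\<close>

text \<open>Inside the radius \<open>t powr (- 1 / \<alpha>)\<close> the multiplier is at most 1;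
  outside, the exponential is bounded by a negative power of its argument. Both parts scale like
  \<open>t powr (- (d / \<alpha>))\<close>.\<close>

lemma nn_integral_stable_multiplier_le:
  assumes \<alpha>: "1 < \<alpha>"
  shows "\<exists>C>0. \<forall>t>0. (\<integral>\<^sup>+\<xi>. ennreal (stable_multiplier \<alpha> t (\<xi> :: 'a::euclidean_space)) \<partial>lborel)
    \<le> ennreal (C * t powr (- (real DIM('a) / \<alpha>)))"
proof -
  let ?d = "real DIM('a)"
  let ?v = "unit_ball_vol ?d"
  \<comment> \<open>Large enough for the tail of order \<open>j * \<alpha>\<close> to be integrable,
    since \<open>\<alpha> > 1\<close> gives \<open>j * \<alpha> > d\<close>.\<close>
  define j where "j = Suc (DIM('a))"
  have v: "?v > 0" by (rule euclidean_norm.c_pos)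
  have j: "real j * \<alpha> > ?d"
  proof -
    have "real j * 1 < real j * \<alpha>" using \<alpha> by (intro mult_strict_left_mono) (auto simp: j_def)
    moreover have "real j = ?d + 1" by (simp add: j_def)
    ultimately show ?thesis by linarith
  qed
  define K where "K = real j ^ j * (real j * \<alpha> / (real j * \<alpha> - ?d))"
  have K: "K \<ge> 0" using j \<alpha> by (auto simp: K_def intro!: mult_nonneg_nonneg divide_nonneg_nonneg)
  show ?thesis
  proof (intro exI[of _ "?v * (1 + K)"] conjI allI impI)
    show "?v * (1 + K) > 0" using K by (intro mult_pos_pos v) auto
    fix t :: real assume t: "0 < t"
    define R where "R = t powr (- 1 / \<alpha>)"
    have R: "R > 0" using t by (simp add: R_def)
    have "(\<integral>\<^sup>+\<xi>. ennreal (stable_multiplier \<alpha> t (\<xi> :: 'a)) \<partial>lborel)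
      \<le> ennreal (?v * (1 * R powr ?d + real j ^ j * t powr (- real j) * (real j * \<alpha> / (real j * \<alpha> - ?d)) * R powr (?d - real j * \<alpha>)))"
    proof (rule euclidean_norm.nn_integral_two_scales_le)
      fix \<xi> :: 'a assume \<xi>: "R < norm \<xi>"
      define y where "y = t * norm \<xi> powr \<alpha>"
      have n: "norm \<xi> > 0" using \<xi> R by linarith
      have y: "y > 0" using n t by (simp add: y_def)
      have "exp (- y) \<le> real j ^ j / y ^ j"
        using power_le_exp[of y j] y by (simp add: exp_minus field_simps)
      also have "y ^ j = y powr (real j)" using y by (simp add: powr_realpow)
      also have "\<dots> = t powr (real j) * norm \<xi> powr (real j * \<alpha>)"
        using t n by (simp add: y_def powr_mult powr_powr mult.commute)
      finally show "stable_multiplier \<alpha> t \<xi> \<le> real j ^ j * t powr (- real j) * norm \<xi> powr (- (real j * \<alpha>))"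
        using n t by (simp add: y_def powr_minus divide_simps)
    qed (use t R j in auto)
    also have "R powr ?d = t powr (- (?d / \<alpha>))" by (simp add: R_def powr_powr)
    also have "real j ^ j * t powr (- real j) * (real j * \<alpha> / (real j * \<alpha> - ?d)) * R powr (?d - real j * \<alpha>)
      = K * (t powr (- real j) * R powr (?d - real j * \<alpha>))" by (simp add: K_def)
    also have "t powr (- real j) * R powr (?d - real j * \<alpha>) = t powr (- (?d / \<alpha>))"
    proof -
      have "- real j + - 1 / \<alpha> * (?d - real j * \<alpha>) = - (?d / \<alpha>)" using \<alpha> by (simp add: field_simps)
      then show ?thesis unfolding R_def powr_powr powr_add[symmetric] by simp
    qed
    finally show "(\<integral>\<^sup>+\<xi>. ennreal (stable_multiplier \<alpha> t (\<xi> :: 'a)) \<partial>lborel) \<le> ennreal (?v * (1 + K) * t powr (- (?d / \<alpha>)))"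
      by (simp add: algebra_simps)
  qed
qed

section \<open>Fourier integrals under translation\<close>

abbreviation fourier_integral :: "('a::euclidean_space \<Rightarrow> real) \<Rightarrow> 'a \<Rightarrow> complex" where
  "fourier_integral f x \<equiv> (LINT \<xi>|lborel. exp (\<i> * of_real (x \<bullet> \<xi>)) * of_real (f \<xi>))"

lemma abs_stable_kernel_le:
  "\<bar>stable_kernel \<alpha> t (x :: 'a::euclidean_space)\<bar> \<le> norm (fourier_integral (stable_multiplier \<alpha> t) x)"
proof -
  let ?c = "1 / (2 * pi) ^ DIM('a)"
  have "(LINT \<xi>|lebesgue. exp (\<i> * of_real (x \<bullet> \<xi>)) * of_real (stable_multiplier \<alpha> t \<xi>)) = fourier_integral (stable_multiplier \<alpha> t) x"
    by (rule integral_completion) measurable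
  then have "\<bar>stable_kernel \<alpha> t x\<bar> \<le> norm (of_real ?c * fourier_integral (stable_multiplier \<alpha> t) x)"
    unfolding stable_kernel_def inverse_fourier_def by (metis abs_Re_le_cmod)
  also have "\<dots> = ?c * norm (fourier_integral (stable_multiplier \<alpha> t) x)"
    by (subst norm_mult, subst norm_of_real) simp
  also have "\<dots> \<le> 1 * norm (fourier_integral (stable_multiplier \<alpha> t) x)"
  proof (rule mult_right_mono)
    have "1 \<le> (2 * pi) ^ DIM('a)" using pi_gt3 by (intro one_le_power) auto
    then show "?c \<le> 1" by (simp add: field_simps)
  qed simp
  finally show ?thesis by simp
qed

lemma norm_fourier_integral_le:
  assumes "f \<in> borel_measurable borel" "(\<integral>\<^sup>+\<xi>. ennreal \<bar>f \<xi>\<bar> \<partial>lborel) \<le> ennreal B" "0 \<le> B"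
  shows "norm (fourier_integral f x) \<le> B"
proof -
  have [measurable]: "f \<in> borel_measurable borel" by fact
  have n: "norm (exp (\<i> * of_real (x \<bullet> \<xi>)) * of_real (f \<xi>)) = \<bar>f \<xi>\<bar>" for \<xi>
    by (simp add: norm_mult)
  have "integrable lborel (\<lambda>\<xi>. exp (\<i> * of_real (x \<bullet> \<xi>)) * complex_of_real (f \<xi>))"
    using assms by (intro integrableI_bounded) (auto simp: n le_less_trans)
  then have "ennreal (norm (fourier_integral f x)) \<le> (\<integral>\<^sup>+\<xi>. ennreal \<bar>f \<xi>\<bar> \<partial>lborel)"
    using integral_norm_bound_ennreal[of lborel "\<lambda>\<xi>. exp (\<i> * of_real (x \<bullet> \<xi>)) * complex_of_real (f \<xi>)"]
    by (simp add: n)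
  also note assms(2)
  finally show ?thesis using assms(3) by simp
qed

lemma integrable_lborel_translation:
  fixes f :: "'a::euclidean_space \<Rightarrow> 'b::{banach, second_countable_topology}"
  assumes f: "integrable lborel f"
  shows "integrable lborel (\<lambda>x. f (x + h))" "(LINT x|lborel. f (x + h)) = (LINT x|lborel. f x)"
proof -
  have [measurable]: "f \<in> borel_measurable borel" using f by auto
  have "integrable (distr lborel borel ((+) h)) f" using f by (simp add: lborel_distr_plus)
  then show "integrable lborel (\<lambda>x. f (x + h))" by (subst (asm) integrable_distr_eq) (auto simp: add.commute)
  have "(LINT x|lborel. f x) = (LINT x|distr lborel borel ((+) h). f x)" by (simp add: lborel_distr_plus)
  also have "\<dots> = (LINT x|lborel. f (x + h))" by (subst integral_distr) (auto simp: add.commute)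
  finally show "(LINT x|lborel. f (x + h)) = (LINT x|lborel. f x)" ..
qed

text \<open>A discrete integration by parts: translation by \<open>h\<close> multiplies the
  transform by the phase of angle \<open>- (x \<bullet> h) = - pi\<close>, which is -1, and the
  difference subtracts the transform once more.\<close>

lemma fourier_integral_fdiff:
  fixes f :: "'a::euclidean_space \<Rightarrow> real"
  assumes f: "integrable lborel f" and h: "x \<bullet> h = pi"
  shows "integrable lborel (fdiff h f)" "fourier_integral (fdiff h f) x = - 2 * fourier_integral f x"
proof -
  have [measurable]: "f \<in> borel_measurable borel" using f by auto
  let ?e = "\<lambda>\<xi>. exp (\<i> * of_real (x \<bullet> \<xi>)) * complex_of_real (f \<xi>)"
  have e: "integrable lborel ?e"
    by (rule Bochner_Integration.integrable_bound[OF f]) (auto simp: norm_mult)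
  have sh: "exp (\<i> * of_real (x \<bullet> \<xi>)) * complex_of_real (f (\<xi> + h)) = - ?e (\<xi> + h)" for \<xi>
    by (simp add: inner_add_right h distrib_left exp_add)
  show "integrable lborel (fdiff h f)"
    using f integrable_lborel_translation(1)[OF f, of h] by (simp add: fdiff_def[abs_def])
  have "fourier_integral (fdiff h f) x = (LINT \<xi>|lborel. - ?e (\<xi> + h) - ?e \<xi>)"
    unfolding fdiff_def sh[symmetric] by (simp add: algebra_simps)
  also have "\<dots> = - (LINT \<xi>|lborel. ?e (\<xi> + h)) - (LINT \<xi>|lborel. ?e \<xi>)"
    using e integrable_lborel_translation(1)[OF e, of h] by simp
  also have "\<dots> = - 2 * fourier_integral f x"
    by (simp only: integrable_lborel_translation(2)[OF e]) simp
  finally show "fourier_integral (fdiff h f) x = - 2 * fourier_integral f x" .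
qed

lemma fourier_integral_fdiff_funpow:
  fixes f :: "'a::euclidean_space \<Rightarrow> real"
  assumes "integrable lborel f" and "x \<bullet> h = pi"
  shows "integrable lborel ((fdiff h ^^ n) f) \<and> fourier_integral ((fdiff h ^^ n) f) x = (- 2) ^ n * fourier_integral f x"
  by (induction n) (use assms fourier_integral_fdiff[OF _ assms(2)] in auto)

text \<open>The direction \<open>h = pi * x / norm x ^ 2\<close> makes \<open>n\<close> differences multiply the transform by
  \<open>(- 2) ^ n\<close>. Near the origin only \<open>1 - exp (- t * norm \<xi> powr \<alpha>) \<le> t * norm \<xi> powr \<alpha>\<close> is used; away from it,
  \<open>n = d + 2\<close> derivatives make the integral converge.\<close>

lemma stable_kernel_decay:
  assumes \<alpha>: "1 < \<alpha>" "\<alpha> < 2"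
  shows "\<exists>C>0. \<forall>t>0. \<forall>x :: 'a::euclidean_space. x \<noteq> 0 \<longrightarrow>
    \<bar>stable_kernel \<alpha> t x\<bar> \<le> C * t * norm x powr (- (real DIM('a) + \<alpha>))"
proof -
  let ?d = "real DIM('a)"
  let ?v = "unit_ball_vol ?d"
  define n where "n = DIM('a) + 2"
  have n: "1 \<le> n" "real n = ?d + 2" "real n \<ge> \<alpha>" using \<alpha> by (auto simp: n_def)
  have v: "?v > 0" by (rule euclidean_norm.c_pos)
  obtain K where K: "K \<ge> 0" and far: "\<And>t \<xi> h :: 'a. 0 < t \<Longrightarrow> h \<noteq> 0 \<Longrightarrow> 2 * real n * norm h < norm \<xi> \<Longrightarrow>
    \<bar>(fdiff h ^^ n) (stable_multiplier \<alpha> t) \<xi>\<bar> \<le> K * t * norm h ^ n * norm \<xi> powr (\<alpha> - real n)"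
    using stable_multiplier_directional_derivatives[OF n(1), of \<alpha>, where 'a='a] n(3) \<alpha> by auto
  obtain C0 where C0: "C0 > 0" and tot: "\<And>t. 0 < t \<Longrightarrow> (\<integral>\<^sup>+\<xi>. ennreal (stable_multiplier \<alpha> t (\<xi> :: 'a)) \<partial>lborel)
    \<le> ennreal (C0 * t powr (- (?d / \<alpha>)))"
    using nn_integral_stable_multiplier_le[OF \<alpha>(1), where 'a='a] by auto
  \<comment> \<open>The decay order of the differenced multiplier;
    \<open>s = d + 2 - \<alpha>\<close> exceeds \<open>d\<close> because
    \<open>\<alpha> < 2\<close>.\<close>
  define s where "s = real n - \<alpha>"
  have s: "s > ?d" using n \<alpha> by (simp add: s_def)
  define C1 where "C1 = ?v * (2 ^ n * 2 powr \<alpha> + K / (2 * real n) ^ n * (s / (s - ?d)))"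
  have C1: "C1 > 0"
  proof -
    have "0 \<le> K / (2 * real n) ^ n * (s / (s - ?d))" using K s by (intro mult_nonneg_nonneg divide_nonneg_nonneg) auto
    then show ?thesis unfolding C1_def by (intro mult_pos_pos v add_pos_nonneg) auto
  qed
  show ?thesis
  proof (intro exI[of _ "C1 * (2 * real n * pi) powr (?d + \<alpha>)"] conjI allI impI)
    show "0 < C1 * (2 * real n * pi) powr (?d + \<alpha>)" using C1 n by simp
    fix t :: real and x :: 'a
    assume t: "0 < t" and x: "x \<noteq> 0"
    define h where "h = (pi / (norm x)\<^sup>2) *\<^sub>R x"
    have h: "x \<bullet> h = pi" "norm h = pi / norm x" "h \<noteq> 0"
      using x by (auto simp: h_def power2_norm_eq_inner[symmetric] power2_eq_square)
    \<comment> \<open>The threshold beyond which the derivative bound applies. It is a multiple of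
      \<open>1 / norm x\<close>, so that the common size \<open>t * R powr (d + \<alpha>)\<close> of
      both parts is the claimed decay.\<close>
    define R where "R = 2 * real n * norm h"
    have R: "R > 0" using h(3) n by (simp add: R_def)
    define m where "m = (stable_multiplier \<alpha> t :: 'a \<Rightarrow> real)"
    define \<Delta> where "\<Delta> = (fdiff h ^^ n) m"
    have [measurable]: "m \<in> borel_measurable borel" unfolding m_def by measurable
    have \<Delta>_meas[measurable]: "\<Delta> \<in> borel_measurable borel" unfolding \<Delta>_def by measurable
    have m_int: "integrable lborel m"
      using tot[OF t] by (intro integrableI_bounded) (auto simp: m_def le_less_trans)
    have near: "\<bar>\<Delta> \<xi>\<bar> \<le> 2 ^ n * (t * (2 powr \<alpha> * R powr \<alpha>))" if "norm \<xi> \<le> R" for \<xi>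
    proof -
      \<comment> \<open>All sample points stay within radius \<open>2 * R\<close>, because
        \<open>n\<close> steps of length \<open>norm h\<close> amount to \<open>R / 2\<close>; this
        is the origin of the factor \<open>2 powr \<alpha>\<close>.\<close>
      have "\<bar>(fdiff h ^^ n) (\<lambda>x. m x + (- 1)) \<xi>\<bar> \<le> 2 ^ n * (t * (2 powr \<alpha> * R powr \<alpha>))"
      proof (rule fdiff_funpow_le_sup)
        fix k assume k: "k \<le> n"
        have "norm (\<xi> + real k *\<^sub>R h) \<le> norm \<xi> + real k * norm h" using norm_triangle_ineq[of \<xi> "real k *\<^sub>R h"] by simp
        also have "\<dots> \<le> R + real n * norm h" using that k by (intro add_mono mult_right_mono) auto
        also have "\<dots> \<le> 2 * R" by (simp add: R_def)
        finally have "norm (\<xi> + real k *\<^sub>R h) powr \<alpha> \<le> (2 * R) powr \<alpha>" using \<alpha> by (intro powr_mono2) auto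
        then have le: "t * norm (\<xi> + real k *\<^sub>R h) powr \<alpha> \<le> t * (2 powr \<alpha> * R powr \<alpha>)"
          using t R by (simp add: powr_mult)
        have "1 - t * norm (\<xi> + real k *\<^sub>R h) powr \<alpha> \<le> m (\<xi> + real k *\<^sub>R h)"
          using exp_ge_add_one_self[of "- t * norm (\<xi> + real k *\<^sub>R h) powr \<alpha>"] by (simp add: m_def)
        moreover have "m (\<xi> + real k *\<^sub>R h) \<le> 1" using t by (simp add: m_def)
        ultimately show "\<bar>m (\<xi> + real k *\<^sub>R h) + (- 1)\<bar> \<le> t * (2 powr \<alpha> * R powr \<alpha>)" using le by linarith
      qed
      then show ?thesis using n(1) by (subst (asm) fdiff_funpow_add_const) (auto simp: \<Delta>_def)
    qed
    have hn: "norm h ^ n = (1 / (2 * real n) ^ n) * R powr (real n)"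
    proof -
      have "R powr (real n) = R ^ n" using R by (rule powr_realpow)
      also have "\<dots> = (2 * real n) ^ n * norm h ^ n" unfolding R_def by (rule power_mult_distrib)
      finally show ?thesis using n(1) by simp
    qed
    have "(\<integral>\<^sup>+\<xi>. ennreal \<bar>\<Delta> \<xi>\<bar> \<partial>lborel)
      \<le> ennreal (?v * (2 ^ n * (t * (2 powr \<alpha> * R powr \<alpha>)) * R powr ?d + K * t * norm h ^ n * (s / (s - ?d)) * R powr (?d - s)))"
    proof (rule euclidean_norm.nn_integral_two_scales_le)
      fix \<xi> :: 'a assume "R < norm \<xi>"
      then show "\<bar>\<Delta> \<xi>\<bar> \<le> K * t * norm h ^ n * norm \<xi> powr (- s)"
        using far[OF t h(3), of \<xi>] by (simp add: \<Delta>_def m_def R_def s_def)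
    qed (use near s R K t in auto)
    also have "2 ^ n * (t * (2 powr \<alpha> * R powr \<alpha>)) * R powr ?d = 2 ^ n * 2 powr \<alpha> * t * R powr (?d + \<alpha>)"
      by (simp add: powr_add mult_ac)
    also have "K * t * norm h ^ n * (s / (s - ?d)) * R powr (?d - s)
        = K / (2 * real n) ^ n * (s / (s - ?d)) * t * (R powr (real n) * R powr (?d - s))"
      unfolding hn by (simp add: mult_ac)
    also have "R powr (real n) * R powr (?d - s) = R powr (?d + \<alpha>)"
      by (simp add: powr_add[symmetric] s_def)
    also have "?v * (2 ^ n * 2 powr \<alpha> * t * R powr (?d + \<alpha>) + K / (2 * real n) ^ n * (s / (s - ?d)) * t * R powr (?d + \<alpha>))
       = C1 * t * R powr (?d + \<alpha>)" by (simp add: C1_def algebra_simps)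
    finally have "norm (fourier_integral \<Delta> x) \<le> C1 * t * R powr (?d + \<alpha>)"
      using C1 t by (intro norm_fourier_integral_le) auto
    also have "fourier_integral \<Delta> x = (- 2) ^ n * fourier_integral m x"
      unfolding \<Delta>_def using fourier_integral_fdiff_funpow[OF m_int h(1)] by blast
    finally have "2 ^ n * norm (fourier_integral m x) \<le> C1 * t * R powr (?d + \<alpha>)"
      by (simp add: norm_mult norm_power)
    moreover have "1 * norm (fourier_integral m x) \<le> 2 ^ n * norm (fourier_integral m x)"
      by (intro mult_right_mono) auto
    ultimately have "\<bar>stable_kernel \<alpha> t x\<bar> \<le> C1 * t * R powr (?d + \<alpha>)"
      using abs_stable_kernel_le[of \<alpha> t x] unfolding m_def by linarith
    also have "R = 2 * real n * pi / norm x" by (simp add: R_def h(2))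
    also have "\<dots> powr (?d + \<alpha>) = (2 * real n * pi) powr (?d + \<alpha>) * norm x powr (- (?d + \<alpha>))"
      using powr_minus_divide[of "norm x" "?d + \<alpha>"] by (simp add: powr_divide)
    finally show "\<bar>stable_kernel \<alpha> t x\<bar> \<le> C1 * (2 * real n * pi) powr (?d + \<alpha>) * t * norm x powr (- (?d + \<alpha>))"
      by (simp add: mult_ac)
  qed
qed

lemma stable_kernel_le:
  assumes \<alpha>: "1 < \<alpha>" "\<alpha> < 2"
  shows "\<exists>C>0. \<forall>t>0. \<forall>x :: 'a::euclidean_space.
    \<bar>stable_kernel \<alpha> t x\<bar> \<le> C * t powr (- (real DIM('a) / \<alpha>)) \<and>
    (x \<noteq> 0 \<longrightarrow> \<bar>stable_kernel \<alpha> t x\<bar> \<le> C * t * norm x powr (- (real DIM('a) + \<alpha>)))"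
proof -
  let ?d = "real DIM('a)"
  obtain C0 where C0: "C0 > 0" and tot: "\<And>t. 0 < t \<Longrightarrow> (\<integral>\<^sup>+\<xi>. ennreal (stable_multiplier \<alpha> t (\<xi> :: 'a)) \<partial>lborel)
    \<le> ennreal (C0 * t powr (- (?d / \<alpha>)))"
    using nn_integral_stable_multiplier_le[OF \<alpha>(1), where 'a='a] by auto
  obtain C1 where C1: "C1 > 0" and dec: "\<And>t (x :: 'a). 0 < t \<Longrightarrow> x \<noteq> 0 \<Longrightarrow>
    \<bar>stable_kernel \<alpha> t x\<bar> \<le> C1 * t * norm x powr (- (?d + \<alpha>))"
    using stable_kernel_decay[OF \<alpha>, where 'a='a] by auto
  show ?thesis
  proof (intro exI[of _ "max C0 C1"] conjI allI impI)
    show "0 < max C0 C1" using C0 by simp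
    fix t :: real and x :: 'a assume t: "0 < t"
    have "\<bar>stable_kernel \<alpha> t x\<bar> \<le> norm (fourier_integral (stable_multiplier \<alpha> t) x)"
      by (rule abs_stable_kernel_le)
    also have "\<dots> \<le> C0 * t powr (- (?d / \<alpha>))"
      using tot[OF t] C0 by (intro norm_fourier_integral_le) auto
    also have "\<dots> \<le> max C0 C1 * t powr (- (?d / \<alpha>))" by (intro mult_right_mono) auto
    finally show "\<bar>stable_kernel \<alpha> t x\<bar> \<le> max C0 C1 * t powr (- (?d / \<alpha>))" .
    assume "x \<noteq> 0"
    then have "\<bar>stable_kernel \<alpha> t x\<bar> \<le> C1 * t * norm x powr (- (?d + \<alpha>))" by (rule dec[OF t])
    also have "\<dots> \<le> max C0 C1 * t * norm x powr (- (?d + \<alpha>))" using t by (intro mult_right_mono) auto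
    finally show "\<bar>stable_kernel \<alpha> t x\<bar> \<le> max C0 C1 * t * norm x powr (- (?d + \<alpha>))" .
  qed
qed

text \<open>The two pointwise bounds cross at \<open>norm x = t powr (1 / \<alpha>)\<close>, and on
  either side of this radius the integral is a constant independent of \<open>t\<close>.\<close>

lemma nn_integral_stable_kernel_le:
  assumes \<alpha>: "1 < \<alpha>" "\<alpha> < 2"
  shows "\<exists>C>0. \<forall>t>0. (\<integral>\<^sup>+x. ennreal \<bar>stable_kernel \<alpha> t (x :: 'a::euclidean_space)\<bar> \<partial>lborel) \<le> ennreal C"
proof -
  let ?d = "real DIM('a)"
  let ?v = "unit_ball_vol ?d"
  have v: "?v > 0" by (rule euclidean_norm.c_pos)
  obtain C where C: "C > 0" and le: "\<And>t (x :: 'a). 0 < t \<Longrightarrow> \<bar>stable_kernel \<alpha> t x\<bar> \<le> C * t powr (- (?d / \<alpha>))"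
    "\<And>t (x :: 'a). 0 < t \<Longrightarrow> x \<noteq> 0 \<Longrightarrow> \<bar>stable_kernel \<alpha> t x\<bar> \<le> C * t * norm x powr (- (?d + \<alpha>))"
    using stable_kernel_le[OF \<alpha>, where 'a='a] by auto
  define K where "K = (?d + \<alpha>) / \<alpha>"
  have K: "K \<ge> 0" using \<alpha> by (simp add: K_def)
  show ?thesis
  proof (intro exI[of _ "?v * (C * (1 + K))"] conjI allI impI)
    show "0 < ?v * (C * (1 + K))" using C K by (intro mult_pos_pos v) auto
    fix t :: real assume t: "0 < t"
    define R where "R = t powr (1 / \<alpha>)"
    have R: "R > 0" using t by (simp add: R_def)
    have "(\<integral>\<^sup>+x. ennreal \<bar>stable_kernel \<alpha> t (x :: 'a)\<bar> \<partial>lborel)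
      \<le> ennreal (?v * (C * t powr (- (?d / \<alpha>)) * R powr ?d + C * t * ((?d + \<alpha>) / (?d + \<alpha> - ?d)) * R powr (?d - (?d + \<alpha>))))"
    proof (rule euclidean_norm.nn_integral_two_scales_le)
      fix x :: 'a assume "R < norm x"
      then show "\<bar>stable_kernel \<alpha> t x\<bar> \<le> C * t * norm x powr (- (?d + \<alpha>))"
        using R by (intro le(2)[OF t]) auto
    qed (use le(1)[OF t] C t R \<alpha> in auto)
    also have "(?d + \<alpha>) / (?d + \<alpha> - ?d) = K" by (simp add: K_def)
    also have "R powr ?d = t powr (?d / \<alpha>)" by (simp add: R_def powr_powr)
    also have "R powr (?d - (?d + \<alpha>)) = 1 / t" using \<alpha> t by (simp add: R_def powr_powr powr_minus_divide)
    also have "C * t powr (- (?d / \<alpha>)) * t powr (?d / \<alpha>) + C * t * K * (1 / t) = C * (1 + K)"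
      using t by (simp add: powr_minus_divide algebra_simps)
    finally show "(\<integral>\<^sup>+x. ennreal \<bar>stable_kernel \<alpha> t (x :: 'a)\<bar> \<partial>lborel) \<le> ennreal (?v * (C * (1 + K)))" .
  qed
qed

lemma stable_kernel_measurable[measurable]:
  "(\<lambda>z. stable_kernel \<alpha> (fst z) (snd z)) \<in> borel_measurable (borel :: (real \<times> 'a::euclidean_space) measure)"
proof -
  have "stable_kernel \<alpha> t x = Re (complex_of_real (1 / (2 * pi) ^ DIM('a)) * fourier_integral (stable_multiplier \<alpha> t) x)"
    for t and x :: 'a
    unfolding stable_kernel_def inverse_fourier_def by (subst integral_completion) auto
  then show ?thesis
    unfolding borel_prod[symmetric] by simp
qed

subsection \<open>The parabolic kernel\<close>

text \<open>On the unit interval \<open>r \<le> r powr e\<close>, applied to \<open>x\<close> and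
  \<open>y\<close> divided by their sum. Used with exponent \<open>1 / \<alpha>\<close> for the
  parabolic triangle inequality and with \<open>1 / p\<close> to separate the two terms of the final
  bound.\<close>

lemma powr_add_le:
  fixes x y e :: real
  assumes "0 \<le> x" "0 \<le> y" "0 < e" "e \<le> 1"
  shows "(x + y) powr e \<le> x powr e + y powr e"
proof (cases "x + y = 0")
  case False
  define s where "s = x + y"
  have s: "s > 0" using False assms by (simp add: s_def)
  have le: "z / s \<le> (z / s) powr e" if "0 \<le> z" "z \<le> s" for z
  proof (cases "z = 0")
    case False
    then have "(z / s) powr 1 \<le> (z / s) powr e" using that s assms by (intro powr_mono') auto
    then show ?thesis using that s by simp
  qed auto
  have "1 = x / s + y / s" using s by (simp add: s_def add_divide_distrib[symmetric])
  also have "\<dots> \<le> (x / s) powr e + (y / s) powr e"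
    using assms by (intro add_mono le) (auto simp: s_def)
  also have "\<dots> = (x powr e + y powr e) / s powr e"
    using assms s by (simp add: powr_divide add_divide_distrib)
  finally show ?thesis using s by (simp add: s_def field_simps)
qed (use assms in auto)

text \<open>The root \<open>1 / \<alpha>\<close>, not the power \<open>\<alpha>\<close>, goes on the
  time variable: this makes the function subadditive. Its balls are cylinders symmetric in time,
  twice as long as \<open>par_cylinder\<close>.\<close>

definition par_norm :: "real \<Rightarrow> real \<times> 'a::euclidean_space \<Rightarrow> real" where
  "par_norm \<alpha> z = max (\<bar>fst z\<bar> powr (1 / \<alpha>)) (norm (snd z))"

lemma par_norm_le_iff:
  assumes "0 < \<alpha>" "0 < \<rho>"
  shows "par_norm \<alpha> z \<le> \<rho> \<longleftrightarrow> \<bar>fst z\<bar> \<le> \<rho> powr \<alpha> \<and> norm (snd z) \<le> \<rho>"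
proof -
  have "\<bar>fst z\<bar> powr (1 / \<alpha>) \<le> \<rho> \<longleftrightarrow> \<bar>fst z\<bar> \<le> \<rho> powr \<alpha>"
  proof
    assume "\<bar>fst z\<bar> powr (1 / \<alpha>) \<le> \<rho>"
    then have "(\<bar>fst z\<bar> powr (1 / \<alpha>)) powr \<alpha> \<le> \<rho> powr \<alpha>" using assms by (intro powr_mono2) auto
    then show "\<bar>fst z\<bar> \<le> \<rho> powr \<alpha>" using assms by (simp add: powr_powr)
  next
    assume "\<bar>fst z\<bar> \<le> \<rho> powr \<alpha>"
    then have "\<bar>fst z\<bar> powr (1 / \<alpha>) \<le> (\<rho> powr \<alpha>) powr (1 / \<alpha>)" using assms by (intro powr_mono2) auto
    then show "\<bar>fst z\<bar> powr (1 / \<alpha>) \<le> \<rho>" using assms by (simp add: powr_powr)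
  qed
  then show ?thesis by (simp add: par_norm_def)
qed

text \<open>\<open>l = 2\<close> is the symmetric ball of \<open>par_norm\<close>, and
  \<open>l = 1\<close> the one-sided cylinder of the Morrey norm.\<close>

lemma emeasure_time_interval_cball:
  assumes "0 < \<rho>" "0 \<le> l"
  shows "emeasure lborel ({a..a + l * \<rho> powr \<alpha>} \<times> cball (x :: 'a::euclidean_space) \<rho>)
    = ennreal (l * unit_ball_vol (real DIM('a)) * \<rho> powr (real DIM('a) + \<alpha>))"
proof -
  have "emeasure lborel ({a..a + l * \<rho> powr \<alpha>} \<times> cball x \<rho>)
    = emeasure lborel {a..a + l * \<rho> powr \<alpha>} * emeasure lborel (cball x \<rho>)"
    unfolding lborel_prod[symmetric] by (rule lborel.emeasure_pair_measure_Times) auto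
  also have "\<dots> = ennreal (l * \<rho> powr \<alpha>) * ennreal (unit_ball_vol (real DIM('a)) * \<rho> powr (real DIM('a)))"
    using assms by (simp add: emeasure_cball powr_realpow)
  also have "\<dots> = ennreal (l * \<rho> powr \<alpha> * (unit_ball_vol (real DIM('a)) * \<rho> powr (real DIM('a))))"
    using assms by (intro ennreal_mult'[symmetric]) auto
  finally show ?thesis by (simp add: powr_add mult_ac)
qed

lemma homogeneous_norm_par_norm:
  assumes \<alpha>: "1 < \<alpha>"
  shows "homogeneous_norm (par_norm \<alpha> :: real \<times> 'a::euclidean_space \<Rightarrow> real)
    (2 * unit_ball_vol (real DIM('a))) (real DIM('a) + \<alpha>)"
proof
  show "par_norm \<alpha> \<in> borel_measurable (borel :: (real \<times> 'a) measure)"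
    unfolding par_norm_def[abs_def] borel_prod[symmetric] by measurable
  show "par_norm \<alpha> (- z) = par_norm \<alpha> z" for z :: "real \<times> 'a" by (simp add: par_norm_def)
  show "par_norm \<alpha> (z + w) \<le> par_norm \<alpha> z + par_norm \<alpha> w" for z w :: "real \<times> 'a"
  proof -
    have "\<bar>fst z + fst w\<bar> powr (1 / \<alpha>) \<le> (\<bar>fst z\<bar> + \<bar>fst w\<bar>) powr (1 / \<alpha>)"
      using \<alpha> by (intro powr_mono2) auto
    also have "\<dots> \<le> \<bar>fst z\<bar> powr (1 / \<alpha>) + \<bar>fst w\<bar> powr (1 / \<alpha>)"
      using \<alpha> by (intro powr_add_le) auto
    finally show ?thesis using norm_triangle_ineq[of "snd z" "snd w"] by (auto simp: par_norm_def)
  qed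
  show "0 < 2 * unit_ball_vol (real DIM('a))" using euclidean_norm.c_pos by simp
  show "0 < real DIM('a) + \<alpha>" using \<alpha> by (simp add: add_nonneg_pos)
  fix \<rho> :: real assume \<rho>: "0 < \<rho>"
  have "{z :: real \<times> 'a. par_norm \<alpha> z \<le> \<rho>} = {- (\<rho> powr \<alpha>)..- (\<rho> powr \<alpha>) + 2 * \<rho> powr \<alpha>} \<times> cball 0 \<rho>"
    using \<rho> \<alpha> by (auto simp: par_norm_le_iff)
  then show "emeasure lborel {z :: real \<times> 'a. par_norm \<alpha> z \<le> \<rho>}
    = ennreal (2 * unit_ball_vol (real DIM('a)) * \<rho> powr (real DIM('a) + \<alpha>))"
    using \<rho> by (simp only: emeasure_time_interval_cball)
qed

section \<open>The convolution kernel of the fractional resolvent\<close>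

definition res_kernel :: "real \<Rightarrow> real \<Rightarrow> real \<Rightarrow> real \<Rightarrow> real \<times> 'a::euclidean_space \<Rightarrow> real" where
  "res_kernel \<alpha> \<sigma> lam \<gamma> u = exp (- lam * (\<sigma> * fst u)) * par_kernel \<alpha> \<gamma> (\<sigma> * fst u) (snd u)"

lemma resolvent_integrand_eq: "resolvent_integrand \<alpha> \<sigma> lam \<gamma> f z w = res_kernel \<alpha> \<sigma> lam \<gamma> (z - w) * f w"
  by (cases z, cases w) (simp add: resolvent_integrand_def res_kernel_def)

lemma res_kernel_measurable[measurable]:
  "res_kernel \<alpha> \<sigma> lam \<gamma> \<in> borel_measurable (borel :: (real \<times> 'a::euclidean_space) measure)"
proof -
  have [measurable]: "(\<lambda>u :: real \<times> 'a. (\<sigma> * fst u, snd u)) \<in> borel \<rightarrow>\<^sub>M borel"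
    unfolding borel_prod[symmetric] by measurable
  have [measurable]: "(\<lambda>u :: real \<times> 'a. stable_kernel \<alpha> (\<sigma> * fst u) (snd u)) \<in> borel_measurable borel"
    using measurable_compose[OF _ stable_kernel_measurable, of "\<lambda>u :: real \<times> 'a. (\<sigma> * fst u, snd u)" borel] by simp
  have [measurable]: "(fst :: real \<times> 'a \<Rightarrow> real) \<in> borel_measurable borel"
    unfolding borel_prod[symmetric] by measurable
  show ?thesis
    unfolding res_kernel_def[abs_def] par_kernel_def by measurable
qed

lemma abs_res_kernel_le:
  assumes "0 < lam" "0 < \<gamma>"
  shows "\<bar>res_kernel \<alpha> \<sigma> lam \<gamma> u\<bar> \<le> (if 0 < \<sigma> * fst u then
    1 / Gamma (\<gamma> / 2) * (exp (- lam * (\<sigma> * fst u)) * (\<sigma> * fst u) powr (\<gamma> / 2 - 1)) * \<bar>stable_kernel \<alpha> (\<sigma> * fst u) (snd u)\<bar> else 0)"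
  using assms Gamma_real_pos[of "\<gamma> / 2"] by (auto simp: res_kernel_def par_kernel_def abs_mult)

text \<open>Uniformity in \<open>lam\<close> comes from bounding the exponential by 1, uniformity in
  \<open>\<sigma>\<close> from the evenness of \<open>par_norm\<close> in time. The two regimes of
  the stable kernel match the two arguments of the maximum in \<open>par_norm\<close>; where
  \<open>norm x\<close> dominates, the positive power \<open>t powr (\<gamma> / 2)\<close> is raised
  to one of \<open>norm x\<close>.\<close>

lemma res_kernel_le_par_norm:
  assumes \<alpha>: "1 < \<alpha>" "\<alpha> < 2" and \<gamma>: "0 < \<gamma>"
  shows "\<exists>C>0. \<forall>lam>0. \<forall>\<sigma>\<in>{1, -1}. \<forall>u :: real \<times> 'a::euclidean_space.
    \<bar>res_kernel \<alpha> \<sigma> lam \<gamma> u\<bar> \<le> C * par_norm \<alpha> u powr (\<alpha> * (\<gamma> / 2) - (real DIM('a) + \<alpha>))"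
proof -
  let ?d = "real DIM('a)"
  obtain C where C: "C > 0" and le: "\<And>t (x :: 'a). 0 < t \<Longrightarrow> \<bar>stable_kernel \<alpha> t x\<bar> \<le> C * t powr (- (?d / \<alpha>))"
    "\<And>t (x :: 'a). 0 < t \<Longrightarrow> x \<noteq> 0 \<Longrightarrow> \<bar>stable_kernel \<alpha> t x\<bar> \<le> C * t * norm x powr (- (?d + \<alpha>))"
    using stable_kernel_le[OF \<alpha>, where 'a='a] by auto
  define G where "G = 1 / Gamma (\<gamma> / 2)"
  have G: "G > 0" using Gamma_real_pos[of "\<gamma> / 2"] \<gamma> by (simp add: G_def)
  show ?thesis
  proof (intro exI[of _ "G * C"] conjI allI impI ballI)
    show "G * C > 0" using G C by simp
    fix lam \<sigma> :: real and u :: "real \<times> 'a"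
    assume lam: "0 < lam" and \<sigma>: "\<sigma> \<in> {1, -1}"
    let ?E = "\<alpha> * (\<gamma> / 2) - (?d + \<alpha>)"
    define t where "t = \<sigma> * fst u"
    define x where "x = snd u"
    show "\<bar>res_kernel \<alpha> \<sigma> lam \<gamma> u\<bar> \<le> G * C * par_norm \<alpha> u powr ?E"
    proof (cases "0 < t")
      case False
      then have "\<bar>res_kernel \<alpha> \<sigma> lam \<gamma> u\<bar> \<le> 0"
        using abs_res_kernel_le[OF lam \<gamma>, of \<alpha> \<sigma> u] by (simp add: t_def)
      also have "0 \<le> G * C * par_norm \<alpha> u powr ?E" using G C by simp
      finally show ?thesis .
    next
      case True
      have tu: "\<bar>fst u\<bar> = t" using True \<sigma> by (auto simp: t_def)
      have key: "t powr (\<gamma> / 2 - 1) * \<bar>stable_kernel \<alpha> t x\<bar> \<le> C * par_norm \<alpha> u powr ?E"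
      proof (cases "norm x \<le> t powr (1 / \<alpha>)")
        case N: True
        have "t powr (\<gamma> / 2 - 1) * \<bar>stable_kernel \<alpha> t x\<bar> \<le> t powr (\<gamma> / 2 - 1) * (C * t powr (- (?d / \<alpha>)))"
          using True by (intro mult_left_mono le) auto
        also have "\<dots> = C * t powr (\<gamma> / 2 - 1 - ?d / \<alpha>)" by (simp add: powr_add[symmetric])
        also have "\<gamma> / 2 - 1 - ?d / \<alpha> = 1 / \<alpha> * ?E" using \<alpha> by (simp add: field_simps)
        also have "t powr (1 / \<alpha> * ?E) = par_norm \<alpha> u powr ?E"
          using N by (simp only: powr_powr[symmetric]) (simp add: par_norm_def tu x_def)
        finally show ?thesis .
      next
        case N: False
        have "t powr (1 / \<alpha>) > 0" using True by simp
        then have x: "norm x > 0" using N by linarith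
        have "t powr (\<gamma> / 2 - 1) * \<bar>stable_kernel \<alpha> t x\<bar> \<le> t powr (\<gamma> / 2 - 1) * (C * t * norm x powr (- (?d + \<alpha>)))"
          using True x by (intro mult_left_mono le) auto
        also have "\<dots> = C * (t powr (\<gamma> / 2 - 1) * t) * norm x powr (- (?d + \<alpha>))" by simp
        also have "t powr (\<gamma> / 2 - 1) * t = (t powr (1 / \<alpha>)) powr (\<alpha> * (\<gamma> / 2))"
          using True \<alpha> by (simp add: powr_powr powr_diff)
        also have "C * (t powr (1 / \<alpha>)) powr (\<alpha> * (\<gamma> / 2)) * norm x powr (- (?d + \<alpha>)) \<le>
          C * norm x powr (\<alpha> * (\<gamma> / 2)) * norm x powr (- (?d + \<alpha>))"
          using N C \<alpha> \<gamma> by (intro mult_left_mono mult_right_mono powr_mono2) auto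
        also have "\<dots> = C * norm x powr ?E" by (simp add: mult.assoc powr_add[symmetric] algebra_simps)
        also have "norm x = par_norm \<alpha> u" using N by (simp add: par_norm_def tu x_def)
        finally show ?thesis .
      qed
      have "\<bar>res_kernel \<alpha> \<sigma> lam \<gamma> u\<bar> \<le> G * (exp (- lam * t) * t powr (\<gamma> / 2 - 1)) * \<bar>stable_kernel \<alpha> t x\<bar>"
        using abs_res_kernel_le[OF lam \<gamma>, of \<alpha> \<sigma> u] True by (simp add: t_def x_def G_def)
      also have "\<dots> = exp (- lam * t) * (G * (t powr (\<gamma> / 2 - 1) * \<bar>stable_kernel \<alpha> t x\<bar>))" by simp
      also have "\<dots> \<le> 1 * (G * (t powr (\<gamma> / 2 - 1) * \<bar>stable_kernel \<alpha> t x\<bar>))"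
        using G lam True by (intro mult_right_mono) auto
      also have "\<dots> \<le> 1 * (G * (C * par_norm \<alpha> u powr ?E))"
        using G by (intro mult_left_mono key) auto
      finally show ?thesis by (simp add: mult.assoc)
    qed
  qed
qed

text \<open>A Gamma integral up to constants, split at \<open>1 / lam\<close>: below, the
  exponential is at most 1; beyond, it is at most \<open>1 / (lam * t)\<close>, which makes the tail
  integrable because \<open>\<beta> < 1\<close>.\<close>

lemma nn_integral_exp_powr_le:
  fixes lam \<beta> :: real
  assumes lam: "0 < lam" and \<beta>: "0 < \<beta>" "\<beta> < 1"
  shows "(\<integral>\<^sup>+t\<in>{0<..}. ennreal (exp (- lam * t) * t powr (\<beta> - 1)) \<partial>lborel) \<le> ennreal ((1 / \<beta> + 1 / (1 - \<beta>)) * lam powr (- \<beta>))"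
proof -
  let ?R = "1 / lam"
  have "(\<integral>\<^sup>+t\<in>{0<..}. ennreal (exp (- lam * t) * t powr (\<beta> - 1)) \<partial>lborel)
    \<le> (\<integral>\<^sup>+t. ennreal (t powr (\<beta> - 1)) * indicator {0..?R} t + ennreal ?R * (ennreal (t powr (- (1 - \<beta>) - 1)) * indicator {?R..} t) \<partial>lborel)"
  proof (rule nn_integral_mono)
    fix t :: real
    show "ennreal (exp (- lam * t) * t powr (\<beta> - 1)) * indicator {0<..} t
      \<le> ennreal (t powr (\<beta> - 1)) * indicator {0..?R} t + ennreal ?R * (ennreal (t powr (- (1 - \<beta>) - 1)) * indicator {?R..} t)"
    proof (cases "0 < t")
      case t: True
      show ?thesis
      proof (cases "t \<le> ?R")
        case True
        have "exp (- lam * t) * t powr (\<beta> - 1) \<le> 1 * t powr (\<beta> - 1)"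
          using lam t by (intro mult_right_mono) auto
        then have "ennreal (exp (- lam * t) * t powr (\<beta> - 1)) \<le> ennreal (t powr (\<beta> - 1))" by (intro ennreal_leI) simp
        then show ?thesis using t True by (simp add: add_increasing2)
      next
        case False
        have "exp (- lam * t) \<le> 1 / (lam * t)"
        proof -
          have "lam * t \<le> exp (lam * t)" using exp_ge_add_one_self[of "lam * t"] by linarith
          then show ?thesis using lam t by (simp add: exp_minus field_simps)
        qed
        then have "exp (- lam * t) * t powr (\<beta> - 1) \<le> 1 / (lam * t) * t powr (\<beta> - 1)" by (rule mult_right_mono) simp
        also have "\<dots> = ?R * t powr (- (1 - \<beta>) - 1)"
          using t by (simp add: powr_diff field_simps power2_eq_square)
        finally have "ennreal (exp (- lam * t) * t powr (\<beta> - 1)) \<le> ennreal ?R * ennreal (t powr (- (1 - \<beta>) - 1))"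
          using lam by (subst ennreal_mult'[symmetric]) (auto intro!: ennreal_leI)
        then show ?thesis using t False by simp
      qed
    qed auto
  qed
  also have "\<dots> = ennreal (?R powr \<beta> / \<beta>) + ennreal ?R * ennreal (?R powr (- (1 - \<beta>)) / (1 - \<beta>))"
    using nn_integral_powr_from_0[of \<beta> ?R] nn_integral_powr_to_inf[of "1 - \<beta>" ?R] lam \<beta>
    by (subst nn_integral_add) (auto simp: nn_integral_cmult)
  also have "\<dots> = ennreal (?R powr \<beta> / \<beta> + ?R * (?R powr (- (1 - \<beta>)) / (1 - \<beta>)))"
    using lam \<beta> by (subst ennreal_plus, force, force, subst ennreal_mult'[of ?R]) auto
  also have "?R powr \<beta> / \<beta> + ?R * (?R powr (- (1 - \<beta>)) / (1 - \<beta>)) = (1 / \<beta> + 1 / (1 - \<beta>)) * lam powr (- \<beta>)"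
  proof -
    have 1: "?R powr \<beta> = lam powr (- \<beta>)" using lam by (simp add: powr_divide powr_minus_divide)
    have "?R * ?R powr (- (1 - \<beta>)) = ?R powr 1 * ?R powr (- (1 - \<beta>))" using lam by simp
    also have "\<dots> = ?R powr \<beta>" unfolding powr_add[symmetric] by simp
    finally have "?R * (?R powr (- (1 - \<beta>)) / (1 - \<beta>)) = ?R powr \<beta> / (1 - \<beta>)" by simp
    then show ?thesis unfolding 1 by (simp add: algebra_simps)
  qed
  finally show ?thesis .
qed

lemma nn_integral_res_kernel_le:
  assumes \<alpha>: "1 < \<alpha>" "\<alpha> < 2" and \<gamma>: "0 < \<gamma>" "\<gamma> < 2"
  shows "\<exists>C>0. \<forall>lam>0. \<forall>\<sigma>\<in>{1, -1}.
    (\<integral>\<^sup>+u. ennreal \<bar>res_kernel \<alpha> \<sigma> lam \<gamma> (u :: real \<times> 'a::euclidean_space)\<bar> \<partial>lborel) \<le> ennreal (C * lam powr (- (\<gamma> / 2)))"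
proof -
  obtain C where C: "C > 0" and le: "\<And>t. 0 < t \<Longrightarrow> (\<integral>\<^sup>+x. ennreal \<bar>stable_kernel \<alpha> t (x :: 'a)\<bar> \<partial>lborel) \<le> ennreal C"
    using nn_integral_stable_kernel_le[OF \<alpha>, where 'a='a] by auto
  define G where "G = 1 / Gamma (\<gamma> / 2)"
  have G: "G > 0" using Gamma_real_pos[of "\<gamma> / 2"] \<gamma> by (simp add: G_def)
  define L where "L = 1 / (\<gamma> / 2) + 1 / (1 - \<gamma> / 2)"
  have L: "L > 0" using \<gamma> by (auto simp: L_def intro!: add_pos_pos)
  show ?thesis
  proof (intro exI[of _ "G * C * L"] conjI allI impI ballI)
    show "0 < G * C * L" using G C L by simp
    fix lam \<sigma> :: real assume lam: "0 < lam" and \<sigma>: "\<sigma> \<in> {1, -1}"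
    define H where "H t = ennreal (exp (- lam * t) * t powr (\<gamma> / 2 - 1)) * indicator {0<..} t" for t :: real
    have [measurable]: "H \<in> borel_measurable borel" unfolding H_def by measurable
    have sk[measurable]: "(\<lambda>x::'a. stable_kernel \<alpha> t x) \<in> borel_measurable borel" for t
    proof -
      have "(\<lambda>x::'a. (t, x)) \<in> borel \<rightarrow>\<^sub>M borel" unfolding borel_prod[symmetric] by measurable
      from measurable_compose[OF this stable_kernel_measurable] show ?thesis by simp
    qed
    have "(\<integral>\<^sup>+u. ennreal \<bar>res_kernel \<alpha> \<sigma> lam \<gamma> (u :: real \<times> 'a)\<bar> \<partial>lborel)
       = (\<integral>\<^sup>+t. (\<integral>\<^sup>+x. ennreal \<bar>res_kernel \<alpha> \<sigma> lam \<gamma> (t, x :: 'a)\<bar> \<partial>lborel) \<partial>lborel)"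
      unfolding lborel_prod[symmetric] by (rule lborel.nn_integral_fst[symmetric]) (simp add: lborel_prod)
    \<comment> \<open>The summand 0 gives the argument the affine form required for the substitution
      by \<open>\<sigma>\<close>, whose Jacobian is 1 for both signs.\<close>
    also have "\<dots> \<le> (\<integral>\<^sup>+t. ennreal (G * C) * H (0 + \<sigma> * t) \<partial>lborel)"
    proof (rule nn_integral_mono)
      fix t :: real
      show "(\<integral>\<^sup>+x. ennreal \<bar>res_kernel \<alpha> \<sigma> lam \<gamma> (t, x :: 'a)\<bar> \<partial>lborel) \<le> ennreal (G * C) * H (0 + \<sigma> * t)"
      proof (cases "0 < \<sigma> * t")
        case False
        have "res_kernel \<alpha> \<sigma> lam \<gamma> (t, x) = 0" for x :: 'a
          using False by (simp add: res_kernel_def par_kernel_def)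
        then show ?thesis by simp
      next
        case True
        define e where "e = exp (- lam * (\<sigma> * t)) * (\<sigma> * t) powr (\<gamma> / 2 - 1)"
        have e: "e \<ge> 0" by (simp add: e_def)
        have "(\<integral>\<^sup>+x. ennreal \<bar>res_kernel \<alpha> \<sigma> lam \<gamma> (t, x :: 'a)\<bar> \<partial>lborel)
          \<le> (\<integral>\<^sup>+x. ennreal (G * e) * ennreal \<bar>stable_kernel \<alpha> (\<sigma> * t) (x :: 'a)\<bar> \<partial>lborel)"
        proof (rule nn_integral_mono)
          fix x :: 'a
          have "\<bar>res_kernel \<alpha> \<sigma> lam \<gamma> (t, x)\<bar> \<le> G * e * \<bar>stable_kernel \<alpha> (\<sigma> * t) x\<bar>"
            using abs_res_kernel_le[OF lam \<gamma>(1), of \<alpha> \<sigma> "(t, x)"] True by (simp add: G_def e_def)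
          then show "ennreal \<bar>res_kernel \<alpha> \<sigma> lam \<gamma> (t, x)\<bar> \<le> ennreal (G * e) * ennreal \<bar>stable_kernel \<alpha> (\<sigma> * t) x\<bar>"
            using G e by (subst ennreal_mult'[symmetric]) (auto intro!: ennreal_leI)
        qed
        also have "\<dots> = ennreal (G * e) * (\<integral>\<^sup>+x. ennreal \<bar>stable_kernel \<alpha> (\<sigma> * t) (x :: 'a)\<bar> \<partial>lborel)"
          by (rule nn_integral_cmult) measurable
        also have "\<dots> \<le> ennreal (G * e) * ennreal C" by (intro mult_left_mono le True) simp
        also have "\<dots> = ennreal (G * C) * ennreal e"
          using G C e by (simp add: ennreal_mult'[symmetric] mult_ac)
        finally show ?thesis using True by (simp add: H_def e_def)
      qed
    qed
    also have "\<dots> = ennreal (G * C) * (\<integral>\<^sup>+t. H (0 + \<sigma> * t) \<partial>lborel)"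
      by (rule nn_integral_cmult) measurable
    also have "(\<integral>\<^sup>+t. H (0 + \<sigma> * t) \<partial>lborel) = (\<integral>\<^sup>+t. H t \<partial>lborel)"
      using \<sigma> nn_integral_real_affine[of H \<sigma> 0] by auto
    also have "ennreal (G * C) * (\<integral>\<^sup>+t. H t \<partial>lborel) \<le> ennreal (G * C) * ennreal (L * lam powr (- (\<gamma> / 2)))"
      unfolding H_def L_def using lam \<gamma> by (intro mult_left_mono nn_integral_exp_powr_le) auto
    also have "\<dots> = ennreal (G * C * L * lam powr (- (\<gamma> / 2)))"
      using G C by (subst ennreal_mult'[symmetric]) (auto simp: mult.assoc)
    finally show "(\<integral>\<^sup>+u. ennreal \<bar>res_kernel \<alpha> \<sigma> lam \<gamma> (u :: real \<times> 'a)\<bar> \<partial>lborel) \<le> ennreal (G * C * L * lam powr (- (\<gamma> / 2)))" .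
  qed
qed

section \<open>From Morrey norms to averages over parabolic balls\<close>

lemma par_cylinder_eq: "par_cylinder \<alpha> \<rho> (t, x) = {t..t + 1 * \<rho> powr \<alpha>} \<times> cball x \<rho>"
  by (auto simp: par_cylinder_def dist_norm norm_minus_commute)

text \<open>The integral inside \<open>morrey_norm\<close> is a Bochner integral, which would be 0
  for a non-integrable function. Membership in \<open>Lp_loc\<close> and compactness of the cylinder
  exclude this, so that the bound passes to the nonnegative integral.\<close>

lemma nn_integral_par_cylinder_le:
  fixes v :: "real \<times> 'a::euclidean_space \<Rightarrow> real"
  assumes v: "v \<in> morrey_class \<alpha> q" and q: "0 < q" and M: "morrey_norm \<alpha> q v \<le> ennreal M" "0 \<le> M" and \<rho>: "0 < \<rho>"
  shows "(\<integral>\<^sup>+w. ennreal (\<bar>v w\<bar> powr q) * indicator (par_cylinder \<alpha> \<rho> z) w \<partial>lebesgue)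
    \<le> ennreal (unit_ball_vol (real DIM('a)) * \<rho> powr (real DIM('a) + \<alpha>) * (M powr q * \<rho> powr (- q)))"
proof -
  obtain t x where z: "z = (t, x)" by (cases z)
  let ?Q = "par_cylinder \<alpha> \<rho> z"
  define m where "m = unit_ball_vol (real DIM('a)) * \<rho> powr (real DIM('a) + \<alpha>)"
  have m: "m > 0" using euclidean_norm.c_pos[where 'a='a] \<rho> by (simp add: m_def)
  have cpt: "compact ?Q" unfolding z par_cylinder_eq by (intro compact_Times) auto
  have meas: "measure lebesgue ?Q = m"
  proof -
    have "emeasure lebesgue ?Q = emeasure lborel ?Q" using cpt by (simp add: borel_compact)
    also have "\<dots> = ennreal m" unfolding z par_cylinder_eq using \<rho> by (subst emeasure_time_interval_cball) (auto simp: m_def)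
    finally show ?thesis using m by (simp add: measure_def)
  qed
  define I where "I = (LINT w:?Q|lebesgue. \<bar>v w\<bar> powr q)"
  have int: "set_integrable lebesgue ?Q (\<lambda>w. \<bar>v w\<bar> powr q)"
    using v cpt by (auto simp: morrey_class_def Lp_loc_def)
  have I0: "I \<ge> 0" unfolding I_def set_lebesgue_integral_def by (intro Bochner_Integration.integral_nonneg) auto
  have "ennreal (\<rho> * (1 / measure lebesgue ?Q * I) powr (1 / q)) \<le> morrey_norm \<alpha> q v"
    unfolding morrey_norm_def I_def using \<rho> by (intro SUP_upper2[of \<rho>] SUP_upper2[of z]) auto
  then have "\<rho> * (I / m) powr (1 / q) \<le> M"
    using M order.trans by (fastforce simp: meas)
  then have "(I / m) powr (1 / q) \<le> M / \<rho>" using \<rho> by (simp add: field_simps)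
  then have "((I / m) powr (1 / q)) powr q \<le> (M / \<rho>) powr q" using q by (intro powr_mono2) auto
  then have "I / m \<le> (M / \<rho>) powr q" using q I0 m by (simp add: powr_powr)
  then have "I \<le> m * (M / \<rho>) powr q" using m by (simp add: field_simps)
  also have "(M / \<rho>) powr q = M powr q * \<rho> powr (- q)" using M \<rho> by (simp add: powr_divide powr_minus_divide)
  finally have "ennreal I \<le> ennreal (m * (M powr q * \<rho> powr (- q)))" by (rule ennreal_leI)
  moreover have "(\<integral>\<^sup>+w. ennreal (\<bar>v w\<bar> powr q) * indicator ?Q w \<partial>lebesgue) = ennreal I"
  proof -
    have "(\<integral>\<^sup>+w. ennreal (\<bar>v w\<bar> powr q) * indicator ?Q w \<partial>lebesgue) = (\<integral>\<^sup>+w. ennreal (indicator ?Q w *\<^sub>R \<bar>v w\<bar> powr q) \<partial>lebesgue)"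
      by (intro nn_integral_cong) (auto simp: indicator_def)
    also have "\<dots> = ennreal I"
      unfolding I_def set_lebesgue_integral_def
      using int unfolding set_integrable_def by (intro nn_integral_eq_integral) auto
    finally show ?thesis .
  qed
  ultimately show ?thesis by (simp add: m_def)
qed

text \<open>A parabolic ball is the union of a past and a future cylinder, each of half its volume.
  The Morrey bound holds on both, so it holds for the average with no loss in the constant.\<close>

lemma avg_le_of_morrey_norm:
  fixes v g :: "real \<times> 'a::euclidean_space \<Rightarrow> real"
  assumes \<alpha>: "1 < \<alpha>" and v: "v \<in> morrey_class \<alpha> q" and q: "0 < q"
    and M: "morrey_norm \<alpha> q v \<le> ennreal M" "0 \<le> M" and \<rho>: "0 < \<rho>"
    and g: "AE w in lebesgue. \<bar>v w\<bar> powr q = g w"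
  shows "homogeneous_norm.avg (par_norm \<alpha>) (2 * unit_ball_vol (real DIM('a))) (real DIM('a) + \<alpha>) \<rho> (\<lambda>w. ennreal (g w)) z
    \<le> ennreal (M powr q * \<rho> powr (- q))"
proof -
  interpret P: homogeneous_norm "par_norm \<alpha> :: real \<times> 'a \<Rightarrow> real" "2 * unit_ball_vol (real DIM('a))" "real DIM('a) + \<alpha>"
    by (rule homogeneous_norm_par_norm[OF \<alpha>])
  obtain t x where z: "z = (t, x)" by (cases z)
  let ?c = "2 * unit_ball_vol (real DIM('a))"
  define m where "m = unit_ball_vol (real DIM('a)) * \<rho> powr (real DIM('a) + \<alpha>)"
  have m: "m > 0" using euclidean_norm.c_pos[where 'a='a] \<rho> by (simp add: m_def)
  let ?X = "M powr q * \<rho> powr (- q)"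
  let ?Q1 = "par_cylinder \<alpha> \<rho> (t - \<rho> powr \<alpha>, x)" and ?Q2 = "par_cylinder \<alpha> \<rho> (t, x)"
  have vm: "(\<lambda>w. ennreal (\<bar>v w\<bar> powr q)) \<in> borel_measurable lebesgue"
    using v by (auto simp: morrey_class_def Lp_loc_def)
  have Q[measurable]: "par_cylinder \<alpha> \<rho> y \<in> sets lebesgue" for y :: "real \<times> 'a"
    by (cases y) (simp only: par_cylinder_eq, intro sets_completionI_sets, auto intro!: borel_closed closed_Times)
  have "P.avg \<rho> (\<lambda>w. ennreal (g w)) z = (\<integral>\<^sup>+w. P.ball_kernel \<rho> (z - w) * ennreal (g w) \<partial>lebesgue)"
    unfolding P.avg_def by (rule nn_integral_completion[symmetric])
  also have "\<dots> = (\<integral>\<^sup>+w. P.ball_kernel \<rho> (z - w) * ennreal (\<bar>v w\<bar> powr q) \<partial>lebesgue)"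
    using g by (intro nn_integral_cong_AE) (auto elim: eventually_mono)
  also have "\<dots> \<le> (\<integral>\<^sup>+w. ennreal (1 / (2 * m)) * (ennreal (\<bar>v w\<bar> powr q) * indicator ?Q1 w + ennreal (\<bar>v w\<bar> powr q) * indicator ?Q2 w) \<partial>lebesgue)"
  proof (rule nn_integral_mono)
    fix w :: "real \<times> 'a"
    show "P.ball_kernel \<rho> (z - w) * ennreal (\<bar>v w\<bar> powr q)
      \<le> ennreal (1 / (2 * m)) * (ennreal (\<bar>v w\<bar> powr q) * indicator ?Q1 w + ennreal (\<bar>v w\<bar> powr q) * indicator ?Q2 w)"
    proof (cases "par_norm \<alpha> (z - w) \<le> \<rho>")
      case True
      then have "w \<in> ?Q1 \<or> w \<in> ?Q2"
        using \<alpha> \<rho> by (auto simp: par_norm_le_iff z par_cylinder_def norm_minus_commute)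
      then show ?thesis using True
        by (auto simp: P.ball_kernel_def m_def mult.assoc indicator_def intro!: mult_left_mono add_increasing2)
    qed (auto simp: P.ball_kernel_def)
  qed
  also have "\<dots> = ennreal (1 / (2 * m)) * ((\<integral>\<^sup>+w. ennreal (\<bar>v w\<bar> powr q) * indicator ?Q1 w \<partial>lebesgue)
     + (\<integral>\<^sup>+w. ennreal (\<bar>v w\<bar> powr q) * indicator ?Q2 w \<partial>lebesgue))"
    using vm by (subst nn_integral_cmult, measurable, subst nn_integral_add) auto
  also have "\<dots> \<le> ennreal (1 / (2 * m)) * (ennreal (m * ?X) + ennreal (m * ?X))"
    unfolding m_def using v q M \<rho> by (intro mult_left_mono add_mono nn_integral_par_cylinder_le) auto
  also have "\<dots> = ennreal (1 / (2 * m)) * ennreal (2 * m * ?X)"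
    using m by (subst ennreal_plus[symmetric]) (auto simp: mult.assoc)
  also have "\<dots> = ennreal ?X"
    using m by (subst ennreal_mult'[symmetric]) auto
  finally show ?thesis .
qed

text \<open>A Lebesgue measurable \<open>f\<close> may be replaced by a Borel representative. Fubini
  on the product of the Borel measures then applies, and the resolvent turns out to be Borel
  measurable.\<close>

lemma frac_resolvent_lborel:
  fixes f f' :: "real \<times> 'a::euclidean_space \<Rightarrow> real"
  assumes f: "f \<in> borel_measurable lebesgue" and [measurable]: "f' \<in> borel_measurable borel"
    and ae: "AE w in lebesgue. f w = f' w"
  shows "frac_resolvent \<alpha> \<sigma> lam \<gamma> f z = (LINT w|lborel. res_kernel \<alpha> \<sigma> lam \<gamma> (z - w) * f' w)"
    and "integrable lebesgue (resolvent_integrand \<alpha> \<sigma> lam \<gamma> f z) \<longleftrightarrow> integrable lborel (\<lambda>w. res_kernel \<alpha> \<sigma> lam \<gamma> (z - w) * f' w)"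
proof -
  let ?g = "\<lambda>w. res_kernel \<alpha> \<sigma> lam \<gamma> (z - w) * f' w"
  have g: "?g \<in> borel_measurable lborel" by measurable
  have "(\<lambda>w. res_kernel \<alpha> \<sigma> lam \<gamma> (z - w)) \<in> borel_measurable lebesgue"
    by (rule measurable_completion) measurable
  then have m: "(\<lambda>w. res_kernel \<alpha> \<sigma> lam \<gamma> (z - w) * f w) \<in> borel_measurable lebesgue"
    using f by measurable
  have m': "?g \<in> borel_measurable lebesgue" by (rule measurable_completion[OF g])
  have e: "AE w in lebesgue. res_kernel \<alpha> \<sigma> lam \<gamma> (z - w) * f w = ?g w"
    using ae by eventually_elim simp
  have "frac_resolvent \<alpha> \<sigma> lam \<gamma> f z = (LINT w|lebesgue. res_kernel \<alpha> \<sigma> lam \<gamma> (z - w) * f w)"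
    unfolding frac_resolvent_def resolvent_integrand_eq ..
  also have "\<dots> = (LINT w|lebesgue. ?g w)" by (rule integral_cong_AE[OF m m' e])
  also have "\<dots> = (LINT w|lborel. ?g w)" by (rule integral_completion[OF g])
  finally show "frac_resolvent \<alpha> \<sigma> lam \<gamma> f z = (LINT w|lborel. ?g w)" .
  have "resolvent_integrand \<alpha> \<sigma> lam \<gamma> f z = (\<lambda>w. res_kernel \<alpha> \<sigma> lam \<gamma> (z - w) * f w)"
    by (rule ext) (rule resolvent_integrand_eq)
  then have "integrable lebesgue (resolvent_integrand \<alpha> \<sigma> lam \<gamma> f z) \<longleftrightarrow> integrable lebesgue ?g"
    using integrable_cong_AE[OF m m' e] by simp
  also have "\<dots> \<longleftrightarrow> integrable lborel ?g" by (rule integrable_completion[OF g])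
  finally show "integrable lebesgue (resolvent_integrand \<alpha> \<sigma> lam \<gamma> f z) \<longleftrightarrow> integrable lborel ?g" .
qed

text \<open>Integrability is not assumed: otherwise the Bochner integral is 0 and the bound is
  trivial. Thus the resolvent is dominated at every point.\<close>

lemma abs_integral_le_nn_integral:
  fixes f :: "'a \<Rightarrow> real"
  shows "ennreal \<bar>LINT x|M. f x\<bar> \<le> (\<integral>\<^sup>+x. ennreal \<bar>f x\<bar> \<partial>M)"
proof (cases "integrable M f")
  case True
  then show ?thesis using integral_norm_bound_ennreal[OF True] by simp
qed (simp add: not_integrable_integral_eq)

section \<open>Unweighted and weighted bounds for the resolvent with absolute values inside\<close>

abbreviation abs_resolvent ::
    "real \<Rightarrow> real \<Rightarrow> real \<Rightarrow> real \<Rightarrow> (real \<times> 'a::euclidean_space \<Rightarrow> real) \<Rightarrow> real \<times> 'a \<Rightarrow> ennreal" where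
  "abs_resolvent \<alpha> \<sigma> lam \<gamma> f z \<equiv> (\<integral>\<^sup>+w. ennreal \<bar>res_kernel \<alpha> \<sigma> lam \<gamma> (z - w)\<bar> * ennreal \<bar>f w\<bar> \<partial>lborel)"

text \<open>Schur's test with constant weights: the kernel has mass at most
  \<open>S = C * lam powr (- (\<gamma> / 2))\<close> in either variable, which gives
  \<open>S powr p\<close> on the level of p-th powers. Finiteness almost everywhere is a separate
  claim because it will show that the resolvent integral converges.\<close>

lemma resolvent_Lp_bound:
  fixes p \<alpha> \<gamma> :: real
  assumes p: "1 < p" and \<alpha>: "1 < \<alpha>" "\<alpha> < 2" and \<gamma>: "0 < \<gamma>" "\<gamma> < 2"
  shows "\<exists>C>0. \<forall>lam>0. \<forall>\<sigma>\<in>{1, -1}. \<forall>f :: real \<times> 'a::euclidean_space \<Rightarrow> real. f \<in> borel_measurable borel \<longrightarrow>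
    (Lp_mass p f < \<infinity> \<longrightarrow>
      (AE z in lborel. abs_resolvent \<alpha> \<sigma> lam \<gamma> f z < \<infinity>)) \<and>
    (\<forall>F. (AE z in lborel. ennreal \<bar>F z\<bar> \<le> abs_resolvent \<alpha> \<sigma> lam \<gamma> f z) \<longrightarrow>
      Lp_mass p F \<le> ennreal ((C * lam powr (- (\<gamma> / 2))) powr p) * Lp_mass p f)"
proof -
  obtain C where C: "C > 0" and bd: "\<And>lam \<sigma>. 0 < lam \<Longrightarrow> \<sigma> \<in> {1, -1} \<Longrightarrow>
    (\<integral>\<^sup>+u. ennreal \<bar>res_kernel \<alpha> \<sigma> lam \<gamma> (u :: real \<times> 'a)\<bar> \<partial>lborel) \<le> ennreal (C * lam powr (- (\<gamma> / 2)))"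
    using nn_integral_res_kernel_le[OF \<alpha> \<gamma>, where 'a='a] by auto
  show ?thesis
  proof (intro exI[of _ C] conjI allI impI ballI)
    fix lam \<sigma> :: real and f :: "real \<times> 'a \<Rightarrow> real"
    assume lam: "0 < lam" and \<sigma>: "\<sigma> \<in> {1, -1}" and [measurable]: "f \<in> borel_measurable borel"
    define S where "S = C * lam powr (- (\<gamma> / 2))"
    have S: "S > 0" using C lam by (simp add: S_def)
    let ?K = "\<lambda>z w :: real \<times> 'a. ennreal \<bar>res_kernel \<alpha> \<sigma> lam \<gamma> (z - w)\<bar>"
    have K1: "(\<integral>\<^sup>+w. ?K z w \<partial>lborel) \<le> ennreal S" for z
      using bd[OF lam \<sigma>] nn_integral_lborel_diff(1)[of "\<lambda>u :: real \<times> 'a. ennreal \<bar>res_kernel \<alpha> \<sigma> lam \<gamma> u\<bar>" z]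
      by (simp add: S_def)
    have K2: "(\<integral>\<^sup>+z. ?K z w \<partial>lborel) \<le> ennreal S" for w
      using bd[OF lam \<sigma>] nn_integral_lborel_diff(2)[of "\<lambda>u :: real \<times> 'a. ennreal \<bar>res_kernel \<alpha> \<sigma> lam \<gamma> u\<bar>" w]
      by (simp add: S_def)
    {
      assume fin: "Lp_mass p f < \<infinity>"
      have "(\<integral>\<^sup>+z. (\<integral>\<^sup>+w. ?K z w * ennreal (\<bar>f w\<bar> powr p) \<partial>lborel) \<partial>lborel) = (\<integral>\<^sup>+w. (\<integral>\<^sup>+z. ?K z w * ennreal (\<bar>f w\<bar> powr p) \<partial>lborel) \<partial>lborel)"
        by (rule lborel_pair.Fubini') measurable
      also have "\<dots> \<le> (\<integral>\<^sup>+w. ennreal S * ennreal (\<bar>f w\<bar> powr p) \<partial>lborel)"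
        using K2 by (intro nn_integral_mono) (auto simp: nn_integral_multc intro!: mult_right_mono)
      also have "\<dots> = ennreal S * Lp_mass p f"
        by (rule nn_integral_cmult) measurable
      also have "\<dots> < \<infinity>" using fin by (simp add: ennreal_mult_less_top)
      finally have "AE z in lborel. (\<integral>\<^sup>+w. ?K z w * ennreal (\<bar>f w\<bar> powr p) \<partial>lborel) \<noteq> \<infinity>"
        by (intro nn_integral_PInf_AE) auto
      then show "AE z in lborel. (\<integral>\<^sup>+w. ?K z w * ennreal \<bar>f w\<bar> \<partial>lborel) < \<infinity>"
      proof eventually_elim
        fix z assume z: "(\<integral>\<^sup>+w. ?K z w * ennreal (\<bar>f w\<bar> powr p) \<partial>lborel) \<noteq> \<infinity>"
        \<comment> \<open>Reduces the integral of the kernel against \<open>f\<close> to the mass of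
          the kernel plus its integral against the p-th power, which is finite almost everywhere by
          Fubini.\<close>
        have "x \<le> 1 + x powr p" if "0 \<le> x" for x :: real
        proof (cases "x \<le> 1")
          case False
          then have "x powr 1 \<le> x powr p" using p by (intro powr_mono) auto
          then show ?thesis using False by simp
        qed (simp add: add_increasing2)
        then have "ennreal \<bar>f w\<bar> \<le> 1 + ennreal (\<bar>f w\<bar> powr p)" for w
          using ennreal_leI[of "\<bar>f w\<bar>" "1 + \<bar>f w\<bar> powr p"] by (simp add: ennreal_plus)
        then have "(\<integral>\<^sup>+w. ?K z w * ennreal \<bar>f w\<bar> \<partial>lborel) \<le> (\<integral>\<^sup>+w. ?K z w * (1 + ennreal (\<bar>f w\<bar> powr p)) \<partial>lborel)"
          by (intro nn_integral_mono mult_left_mono) auto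
        also have "\<dots> = (\<integral>\<^sup>+w. ?K z w \<partial>lborel) + (\<integral>\<^sup>+w. ?K z w * ennreal (\<bar>f w\<bar> powr p) \<partial>lborel)"
          by (simp add: distrib_left nn_integral_add)
        also have "\<dots> < \<infinity>" using K1[of z] z by (simp add: less_top le_less_trans[OF K1[of z]])
        finally show "(\<integral>\<^sup>+w. ?K z w * ennreal \<bar>f w\<bar> \<partial>lborel) < \<infinity>" .
      qed
    }
    fix F assume F: "AE z in lborel. ennreal \<bar>F z\<bar> \<le> (\<integral>\<^sup>+w. ?K z w * ennreal \<bar>f w\<bar> \<partial>lborel)"
    have "(\<integral>\<^sup>+z. ennreal (1 * \<bar>F z\<bar> powr p) \<partial>lborel) \<le> ennreal (S powr p) * Lp_mass p f"
    proof (rule Schur_test[where K="?K" and \<sigma>="\<lambda>_. 1" and s="\<lambda>_. S" and V="\<lambda>_. 1"])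
      show "AE w in lborel. (\<integral>\<^sup>+z. ?K z w * ennreal (1 * S powr (p - 1)) \<partial>lborel) \<le> ennreal (S powr p * 1 powr (p - 1))"
      proof (rule AE_I2)
        fix w :: "real \<times> 'a"
        have "(\<integral>\<^sup>+z. ?K z w * ennreal (1 * S powr (p - 1)) \<partial>lborel) = (\<integral>\<^sup>+z. ?K z w \<partial>lborel) * ennreal (S powr (p - 1))"
          by (simp add: nn_integral_multc)
        also have "\<dots> \<le> ennreal S * ennreal (S powr (p - 1))" by (intro mult_right_mono K2) simp
        also have "\<dots> = ennreal (S * S powr (p - 1))" using S by (simp add: ennreal_mult')
        also have "S * S powr (p - 1) = S powr p" using S by (simp add: powr_diff)
        finally show "(\<integral>\<^sup>+z. ?K z w * ennreal (1 * S powr (p - 1)) \<partial>lborel) \<le> ennreal (S powr p * 1 powr (p - 1))" by simp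
      qed
      show "AE z in lborel. 0 < S \<and> (\<integral>\<^sup>+w. ?K z w * ennreal 1 \<partial>lborel) \<le> ennreal S"
        using S K1 by simp
    qed (use p F in auto)
    then show "Lp_mass p F \<le> ennreal ((C * lam powr (- (\<gamma> / 2))) powr p) * Lp_mass p f"
      by (simp add: S_def)
  qed (rule C)
qed

text \<open>\<open>Fefferman_Phong\<close> for the parabolic norm, with \<open>A = M powr q\<close>.
  Since \<open>\<kappa> * p = \<alpha> - 1\<close>, the factor
  \<open>A powr (\<kappa> * p / q)\<close> becomes \<open>M powr (\<alpha> - 1)\<close>; the
  constant comparing the kernels is moved onto \<open>f\<close>.\<close>

lemma resolvent_Morrey_bound:
  fixes p \<alpha> \<gamma> q :: real
  assumes p: "1 < p" and \<alpha>: "1 < \<alpha>" "\<alpha> < 2" and \<gamma>: "\<gamma> = 2 * ((1 - 1 / \<alpha>) * (1 / p))" and q: "1 < q"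
  shows "\<exists>C>0. \<forall>lam>0. \<forall>\<sigma>\<in>{1, -1}. \<forall>(f :: real \<times> 'a::euclidean_space \<Rightarrow> real) g F v M. f \<in> borel_measurable borel \<longrightarrow>
    g \<in> borel_measurable borel \<longrightarrow> (\<forall>z. 0 \<le> g z) \<longrightarrow> v \<in> morrey_class \<alpha> q \<longrightarrow> morrey_norm \<alpha> q v \<le> ennreal M \<longrightarrow> 0 \<le> M \<longrightarrow>
    (AE w in lebesgue. \<bar>v w\<bar> powr q = g w) \<longrightarrow>
    (AE z in lborel. ennreal \<bar>F z\<bar> \<le> abs_resolvent \<alpha> \<sigma> lam \<gamma> f z) \<longrightarrow>
    (\<integral>\<^sup>+z. ennreal (g z powr ((\<alpha> - 1) / q) * \<bar>F z\<bar> powr p) \<partial>lborel)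
      \<le> ennreal (C * M powr (\<alpha> - 1)) * Lp_mass p f"
proof -
  let ?d = "real DIM('a)"
  interpret P: homogeneous_norm "par_norm \<alpha> :: real \<times> 'a \<Rightarrow> real" "2 * unit_ball_vol ?d" "?d + \<alpha>"
    by (rule homogeneous_norm_par_norm[OF \<alpha>(1)])
  define \<kappa> where "\<kappa> = (\<alpha> - 1) / p"
  have \<gamma>\<kappa>: "\<alpha> * (\<gamma> / 2) = \<kappa>" using \<alpha> p by (simp add: \<gamma> \<kappa>_def field_simps)
  have \<gamma>0: "0 < \<gamma>" unfolding \<gamma> using \<alpha> p by (intro mult_pos_pos) auto
  \<comment> \<open>The last claim combines \<open>\<alpha> < 2\<close> and \<open>1 < q\<close>:
    \<open>\<kappa> * p = \<alpha> - 1 < 1 < q\<close>.\<close>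
  have \<kappa>: "0 < \<kappa>" "\<kappa> * p = \<alpha> - 1" "\<kappa> * p < q" using \<alpha> p q by (auto simp: \<kappa>_def)
  have "\<kappa> < \<alpha> - 1" unfolding \<kappa>_def using \<alpha> p divide_strict_left_mono[of 1 p "\<alpha> - 1"] by simp
  then have \<kappa>D: "\<kappa> < ?d + \<alpha>" using of_nat_0_le_iff[of "DIM('a)", where 'a=real] by linarith
  obtain C where C: "C > 0" and FP: "\<forall>g f F A. 0 \<le> A \<longrightarrow> g \<in> borel_measurable borel \<longrightarrow> f \<in> borel_measurable borel \<longrightarrow>
    (\<forall>z. 0 \<le> g z) \<longrightarrow> (\<forall>r>0. \<forall>z. P.avg r (\<lambda>w. ennreal (g w)) z \<le> ennreal (A * r powr (- q))) \<longrightarrow>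
    (AE z in lborel. ennreal \<bar>F z\<bar> \<le> P.potential \<kappa> (\<lambda>w. ennreal \<bar>f w\<bar>) z) \<longrightarrow>
    (\<integral>\<^sup>+z. ennreal (g z powr (\<kappa> * p / q) * \<bar>F z\<bar> powr p) \<partial>lborel)
      \<le> ennreal (C * A powr (\<kappa> * p / q)) * Lp_mass p f"
    using P.Fefferman_Phong[OF p \<kappa>(1,3)] by (elim exE conjE)
  obtain C1 where C1: "C1 > 0" and kb: "\<And>lam \<sigma> u. 0 < lam \<Longrightarrow> \<sigma> \<in> {1, -1} \<Longrightarrow>
    \<bar>res_kernel \<alpha> \<sigma> lam \<gamma> (u :: real \<times> 'a)\<bar> \<le> C1 * par_norm \<alpha> u powr (\<kappa> - (?d + \<alpha>))"
    using res_kernel_le_par_norm[OF \<alpha> \<gamma>0, where 'a='a] unfolding \<gamma>\<kappa> by blast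
  \<comment> \<open>The factor after \<open>C1\<close> undoes the normalisation
    \<open>1 / (c * (D - \<kappa>))\<close> of the Riesz kernel.\<close>
  define B where "B = C1 * (2 * unit_ball_vol ?d * (?d + \<alpha> - \<kappa>))"
  have B: "B > 0" using C1 \<kappa>D P.c_pos by (simp add: B_def)
  show ?thesis
  proof (intro exI[of _ "C * B powr p"] conjI allI impI ballI)
    show "0 < C * B powr p" using C B by simp
    fix lam \<sigma> :: real and f g F v :: "real \<times> 'a \<Rightarrow> real" and M :: real
    assume lam: "0 < lam" and \<sigma>: "\<sigma> \<in> {1, -1}" and f[measurable]: "f \<in> borel_measurable borel"
      and g[measurable]: "g \<in> borel_measurable borel" and g0: "\<forall>z. 0 \<le> g z"
      and v: "v \<in> morrey_class \<alpha> q" "morrey_norm \<alpha> q v \<le> ennreal M" "0 \<le> M"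
      and vg: "AE w in lebesgue. \<bar>v w\<bar> powr q = g w"
      and F: "AE z in lborel. ennreal \<bar>F z\<bar> \<le> abs_resolvent \<alpha> \<sigma> lam \<gamma> f z"
    have avg: "P.avg r (\<lambda>w. ennreal (g w)) z \<le> ennreal (M powr q * r powr (- q))" if "0 < r" for r z
      using \<alpha> v vg that q by (intro avg_le_of_morrey_norm) auto
    have kr: "AE u in lborel. ennreal \<bar>res_kernel \<alpha> \<sigma> lam \<gamma> (u :: real \<times> 'a)\<bar> \<le> ennreal B * P.riesz_kernel \<kappa> u"
      using P.AE_N_pos
    proof eventually_elim
      fix u :: "real \<times> 'a" assume u: "0 < par_norm \<alpha> u"
      have "ennreal \<bar>res_kernel \<alpha> \<sigma> lam \<gamma> u\<bar> \<le> ennreal (C1 * par_norm \<alpha> u powr (\<kappa> - (?d + \<alpha>)))"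
        by (intro ennreal_leI kb lam \<sigma>)
      also have "C1 * par_norm \<alpha> u powr (\<kappa> - (?d + \<alpha>)) = B * (par_norm \<alpha> u powr (\<kappa> - (?d + \<alpha>)) / (2 * unit_ball_vol ?d * (?d + \<alpha> - \<kappa>)))"
        using less_imp_neq[OF P.c_pos] \<kappa>D by (simp add: B_def)
      also have "ennreal \<dots> = ennreal B * P.riesz_kernel \<kappa> u"
        unfolding P.riesz_kernel_eq[OF u \<kappa>D] using B by (intro ennreal_mult') auto
      finally show "ennreal \<bar>res_kernel \<alpha> \<sigma> lam \<gamma> u\<bar> \<le> ennreal B * P.riesz_kernel \<kappa> u" .
    qed
    have F': "AE z in lborel. ennreal \<bar>F z\<bar> \<le> P.potential \<kappa> (\<lambda>w. ennreal \<bar>B * f w\<bar>) z"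
      using F
    proof eventually_elim
      fix z assume Fz: "ennreal \<bar>F z\<bar> \<le> abs_resolvent \<alpha> \<sigma> lam \<gamma> f z"
      \<comment> \<open>The map from \<open>w\<close> to \<open>z - w\<close> preserves null sets.
        This is expressed by integrating the indicator of the exceptional set and using invariance
        of the integral.\<close>
      have krz: "AE w in lborel. ennreal \<bar>res_kernel \<alpha> \<sigma> lam \<gamma> (z - w)\<bar> \<le> ennreal B * P.riesz_kernel \<kappa> (z - w)"
      proof -
        have "(\<integral>\<^sup>+u. (if ennreal \<bar>res_kernel \<alpha> \<sigma> lam \<gamma> u\<bar> \<le> ennreal B * P.riesz_kernel \<kappa> u then 0 else 1) \<partial>lborel) = 0"
          using kr by (subst nn_integral_0_iff_AE) (auto elim: eventually_mono)
        then have "(\<integral>\<^sup>+w. (if ennreal \<bar>res_kernel \<alpha> \<sigma> lam \<gamma> (z - w)\<bar> \<le> ennreal B * P.riesz_kernel \<kappa> (z - w) then 0 else 1) \<partial>lborel) = 0"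
          by (subst nn_integral_lborel_diff(1)[of "\<lambda>u. if ennreal \<bar>res_kernel \<alpha> \<sigma> lam \<gamma> u\<bar> \<le> ennreal B * P.riesz_kernel \<kappa> u then 0 else 1"]) auto
        then show ?thesis
          by (subst (asm) nn_integral_0_iff_AE) (auto elim!: eventually_mono split: if_splits)
      qed
      note Fz
      also have "abs_resolvent \<alpha> \<sigma> lam \<gamma> f z \<le> P.potential \<kappa> (\<lambda>w. ennreal \<bar>B * f w\<bar>) z"
        unfolding P.potential_def
      proof (rule nn_integral_mono_AE, use krz in eventually_elim)
        fix w assume "ennreal \<bar>res_kernel \<alpha> \<sigma> lam \<gamma> (z - w)\<bar> \<le> ennreal B * P.riesz_kernel \<kappa> (z - w)"
        then have "ennreal \<bar>res_kernel \<alpha> \<sigma> lam \<gamma> (z - w)\<bar> * ennreal \<bar>f w\<bar> \<le> ennreal B * P.riesz_kernel \<kappa> (z - w) * ennreal \<bar>f w\<bar>"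
          by (rule mult_right_mono) simp
        then show "ennreal \<bar>res_kernel \<alpha> \<sigma> lam \<gamma> (z - w)\<bar> * ennreal \<bar>f w\<bar> \<le> P.riesz_kernel \<kappa> (z - w) * ennreal \<bar>B * f w\<bar>"
          using B by (simp add: abs_mult ennreal_mult' mult_ac)
      qed
      finally show "ennreal \<bar>F z\<bar> \<le> P.potential \<kappa> (\<lambda>w. ennreal \<bar>B * f w\<bar>) z" .
    qed
    show "(\<integral>\<^sup>+z. ennreal (g z powr ((\<alpha> - 1) / q) * \<bar>F z\<bar> powr p) \<partial>lborel)
      \<le> ennreal (C * B powr p * M powr (\<alpha> - 1)) * Lp_mass p f"
    proof -
      have "(\<integral>\<^sup>+z. ennreal (g z powr (\<kappa> * p / q) * \<bar>F z\<bar> powr p) \<partial>lborel)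
        \<le> ennreal (C * (M powr q) powr (\<kappa> * p / q)) * (\<integral>\<^sup>+w. ennreal (\<bar>B * f w\<bar> powr p) \<partial>lborel)"
        using avg g0 F' by (intro FP[rule_format]) auto
      also have "(M powr q) powr (\<kappa> * p / q) = M powr (\<alpha> - 1)" using q by (simp add: powr_powr \<kappa>(2))
      also have "(\<integral>\<^sup>+w. ennreal (\<bar>B * f w\<bar> powr p) \<partial>lborel) = ennreal (B powr p) * Lp_mass p f"
        using B by (subst nn_integral_cmult[symmetric]) (auto simp: abs_mult powr_mult ennreal_mult')
      also have "ennreal (C * M powr (\<alpha> - 1)) * (ennreal (B powr p) * Lp_mass p f)
        = ennreal (C * B powr p * M powr (\<alpha> - 1)) * Lp_mass p f"
        using C by (subst mult.assoc[symmetric], subst ennreal_mult'[symmetric]) (auto simp: mult_ac)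
      finally show ?thesis by (simp add: \<kappa>(2))
    qed
  qed
qed

subsection \<open>The theorem\<close>

lemma powr_le_of_le_add:
  fixes x a b p :: real
  assumes "1 < p" "0 \<le> x" "0 \<le> a" "0 \<le> b" "x \<le> a + b"
  shows "x powr (1 / p) \<le> a powr (1 / p) + b powr (1 / p)"
proof -
  have "x powr (1 / p) \<le> (a + b) powr (1 / p)" using assms by (intro powr_mono2) auto
  also have "\<dots> \<le> a powr (1 / p) + b powr (1 / p)" using assms by (intro powr_add_le) auto
  finally show ?thesis .
qed

text \<open>Convergence of the integral almost everywhere is asserted beside the norm bound, because
  \<open>frac_resolvent\<close> takes the default value 0 wherever the integral diverges.\<close>

theorem corollary1:
  fixes \<alpha> p q :: real
  assumes "CARD('d::finite) \<ge> 2"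
    and "1 < \<alpha>" and "\<alpha> < 2"
    and "1 < q" and "q < real CARD('d) + \<alpha>"
    and "1 < p"
  shows "\<exists>c\<^sub>1 c\<^sub>2 :: real. c\<^sub>1 > 0 \<and> c\<^sub>2 > 0 \<and>
    (\<forall>(b :: real \<times> (real ^ 'd) \<Rightarrow> real ^ 'd) b\<^sub>s b\<^sub>b.
       b \<in> borel_measurable lebesgue \<longrightarrow>
       (\<forall>z. b z = b\<^sub>s z + b\<^sub>b z) \<longrightarrow>
       b\<^sub>b \<in> Linf_space \<longrightarrow>
       (\<lambda>z. norm (b\<^sub>s z) powr (1 / (\<alpha> - 1))) \<in> morrey_class \<alpha> q \<longrightarrow>
       (\<forall>lam>0. \<forall>\<sigma>\<in>{1, -1}.
          let \<gamma> = 2 * ((1 - 1 / \<alpha>) * (1 / p)) in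
          (\<forall>f\<in>(Lp_space p :: (real \<times> (real ^ 'd) \<Rightarrow> real) set). AE z in lebesgue. integrable lebesgue (resolvent_integrand \<alpha> \<sigma> lam \<gamma> f z)) \<and>
          Lp_opnorm p (\<lambda>f z. norm (b z) powr (1 / p) * frac_resolvent \<alpha> \<sigma> lam \<gamma> f z)
            \<le> ennreal (c\<^sub>1 * enn2real (morrey_norm \<alpha> q (\<lambda>z. norm (b\<^sub>s z) powr (1 / (\<alpha> - 1)))) powr ((\<alpha> - 1) / p)
                       + c\<^sub>2 * lam powr ((- 1 + 1 / \<alpha>) * (1 / p)) * enn2real (Linf_norm b\<^sub>b) powr (1 / p))))"
proof -
  note \<alpha> = assms(2,3) and q = assms(4) and p = assms(6)
  define \<gamma> where "\<gamma> = 2 * ((1 - 1 / \<alpha>) * (1 / p))"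
  have \<gamma>: "0 < \<gamma>" "\<gamma> < 2"
  proof -
    have x: "0 < 1 - 1 / \<alpha>" "1 - 1 / \<alpha> < 1" and y: "0 < 1 / p" "1 / p < 1" using \<alpha> p by auto
    have "(1 - 1 / \<alpha>) * (1 / p) < 1 * 1"
      by (rule mult_strict_mono[OF x(2) y(2)]) (use y in auto)
    then show "\<gamma> < 2" unfolding \<gamma>_def by linarith
    show "0 < \<gamma>" unfolding \<gamma>_def by (intro mult_pos_pos x y) simp
  qed
  from resolvent_Morrey_bound[OF p \<alpha> \<gamma>_def q, where 'a="real ^ 'd"] resolvent_Lp_bound[OF p \<alpha> \<gamma>, where 'a="real ^ 'd"]
  show ?thesis
    unfolding Let_def \<gamma>_def[symmetric]
  proof (elim exE conjE, goal_cases)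
    case (1 C1 C2)
    note C1 = 1(1) and bound_s = 1(2) and C2 = 1(3) and bound_b = 1(4)
    show ?case
  \<comment> \<open>\<open>C1\<close> bounds p-th powers of norms and needs the root;
    \<open>C2\<close> already bounds the mass of the kernel, that is, a norm.\<close>
  proof (rule exI[of _ "C1 powr (1 / p)"], rule exI[of _ C2], intro conjI allI impI ballI)
    show "C1 powr (1 / p) > 0" "C2 > 0" using C1 C2 by auto
    fix b b\<^sub>s b\<^sub>b :: "real \<times> (real ^ 'd) \<Rightarrow> real ^ 'd" and lam \<sigma> :: real
    assume b: "b \<in> borel_measurable lebesgue" and sum: "\<forall>z. b z = b\<^sub>s z + b\<^sub>b z" and bb: "b\<^sub>b \<in> Linf_space"
      and bs: "(\<lambda>z. norm (b\<^sub>s z) powr (1 / (\<alpha> - 1))) \<in> morrey_class \<alpha> q"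
      and lam: "0 < lam" and \<sigma>: "\<sigma> \<in> {1, -1}"
    define v where "v z = norm (b\<^sub>s z) powr (1 / (\<alpha> - 1))" for z
    define M where "M = enn2real (morrey_norm \<alpha> q v)"
    define B where "B = enn2real (Linf_norm b\<^sub>b)"
    define S where "S = C2 * lam powr (- (\<gamma> / 2))"
    have v: "v \<in> morrey_class \<alpha> q" using bs by (simp add: v_def[abs_def])
    have M: "morrey_norm \<alpha> q v = ennreal M" "0 \<le> M"
      using v by (auto simp: M_def morrey_class_def)
    have B0: "0 \<le> B" by (simp add: B_def)
    have S: "S > 0" using C2 lam by (simp add: S_def)
    have ae_b: "AE z in lebesgue. norm (b\<^sub>b z) \<le> B"
    proof -
      have "Linf_norm b\<^sub>b = ennreal B" using bb by (auto simp: Linf_space_def B_def)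
      then have "AE z in lebesgue. ennreal (norm (b\<^sub>b z)) \<le> ennreal B"
        using esssup_AE[of "\<lambda>z. ennreal (norm (b\<^sub>b z))" lebesgue] by (simp add: Linf_norm_def)
      then show ?thesis using B0 by (auto elim!: eventually_mono)
    qed
    \<comment> \<open>The maximum with 0 makes the Borel representative nonnegative everywhere, not
      only almost everywhere.\<close>
    obtain g where g[measurable]: "g \<in> borel_measurable borel" and g0: "\<And>z. 0 \<le> g z"
      and vg: "AE w in lebesgue. \<bar>v w\<bar> powr q = g w"
    proof -
      have "(\<lambda>w. \<bar>v w\<bar> powr q) \<in> borel_measurable lebesgue"
        using v by (auto simp: morrey_class_def Lp_loc_def)
      from completion_ex_borel_measurable_real[OF this] obtain g0 where
        g0: "g0 \<in> borel_measurable lborel" "AE w in lborel. \<bar>v w\<bar> powr q = g0 w" by auto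
      have "AE w in lebesgue. \<bar>v w\<bar> powr q = max 0 (g0 w)"
        using AE_completion[OF g0(2)] by eventually_elim (metis max.absorb2 powr_ge_zero)
      with g0(1) show ?thesis by (intro that[of "\<lambda>w. max 0 (g0 w)"]) auto
    qed
    have vb: "(\<bar>v w\<bar> powr q) powr ((\<alpha> - 1) / q) = norm (b\<^sub>s w)" for w
      using \<alpha> q by (simp add: v_def powr_powr)
    \<comment> \<open>The weight enters with exponent one in the p-th power, so
      \<open>norm b\<close> splits linearly into its two parts before any root is taken.\<close>
    have main: "(AE z in lebesgue. integrable lebesgue (resolvent_integrand \<alpha> \<sigma> lam \<gamma> f z)) \<and>
      frac_resolvent \<alpha> \<sigma> lam \<gamma> f \<in> borel_measurable borel \<and>
      (\<integral>\<^sup>+z. ennreal (norm (b z) * \<bar>frac_resolvent \<alpha> \<sigma> lam \<gamma> f z\<bar> powr p) \<partial>lebesgue)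
        \<le> ennreal (C1 * M powr (\<alpha> - 1) + B * S powr p) * (\<integral>\<^sup>+w. ennreal (\<bar>f w\<bar> powr p) \<partial>lebesgue)"
      if f: "f \<in> Lp_space p" for f :: "real \<times> (real ^ 'd) \<Rightarrow> real"
    proof -
      have fm: "f \<in> borel_measurable lebesgue" and fi: "integrable lebesgue (\<lambda>z. \<bar>f z\<bar> powr p)"
        using f by (auto simp: Lp_space_def)
      obtain f' where f'[measurable]: "f' \<in> borel_measurable borel" and "AE w in lborel. f w = f' w"
        using completion_ex_borel_measurable_real[OF fm] by auto
      then have ff': "AE w in lebesgue. f w = f' w" by (intro AE_completion)
      let ?F = "frac_resolvent \<alpha> \<sigma> lam \<gamma> f"
      let ?G = "abs_resolvent \<alpha> \<sigma> lam \<gamma> f'"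
      note Feq = frac_resolvent_lborel[OF fm f' ff', of \<alpha> \<sigma> lam \<gamma>]
      have Fm: "?F \<in> borel_measurable borel"
        unfolding Feq(1)[abs_def] by measurable
      have FG: "ennreal \<bar>?F z\<bar> \<le> ?G z" for z
        using abs_integral_le_nn_integral[of lborel "\<lambda>w. res_kernel \<alpha> \<sigma> lam \<gamma> (z - w) * f' w"] unfolding Feq(1)
        by (simp add: abs_mult ennreal_mult')
      have \<Phi>: "Lp_mass p f' = (\<integral>\<^sup>+w. ennreal (\<bar>f w\<bar> powr p) \<partial>lebesgue)"
        unfolding nn_integral_completion[of lborel, symmetric]
        using ff' by (intro nn_integral_cong_AE) (auto elim: eventually_mono)
      have "(\<integral>\<^sup>+w. ennreal (\<bar>f w\<bar> powr p) \<partial>lebesgue) < \<infinity>"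
        using nn_integral_eq_integral[OF fi] by simp
      then have "AE z in lborel. ?G z < \<infinity>"
        using bound_b[rule_format, OF lam \<sigma> f'] \<Phi> by simp
      then have "AE z in lebesgue. ?G z < \<infinity>" by (rule AE_completion)
      then have int: "AE z in lebesgue. integrable lebesgue (resolvent_integrand \<alpha> \<sigma> lam \<gamma> f z)"
      proof eventually_elim
        fix z assume "?G z < \<infinity>"
        then show "integrable lebesgue (resolvent_integrand \<alpha> \<sigma> lam \<gamma> f z)"
          unfolding Feq(2) by (intro integrableI_bounded) (auto simp: abs_mult ennreal_mult')
      qed
      have bs_le: "(\<integral>\<^sup>+z. ennreal (g z powr ((\<alpha> - 1) / q) * \<bar>?F z\<bar> powr p) \<partial>lborel)
        \<le> ennreal (C1 * M powr (\<alpha> - 1)) * Lp_mass p f'"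
        using M by (intro bound_s[rule_format, OF lam \<sigma> f' g g0 v _ _ vg AE_I2[OF FG]]) auto
      have bb_le: "Lp_mass p ?F
        \<le> ennreal (S powr p) * Lp_mass p f'"
        unfolding S_def by (rule bound_b[rule_format, OF lam \<sigma> f', THEN conjunct2, rule_format, OF AE_I2[OF FG]])
      have "(\<integral>\<^sup>+z. ennreal (norm (b z) * \<bar>?F z\<bar> powr p) \<partial>lebesgue)
        \<le> (\<integral>\<^sup>+z. ennreal (g z powr ((\<alpha> - 1) / q) * \<bar>?F z\<bar> powr p) + ennreal B * ennreal (\<bar>?F z\<bar> powr p) \<partial>lebesgue)"
      proof (rule nn_integral_mono_AE, use vg ae_b in eventually_elim)
        fix z assume gz: "\<bar>v z\<bar> powr q = g z" and bz: "norm (b\<^sub>b z) \<le> B"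
        have "norm (b z) \<le> norm (b\<^sub>s z) + norm (b\<^sub>b z)" using sum norm_triangle_ineq by metis
        also have "\<dots> \<le> g z powr ((\<alpha> - 1) / q) + B" using vb[of z] gz bz by simp
        finally have "ennreal (norm (b z) * \<bar>?F z\<bar> powr p) \<le> ennreal ((g z powr ((\<alpha> - 1) / q) + B) * \<bar>?F z\<bar> powr p)"
          by (intro ennreal_leI mult_right_mono) auto
        also have "\<dots> = ennreal (g z powr ((\<alpha> - 1) / q) * \<bar>?F z\<bar> powr p) + ennreal B * ennreal (\<bar>?F z\<bar> powr p)"
          using B0 by (subst ennreal_mult'[symmetric], simp, subst ennreal_plus[symmetric]) (auto simp: distrib_right)
        finally show "ennreal (norm (b z) * \<bar>?F z\<bar> powr p) \<le> \<dots>" .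
      qed
      also have "\<dots> = (\<integral>\<^sup>+z. ennreal (g z powr ((\<alpha> - 1) / q) * \<bar>?F z\<bar> powr p) + ennreal B * ennreal (\<bar>?F z\<bar> powr p) \<partial>lborel)"
        by (rule nn_integral_completion)
      also have "\<dots> = (\<integral>\<^sup>+z. ennreal (g z powr ((\<alpha> - 1) / q) * \<bar>?F z\<bar> powr p) \<partial>lborel) + ennreal B * Lp_mass p ?F"
        using Fm by (subst nn_integral_add) (auto simp: nn_integral_cmult)
      also have "\<dots> \<le> ennreal (C1 * M powr (\<alpha> - 1)) * Lp_mass p f'
        + ennreal B * (ennreal (S powr p) * Lp_mass p f')"
        by (intro add_mono mult_left_mono bs_le bb_le) simp
      also have "\<dots> = (ennreal (C1 * M powr (\<alpha> - 1)) + ennreal (B * S powr p)) * Lp_mass p f'"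
        using B0 by (simp add: distrib_right ennreal_mult' mult.assoc)
      also have "ennreal (C1 * M powr (\<alpha> - 1)) + ennreal (B * S powr p) = ennreal (C1 * M powr (\<alpha> - 1) + B * S powr p)"
        using C1 B0 by (intro ennreal_plus[symmetric]) auto
      finally show ?thesis using int Fm unfolding \<Phi> by blast
    qed
    show "AE z in lebesgue. integrable lebesgue (resolvent_integrand \<alpha> \<sigma> lam \<gamma> f z)"
      if "f \<in> Lp_space p" for f :: "real \<times> (real ^ 'd) \<Rightarrow> real"
      using main[OF that] by blast
    let ?X = "C1 * M powr (\<alpha> - 1) + B * S powr p"
    have X: "0 \<le> ?X" using C1 B0 by simp
    \<comment> \<open>The p-th root is subadditive, so the two terms separate with no additional
      constant.\<close>
    have rhs: "?X powr (1 / p) \<le> C1 powr (1 / p) * M powr ((\<alpha> - 1) / p) + C2 * lam powr ((- 1 + 1 / \<alpha>) * (1 / p)) * B powr (1 / p)"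
    proof -
      have "- (\<gamma> / 2) = (- 1 + 1 / \<alpha>) * (1 / p)" unfolding \<gamma>_def by (simp add: algebra_simps diff_divide_distrib)
      then have S_eq: "C2 * lam powr ((- 1 + 1 / \<alpha>) * (1 / p)) = S" by (simp only: S_def)
      have "?X powr (1 / p) \<le> (C1 * M powr (\<alpha> - 1)) powr (1 / p) + (B * S powr p) powr (1 / p)"
        using p C1 B0 X by (intro powr_le_of_le_add) auto
      also have "(C1 * M powr (\<alpha> - 1)) powr (1 / p) = C1 powr (1 / p) * M powr ((\<alpha> - 1) / p)"
        using C1 by (simp add: powr_mult powr_powr)
      also have "(B * S powr p) powr (1 / p) = S * B powr (1 / p)"
        using B0 S p by (simp add: powr_mult powr_powr)
      finally show ?thesis unfolding S_eq .
    qed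
    have "Lp_opnorm p (\<lambda>f z. norm (b z) powr (1 / p) * frac_resolvent \<alpha> \<sigma> lam \<gamma> f z) \<le> ennreal (?X powr (1 / p))"
      unfolding Lp_opnorm_def
    proof (rule SUP_least)
      fix f :: "real \<times> (real ^ 'd) \<Rightarrow> real"
      assume "f \<in> {f \<in> Lp_space p. Lp_norm p f \<le> 1}"
      then have f: "f \<in> Lp_space p" and le1: "Lp_norm p f \<le> 1" by auto
      let ?F = "frac_resolvent \<alpha> \<sigma> lam \<gamma> f"
      let ?h = "\<lambda>z. norm (b z) powr (1 / p) * ?F z"
      have Fm: "?F \<in> borel_measurable lebesgue"
        using main[OF f] by (intro measurable_completion) simp
      have hm: "?h \<in> borel_measurable lebesgue" using b Fm by measurable
      have hp: "\<bar>?h z\<bar> powr p = norm (b z) * \<bar>?F z\<bar> powr p" for z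
        using p by (simp add: abs_mult powr_mult powr_powr)
      have fi: "integrable lebesgue (\<lambda>z. \<bar>f z\<bar> powr p)" using f by (simp add: Lp_space_def)
      define I where "I = (LINT z|lebesgue. \<bar>f z\<bar> powr p)"
      have I0: "I \<ge> 0" by (simp add: I_def)
      have "ennreal (I powr (1 / p)) \<le> 1" using le1 f by (simp add: Lp_norm_def I_def)
      then have "I powr (1 / p) \<le> 1" by (simp flip: ennreal_1)
      then have "(I powr (1 / p)) powr p \<le> 1 powr p" using p by (intro powr_mono2) auto
      then have I1: "I \<le> 1" using I0 p by (simp add: powr_powr)
      have "(\<integral>\<^sup>+z. ennreal (\<bar>?h z\<bar> powr p) \<partial>lebesgue) \<le> ennreal ?X * (\<integral>\<^sup>+w. ennreal (\<bar>f w\<bar> powr p) \<partial>lebesgue)"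
        unfolding hp using main[OF f] by blast
      also have "\<dots> = ennreal ?X * ennreal I" using nn_integral_eq_integral[OF fi] by (simp add: I_def)
      also have "\<dots> \<le> ennreal ?X * ennreal 1" by (intro mult_left_mono ennreal_leI I1) simp
      finally have nn: "(\<integral>\<^sup>+z. ennreal (\<bar>?h z\<bar> powr p) \<partial>lebesgue) \<le> ennreal ?X" by simp
      \<comment> \<open>\<open>Lp_norm\<close> is infinite outside \<open>Lp_space\<close>, so
        membership of the image must be settled before its norm can be estimated.\<close>
      have hi: "integrable lebesgue (\<lambda>z. \<bar>?h z\<bar> powr p)"
        using hm nn by (intro integrableI_bounded) (auto simp: le_less_trans)
      then have hL: "?h \<in> Lp_space p" using hm by (simp add: Lp_space_def)
      have "ennreal (LINT z|lebesgue. \<bar>?h z\<bar> powr p) \<le> ennreal ?X"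
        using nn nn_integral_eq_integral[OF hi] by simp
      then have "(LINT z|lebesgue. \<bar>?h z\<bar> powr p) \<le> ?X" using X by (simp add: ennreal_le_iff)
      then have "(LINT z|lebesgue. \<bar>?h z\<bar> powr p) powr (1 / p) \<le> ?X powr (1 / p)"
        using p by (intro powr_mono2) auto
      then show "Lp_norm p ?h \<le> ennreal (?X powr (1 / p))"
        unfolding Lp_norm_def using hL by (simp add: ennreal_leI)
    qed
    also have "\<dots> \<le> ennreal (C1 powr (1 / p) * M powr ((\<alpha> - 1) / p) + C2 * lam powr ((- 1 + 1 / \<alpha>) * (1 / p)) * B powr (1 / p))"
      by (rule ennreal_leI[OF rhs])
    finally show "Lp_opnorm p (\<lambda>f z. norm (b z) powr (1 / p) * frac_resolvent \<alpha> \<sigma> lam \<gamma> f z)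
      \<le> ennreal (C1 powr (1 / p) * enn2real (morrey_norm \<alpha> q (\<lambda>z. norm (b\<^sub>s z) powr (1 / (\<alpha> - 1)))) powr ((\<alpha> - 1) / p)
                 + C2 * lam powr ((- 1 + 1 / \<alpha>) * (1 / p)) * enn2real (Linf_norm b\<^sub>b) powr (1 / p))"
      by (simp add: M_def B_def v_def[abs_def])
  qed
  qed
qed

end
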